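(* Let $p$ be a prime and let $\{X_{n,k}:n\in\mathbb{N},\ k=1,\ldots,K_n\}$ be a rowwise independent array of random elements in the $p$-adic solenoid $S_p$. Suppose that there exist $a=(a_0,a_1,\ldots)\in S_p$, a real number $b\ge0$ and a Lévy measure $\eta$ on $S_p$ such that (i) $\max_{1\le k\le K_n}\mathrm{P}\bigl(\exists\,j\le d:|\arg((X_{n,k})_j)|>\varepsilon\bigr)\to0$ as $n\to\infty$ for all $d\in\mathbb{Z}_+$, $\varepsilon>0$, (ii) $\exp\left\{\frac{i}{p^d}\sum_{k=1}^{K_n}\mathrm{E}\,h(\arg((X_{n,k})_0))\right\}\to a_d$ as $n\to\infty$ for all $d\in\mathbb{Z}_+$, (iii) $\sum_{k=1}^{K_n}\mathrm{Var}\,h(\arg((X_{n,k})_0))\to b+\int_{S_p}h(\arg(y_0))^2\,d\eta(y)$ as $n\to\infty$, (iv) $\sum_{k=1}^{K_n}\mathrm{E}\,f(X_{n,k})\to\int_{S_p}f\,d\eta$ as $n\to\infty$ for all $f\in\mathcal{C}_0(S_p)$. Then the array $\{X_{n,k}\}$ is infinitesimal, and the distribution of $\sum_{k=1}^{K_n}X_{n,k}$ converges weakly to $\delta_a*\gamma_{\psi_b}*\pi_{\eta,\,g_{S_p}}$ as $n\to\infty$.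
   Context: $\mathbb{N}$ and $\mathbb{Z}_+$ are the sets of positive and of nonnegative integers. $\mathbb{T}=\{e^{ix}:-\pi\le x<\pi\}$ is the circle group under multiplication. $S_p=\{(y_0,y_1,\ldots)\in\mathbb{T}^\infty:y_j=y_{j+1}^p\text{ for all }j\in\mathbb{Z}_+\}$, a compact Abelian group under coordinatewise multiplication with the topology inherited from the product topology; its identity is $e=(1,1,\ldots)$. $\sum_{k=1}^{K_n}X_{n,k}$ denotes the group operation (coordinatewise product) applied to $X_{n,1},\ldots,X_{n,K_n}$, and $(X_{n,k})_j$ is the $j$-th coordinate. The characters of $S_p$ are $\chi_{d,\ell}(y)=y_d^\ell$, $d\in\mathbb{Z}_+$, $\ell\in\mathbb{Z}$. $\arg:\mathbb{T}\to[-\pi,\pi)$ is given by $\arg(e^{ix})=x$ for $-\pi\le x<\pi$. The function $h:\mathbb{R}\to\mathbb{R}$ is: $h(x)=0$ if $x<-\pi$ or $x\ge\pi$; $h(x)=-x-\pi$ if $-\pi\le x<-\pi/2$; $h(x)=x$ if $-\pi/2\le x<\pi/2$; $h(x)=-x+\pi$ if $\pi/2\le x<\pi$. Put $g_{S_p}(y,\chi_{d,\ell})=\ell\,h(\arg y_0)/p^d$. A Borel neighbourhood of $e$ is a Borel set containing an open set that contains $e$. Rowwise independent: for each $n$, $X_{n,1},\ldots,X_{n,K_n}$ are independent. Infinitesimal: $\lim_{n\to\infty}\max_{1\le k\le K_n}\mathrm{P}(X_{n,k}\in S_p\setminus U)=0$ for every Borel neighbourhood $U$ of $e$. $\mathcal{C}_0(S_p)$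 is the set of real-valued bounded continuous functions on $S_p$ vanishing on some Borel neighbourhood of $e$. A Lévy measure on $S_p$ is a $[0,\infty]$-valued Borel measure $\eta$ on $S_p$ with $\eta(\{e\})=0$, $\eta(S_p\setminus U)<\infty$ for every Borel neighbourhood $U$ of $e$, and $\int_{S_p}(1-\mathrm{Re}\,\chi(y))\,d\eta(y)<\infty$ for every character $\chi$ of $S_p$. $\delta_a$ is the Dirac measure at $a$ and $*$ is convolution. $\gamma_{\psi_b}$ is the probability measure on $S_p$ with $\int_{S_p}y_d^\ell\,d\gamma_{\psi_b}(y)=\exp\{-b\ell^2/(2p^{2d})\}$ for all $d\in\mathbb{Z}_+$, $\ell\in\mathbb{Z}$. $\pi_{\eta,\,g_{S_p}}$ is the probability measure on $S_p$ with $\int_{S_p}y_d^\ell\,d\pi_{\eta,\,g_{S_p}}(y)=\exp\left\{\int_{S_p}\bigl(y_d^\ell-1-i\ell h(\arg y_0)/p^d\bigr)\,d\eta(y)\right\}$ for all $d\in\mathbb{Z}_+$, $\ell\in\mathbb{Z}$. (These measures exist and are uniquely determined.) *)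

theory Defs
  imports "HOL-Probability.Probability"
begin

definition circle :: "complex set" where
  "circle = {cis x |x. -pi \<le> x \<and> x < pi}"

text \<open>The solenoid is a subset of the type of all complex sequences. The topology of that type
  is the product topology, so \<open>top_of_set (solenoid p)\<close>, \<open>continuous_on (solenoid p)\<close> and
  \<open>restrict_space borel (solenoid p)\<close> all refer to the topology inherited from it.\<close>

definition solenoid :: "nat \<Rightarrow> (nat \<Rightarrow> complex) set" where
  "solenoid p = {y. (\<forall>j. y j \<in> circle) \<and> (\<forall>j. y j = y (Suc j) ^ p)}"

definition sol_borel :: "nat \<Rightarrow> (nat \<Rightarrow> complex) measure" where
  "sol_borel p = restrict_space borel (solenoid p)"

definition sol_one :: "nat \<Rightarrow> complex" where
  "sol_one = (\<lambda>j. 1)"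

definition sol_mult :: "(nat \<Rightarrow> complex) \<Rightarrow> (nat \<Rightarrow> complex) \<Rightarrow> nat \<Rightarrow> complex" where
  "sol_mult y z = (\<lambda>j. y j * z j)"

definition sol_prod :: "('i \<Rightarrow> nat \<Rightarrow> complex) \<Rightarrow> 'i set \<Rightarrow> nat \<Rightarrow> complex" where
  "sol_prod y I = (\<lambda>j. \<Prod>k\<in>I. y k j)"

text \<open>These are all the (continuous) characters of the solenoid.\<close>

definition sol_char :: "nat \<Rightarrow> int \<Rightarrow> (nat \<Rightarrow> complex) \<Rightarrow> complex" where
  "sol_char d l y = y d powi l"

text \<open>The argument takes values in \<open>[-\<pi>, \<pi>)\<close>; the library's \<^const>\<open>Arg\<close> uses \<open>(-\<pi>, \<pi>]\<close>.\<close>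

definition circ_arg :: "complex \<Rightarrow> real" where
  "circ_arg z = (THE x. -pi \<le> x \<and> x < pi \<and> cis x = z)"

definition h_fun :: "real \<Rightarrow> real" where
  "h_fun x = (if x < -pi \<or> pi \<le> x then 0
              else if x < -pi/2 then -x - pi
              else if x < pi/2 then x
              else -x + pi)"

definition g_sol :: "nat \<Rightarrow> (nat \<Rightarrow> complex) \<Rightarrow> nat \<Rightarrow> int \<Rightarrow> real" where
  "g_sol p y d l = of_int l * h_fun (circ_arg (y 0)) / of_nat p ^ d"

definition borel_nbhd :: "nat \<Rightarrow> (nat \<Rightarrow> complex) set \<Rightarrow> bool" where
  "borel_nbhd p U \<longleftrightarrow> U \<in> sets (sol_borel p) \<and>
     (\<exists>V. openin (top_of_set (solenoid p)) V \<and> sol_one \<in> V \<and> V \<subseteq> U)"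

definition C0_sol :: "nat \<Rightarrow> ((nat \<Rightarrow> complex) \<Rightarrow> real) set" where
  "C0_sol p = {f. continuous_on (solenoid p) f \<and> bounded (f ` solenoid p) \<and>
                  (\<exists>U. borel_nbhd p U \<and> (\<forall>y\<in>U. f y = 0))}"

definition levy_measure :: "nat \<Rightarrow> (nat \<Rightarrow> complex) measure \<Rightarrow> bool" where
  "levy_measure p \<eta> \<longleftrightarrow> sets \<eta> = sets (sol_borel p) \<and>
     emeasure \<eta> {sol_one} = 0 \<and>
     (\<forall>U. borel_nbhd p U \<longrightarrow> emeasure \<eta> (solenoid p - U) < \<infinity>) \<and>
     (\<forall>d l. (\<integral>\<^sup>+y. ennreal (1 - Re (sol_char d l y)) \<partial>\<eta>) < \<infinity>)"

definition infinitesimal ::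
  "nat \<Rightarrow> 'w measure \<Rightarrow> (nat \<Rightarrow> nat) \<Rightarrow> (nat \<Rightarrow> nat \<Rightarrow> 'w \<Rightarrow> nat \<Rightarrow> complex) \<Rightarrow> bool" where
  "infinitesimal p M K X \<longleftrightarrow>
     (\<forall>U. borel_nbhd p U \<longrightarrow>
       (\<lambda>n. MAX k\<in>{1..K n}. measure M {\<omega> \<in> space M. X n k \<omega> \<in> solenoid p - U}) \<longlonglongrightarrow> 0)"

definition sol_weak_conv ::
  "nat \<Rightarrow> (nat \<Rightarrow> (nat \<Rightarrow> complex) measure) \<Rightarrow> (nat \<Rightarrow> complex) measure \<Rightarrow> bool" where
  "sol_weak_conv p \<mu> \<nu> \<longleftrightarrow>
     (\<forall>f :: (nat \<Rightarrow> complex) \<Rightarrow> real.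
        continuous_on (solenoid p) f \<and> bounded (f ` solenoid p) \<longrightarrow>
        (\<lambda>n. \<integral>y. f y \<partial>\<mu> n) \<longlonglongrightarrow> (\<integral>y. f y \<partial>\<nu>))"

definition sol_conv ::
  "nat \<Rightarrow> (nat \<Rightarrow> complex) measure \<Rightarrow> (nat \<Rightarrow> complex) measure \<Rightarrow> (nat \<Rightarrow> complex) measure" where
  "sol_conv p \<mu> \<nu> = distr (\<mu> \<Otimes>\<^sub>M \<nu>) (sol_borel p) (\<lambda>(y, z). sol_mult y z)"

text \<open>The probability measure on the solenoid with Fourier transform \<open>\<phi>\<close>; meaningful only if there is one.
  Uniqueness then holds because the characters span a dense algebra of continuous functions.\<close>

definition sol_measure_of :: "nat \<Rightarrow> (nat \<Rightarrow> int \<Rightarrow> complex) \<Rightarrow> (nat \<Rightarrow> complex) measure" where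
  "sol_measure_of p \<phi> =
     (THE \<mu>. prob_space \<mu> \<and> sets \<mu> = sets (sol_borel p) \<and>
             (\<forall>d l. (\<integral>y. sol_char d l y \<partial>\<mu>) = \<phi> d l))"

definition gauss_sol :: "nat \<Rightarrow> real \<Rightarrow> (nat \<Rightarrow> complex) measure" where
  "gauss_sol p b =
     sol_measure_of p (\<lambda>d l. of_real (exp (- b * (of_int l)\<^sup>2 / (2 * of_nat p ^ (2 * d)))))"

definition gen_poisson_sol :: "nat \<Rightarrow> (nat \<Rightarrow> complex) measure \<Rightarrow> (nat \<Rightarrow> complex) measure" where
  "gen_poisson_sol p \<eta> =
     sol_measure_of p
       (\<lambda>d l. exp (\<integral>y. (sol_char d l y - 1 - \<i> * of_real (g_sol p y d l)) \<partial>\<eta>))"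

end

theory Submission
  imports Defs "HOL-Computational_Algebra.Primes"
begin

text \<open>
  On the circle \<open>h (arg z) = arcsin (Im z)\<close>, so all functions involved are continuous on the compact
  solenoid. By Stone--Weierstrass, Fourier coefficients determine a law, and their convergence implies weak
  convergence. The Gaussian law is the image of a normal law under the one-parameter subgroup
  \<open>t \<mapsto> (cis (t / p^j))\<^sub>j\<close>; the generalized Poisson law is the law of an almost surely convergent
  infinite product of centred compound Poisson variables, one for each shell of the Levy measure.
  For the rows, each character is centred by the mean \<open>m\<close> of \<open>h (arg (X 0))\<close> before it is expanded
  to second order: the sum of the \<open>m\<^sup>2\<close> over a row need not stay bounded, only the sum of the variances does.
\<close>

section \<open>The solenoid and its characters\<close>

text \<open>For a fixed character \<open>sol_char d l\<close> everything is measured by the one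
  distance |y_d - 1|. Coordinate 0 is a power of coordinate d, so within radius 1/(4 p^d) of 1 the
  character is exactly exp(i theta H), where theta = l/p^d and H = h(arg y_0); closeness of y_0 to 1
  alone would say little about y_d. The second-order remainder of a centred character then has two
  regimes. Near the identity it is of third order in H - m, hence a small multiple of (H - m)^2,
  whose row sums are bounded by (iii). Away from the identity, replacing m by 0 costs O(|m|), and
  the uncentred remainder F, cut off near e, is a test function for (iv). So the row sums tend to
  the integral of F. As F exceeds the integrand J of the Poisson exponent by theta^2 H^2 / 2, the
  integral of H^2 in (iii) cancels, and -b theta^2 / 2 plus the integral of J is left. Condition (i)
  makes all factors uniformly close to 1, so that their product may be replaced by the exponential
  of the sum of their deviations from 1; (ii) restores the means removed by centring.\<close>

lemma circle_eq: "circle = {z. cmod z = 1}"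
proof (intro set_eqI iffI)
  fix z assume "z \<in> {z. cmod z = 1}"
  then have z: "cmod z = 1" by simp
  then have c: "cis (Arg z) = z" by (metis cis_Arg divide_self_if norm_zero sgn_eq scaleR_one div_by_1 of_real_1 zero_neq_one)
  show "z \<in> circle"
  proof (cases "Arg z = pi")
    case True
    then have "z = cis (-pi)" using c by (simp add: complex_eq_iff)
    then show ?thesis unfolding circle_def by force
  next
    case False
    then have "-pi \<le> Arg z \<and> Arg z < pi" using Arg_bounded[of z] by auto
    then show ?thesis unfolding circle_def using c by force
  qed
qed (auto simp: circle_def)

lemma norm_circle: "z \<in> circle \<Longrightarrow> cmod z = 1"
  by (simp add: circle_eq)

lemma cis_inj_on_arg_range:
  assumes "-pi \<le> x" "x < pi" "-pi \<le> y" "y < pi" "cis x = cis y"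
  shows "x = y"
proof -
  have "sin x = sin y \<and> cos x = cos y" using assms(5) by (simp add: complex_eq_iff)
  then obtain n where n: "x = y + 2 * pi * real_of_int n" using sin_cos_eq_iff by metis
  have "\<bar>2 * pi * real_of_int n\<bar> < 2 * pi" using n assms by auto
  then have "\<bar>real_of_int n\<bar> < 1" by (simp add: abs_mult)
  then have "n = 0" by linarith
  then show ?thesis using n by simp
qed

lemma circ_arg_cis:
  assumes "-pi \<le> x" "x < pi"
  shows "circ_arg (cis x) = x"
  unfolding circ_arg_def using assms by (intro the_equality) (auto intro: cis_inj_on_arg_range)

lemma circ_arg:
  assumes "z \<in> circle"
  shows "-pi \<le> circ_arg z" "circ_arg z < pi" "cis (circ_arg z) = z"
  using assms by (auto simp: circle_def circ_arg_cis)

lemma h_fun_circ_arg: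
  assumes "z \<in> circle"
  shows "h_fun (circ_arg z) = arcsin (Im z)"
proof -
  define x where "x = circ_arg z"
  have x: "-pi \<le> x" "x < pi" "z = cis x" using circ_arg[OF assms] by (auto simp: x_def)
  consider "x < -pi/2" | "-pi/2 \<le> x" "x < pi/2" | "pi/2 \<le> x" by linarith
  then have "h_fun x = arcsin (sin x)"
  proof cases
    case 1
    have "sin x = sin (-x - pi)" by (simp add: sin_diff)
    moreover have "arcsin (sin (-x - pi)) = -x - pi" using 1 x by (intro arcsin_sin) auto
    ultimately show ?thesis using 1 x by (simp add: h_fun_def)
  next
    case 2 then show ?thesis by (simp add: h_fun_def arcsin_sin)
  next
    case 3
    have "sin x = sin (-x + pi)" by (simp add: sin_diff)
    moreover have "arcsin (sin (-x + pi)) = -x + pi" using 3 x by (intro arcsin_sin) auto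
    ultimately show ?thesis using 3 x by (simp add: h_fun_def)
  qed
  also have "sin x = Im z" using x(3) by simp
  finally show ?thesis by (simp add: x_def)
qed

text \<open>Cosine is strictly decreasing on [0, pi]. This turns events about the discontinuous
  \<open>circ_arg\<close> into conditions on the continuous function \<open>Re\<close>, which
  settles their measurability.\<close>

lemma abs_circ_arg_gt_iff:
  assumes "z \<in> circle" "0 \<le> e" "e < pi"
  shows "e < \<bar>circ_arg z\<bar> \<longleftrightarrow> Re z < cos e"
proof -
  have b: "\<bar>circ_arg z\<bar> \<le> pi" using circ_arg[OF assms(1)] by auto
  have "Re z = cos \<bar>circ_arg z\<bar>" using circ_arg(3)[OF assms(1)] by (metis cis.simps(1) cos_abs_real)
  then show ?thesis using cos_mono_less_eq[of "\<bar>circ_arg z\<bar>" e] b assms by auto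
qed

lemma solenoid_circle: "y \<in> solenoid p \<Longrightarrow> y j \<in> circle"
  unfolding solenoid_def by blast

lemma solenoid_norm: "y \<in> solenoid p \<Longrightarrow> cmod (y j) = 1"
  by (simp add: norm_circle solenoid_circle)

lemma solenoid_nonzero: "y \<in> solenoid p \<Longrightarrow> y j \<noteq> 0"
  using solenoid_norm[of y p j] by auto

lemma solenoid_Suc: "y \<in> solenoid p \<Longrightarrow> y (Suc j) ^ p = y j"
  unfolding solenoid_def by (drule CollectD, drule conjunct2, erule allE, erule sym)

lemma solenoidI: "(\<And>j. cmod (y j) = 1) \<Longrightarrow> (\<And>j. y (Suc j) ^ p = y j) \<Longrightarrow> y \<in> solenoid p"
  unfolding solenoid_def circle_eq by (intro CollectI conjI allI) (simp, erule meta_allE, erule sym)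

lemma solenoid_power:
  assumes "y \<in> solenoid p"
  shows "y (d + k) ^ (p ^ k) = y d"
proof (induction k)
  case (Suc k)
  have "y (d + Suc k) ^ (p ^ Suc k) = (y (Suc (d + k)) ^ p) ^ (p ^ k)" by (simp add: power_mult)
  also have "y (Suc (d + k)) ^ p = y (d + k)" using assms by (simp add: solenoid_Suc)
  finally show ?case using Suc by simp
qed simp

lemma norm_sol_char: "y \<in> solenoid p \<Longrightarrow> cmod (sol_char d l y) = 1"
  by (simp add: sol_char_def norm_power_int solenoid_norm)

text \<open>y_d is the p^k-th power of y_{d+k}. Raising the level in this way brings two characters
  to a common coordinate, where they can be multiplied.\<close>

lemma sol_char_lift:
  assumes "y \<in> solenoid p"
  shows "sol_char d l y = sol_char (d + k) (int (p ^ k) * l) y"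
proof -
  have "y d powi l = (y (d + k) powi int (p ^ k)) powi l"
    using solenoid_power[OF assms, of d k] by (simp only: power_int_of_nat)
  then show ?thesis unfolding sol_char_def by (simp only: power_int_mult)
qed

lemma sol_one_in [simp]: "sol_one \<in> solenoid p"
  by (rule solenoidI) (simp_all add: sol_one_def)

lemma sol_mult_in: "y \<in> solenoid p \<Longrightarrow> z \<in> solenoid p \<Longrightarrow> sol_mult y z \<in> solenoid p"
  by (rule solenoidI) (simp_all add: sol_mult_def norm_mult solenoid_norm power_mult_distrib solenoid_Suc)

lemma sol_prod_in: "(\<And>k. k \<in> I \<Longrightarrow> y k \<in> solenoid p) \<Longrightarrow> sol_prod y I \<in> solenoid p"
  by (rule solenoidI)
     (auto simp: sol_prod_def prod_norm[symmetric] prod_power_distrib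
       intro!: prod.neutral prod.cong solenoid_norm solenoid_Suc)

lemma sol_char_mult: "sol_char d l (sol_mult y z) = sol_char d l y * sol_char d l z"
  by (simp add: sol_char_def sol_mult_def power_int_mult_distrib)

lemma sol_char_prod: "sol_char d l (sol_prod y I) = (\<Prod>k\<in>I. sol_char d l (y k))"
  unfolding sol_char_def sol_prod_def by (induction I rule: infinite_finite_induct) (auto simp: power_int_mult_distrib)

section \<open>Topology of the solenoid, measurability and integrability\<close>

lemma continuous_on_sol_coord [continuous_intros]: "continuous_on S (\<lambda>y :: nat \<Rightarrow> complex. y j)"
  by (rule continuous_on_product_then_coordinatewise[OF continuous_on_id])

text \<open>Tychonoff's theorem for the product of unit circles, intersected with the closed
  relations between neighbouring coordinates.\<close>

lemma compact_solenoid: "compact (solenoid p)"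
proof -
  have "compactin (product_topology (\<lambda>_. euclidean) UNIV) (\<Pi>\<^sub>E j\<in>(UNIV::nat set). sphere (0::complex) 1)"
    by (subst compactin_PiE) (auto simp: compactin_euclidean_iff)
  then have c: "compact (\<Pi>\<^sub>E j\<in>(UNIV::nat set). sphere (0::complex) 1)"
    by (simp add: euclidean_product_topology compactin_euclidean_iff)
  have "closed {y :: nat \<Rightarrow> complex. \<forall>j. y j = y (Suc j) ^ p}"
    by (intro closed_Collect_all closed_Collect_eq continuous_intros)
  then have "compact ((\<Pi>\<^sub>E j\<in>(UNIV::nat set). sphere (0::complex) 1) \<inter> {y. \<forall>j. y j = y (Suc j) ^ p})"
    by (intro compact_Int_closed c)
  also have "\<dots> = solenoid p"
    by (simp add: solenoid_def circle_eq PiE_UNIV_domain Pi_def Collect_conj_eq)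
  finally show ?thesis .
qed

lemma space_sol_borel [simp]: "space (sol_borel p) = solenoid p"
  by (simp add: sol_borel_def space_restrict_space)

lemma solenoid_borel [measurable]: "solenoid p \<in> sets borel"
  using compact_solenoid by (rule borel_compact)

lemma measurable_sol_borelI:
  assumes "\<And>j. (\<lambda>x. f x j) \<in> borel_measurable N" "\<And>x. x \<in> space N \<Longrightarrow> f x \<in> solenoid p"
  shows "f \<in> measurable N (sol_borel p)"
  unfolding sol_borel_def
  using measurable_coordinatewise_then_product[of f N] assms by (intro measurable_restrict_space2) auto

lemma borel_measurable_sol_continuous:
  fixes f :: "(nat \<Rightarrow> complex) \<Rightarrow> 'b::topological_space"
  shows "continuous_on (solenoid p) f \<Longrightarrow> f \<in> borel_measurable (sol_borel p)"
  unfolding sol_borel_def by (rule borel_measurable_continuous_on_restrict)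

lemma measurable_sol_coord [measurable]: "(\<lambda>y. y j) \<in> borel_measurable (sol_borel p)"
  by (intro borel_measurable_sol_continuous continuous_intros)

lemma continuous_on_sol_char: "continuous_on (solenoid p) (sol_char d l)"
  unfolding sol_char_def by (intro continuous_intros) (auto dest: solenoid_nonzero)

lemma measurable_sol_char [measurable]: "sol_char d l \<in> borel_measurable (sol_borel p)"
  by (intro borel_measurable_sol_continuous continuous_on_sol_char)

lemma space_eq_solenoid:
  assumes "sets \<mu> = sets (sol_borel p)" shows "space \<mu> = solenoid p"
  using sets_eq_imp_space_eq[OF assms] by simp

lemma integrable_sol_bounded:
  fixes f :: "(nat \<Rightarrow> complex) \<Rightarrow> 'b::{banach, second_countable_topology}"
  assumes "finite_measure \<mu>" "sets \<mu> = sets (sol_borel p)" "f \<in> borel_measurable (sol_borel p)"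
    "\<And>y. y \<in> solenoid p \<Longrightarrow> norm (f y) \<le> B"
  shows "integrable \<mu> f"
proof -
  interpret finite_measure \<mu> by fact
  show ?thesis
    using assms space_eq_solenoid[OF assms(2)] measurable_cong_sets[OF assms(2) refl]
    by (intro integrable_const_bound[of _ B]) auto
qed

lemma integrable_sol_char:
  assumes "finite_measure \<mu>" "sets \<mu> = sets (sol_borel p)"
  shows "integrable \<mu> (sol_char d l)"
  by (rule integrable_sol_bounded[OF assms measurable_sol_char, where B = 1]) (simp add: norm_sol_char)

lemma bounded_sol_continuous:
  fixes f :: "(nat \<Rightarrow> complex) \<Rightarrow> 'b::real_normed_vector"
  assumes "continuous_on (solenoid p) f"
  shows "\<exists>B. \<forall>y\<in>solenoid p. norm (f y) \<le> B"
  using compact_imp_bounded[OF compact_continuous_image[OF assms compact_solenoid]]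
  by (simp add: bounded_iff)

lemma integrable_sol_continuous:
  fixes f :: "(nat \<Rightarrow> complex) \<Rightarrow> 'b::{banach, second_countable_topology}"
  assumes "finite_measure \<mu>" "sets \<mu> = sets (sol_borel p)" "continuous_on (solenoid p) f"
  shows "integrable \<mu> f"
proof -
  obtain B where "\<forall>y\<in>solenoid p. norm (f y) \<le> B" using bounded_sol_continuous[OF assms(3)] ..
  then show ?thesis
    by (intro integrable_sol_bounded[OF assms(1,2) borel_measurable_sol_continuous[OF assms(3)]]) auto
qed

section \<open>Fourier coefficients determine a law\<close>

text \<open>A monomial has to agree with a multiple of a character on the solenoid only: off the
  solenoid a product of characters of different levels need not be a character, and the class would
  not be closed under multiplication.\<close>

inductive trig_poly :: "nat \<Rightarrow> ((nat \<Rightarrow> complex) \<Rightarrow> complex) \<Rightarrow> bool" for p where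
  monom: "(\<And>y. y \<in> solenoid p \<Longrightarrow> g y = c * sol_char d l y) \<Longrightarrow> trig_poly p g"
| add: "trig_poly p f \<Longrightarrow> trig_poly p g \<Longrightarrow> trig_poly p (\<lambda>y. f y + g y)"

lemma trig_poly_const: "trig_poly p (\<lambda>y. c)"
  by (rule trig_poly.monom[of _ _ c 0 0]) (simp add: sol_char_def)

text \<open>Both characters are lifted to the common level d + d', where the exponents add
  up.\<close>

lemma sol_char_times:
  assumes "y \<in> solenoid p"
  shows "sol_char d l y * sol_char d' l' y
    = sol_char (d + d') (int (p ^ d') * l + int (p ^ d) * l') y"
proof -
  have "sol_char d l y = sol_char (d + d') (int (p ^ d') * l) y"
    by (rule sol_char_lift[OF assms])
  moreover have "sol_char d' l' y = sol_char (d + d') (int (p ^ d) * l') y"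
    using sol_char_lift[OF assms, of d' l' d] by (simp add: add.commute)
  ultimately show ?thesis
    unfolding sol_char_def using solenoid_nonzero[OF assms, of "d + d'"] by (simp only: power_int_add simp_thms)
qed

lemma trig_poly_mult_monom:
  assumes "trig_poly p f" "\<And>y. y \<in> solenoid p \<Longrightarrow> g y = c * sol_char d l y"
  shows "trig_poly p (\<lambda>y. f y * g y)"
  using assms(1)
proof induction
  case (monom f c' d' l')
  show ?case
  proof (rule trig_poly.monom)
    fix y assume y: "y \<in> solenoid p"
    show "f y * g y = (c' * c) * sol_char (d' + d) (int (p ^ d) * l' + int (p ^ d') * l) y"
      unfolding sol_char_times[OF y, symmetric] using monom[OF y] assms(2)[OF y] by simp
  qed
next
  case (add f1 f2)
  then show ?case using trig_poly.add[OF add.IH] by (simp add: ring_distribs)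
qed

lemma trig_poly_mult:
  assumes "trig_poly p f" "trig_poly p g"
  shows "trig_poly p (\<lambda>y. f y * g y)"
  using assms(2)
proof induction
  case (monom g c d l)
  then show ?case by (rule trig_poly_mult_monom[OF assms(1)])
next
  case (add g1 g2)
  then show ?case using trig_poly.add[OF add.IH] by (simp add: ring_distribs)
qed

text \<open>The difference g - f vanishes on the solenoid and so counts as a monomial with
  coefficient 0; adding it to f corrects the values off the solenoid.\<close>

lemma trig_poly_cong:
  assumes "trig_poly p f" "\<And>y. y \<in> solenoid p \<Longrightarrow> f y = g y"
  shows "trig_poly p g"
proof -
  have "trig_poly p (\<lambda>y. g y - f y)" by (rule trig_poly.monom[of _ _ 0]) (simp add: assms(2))
  from trig_poly.add[OF assms(1) this] show ?thesis by simp
qed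

lemma trig_poly_continuous: "trig_poly p f \<Longrightarrow> continuous_on (solenoid p) f"
proof (induction rule: trig_poly.induct)
  case (monom g c d l)
  have "continuous_on (solenoid p) (\<lambda>y. c * sol_char d l y)"
    by (intro continuous_intros continuous_on_sol_char)
  then show ?case using monom by (subst continuous_on_cong[OF refl]) auto
qed (intro continuous_intros)

lemma cnj_sol_char: "y \<in> solenoid p \<Longrightarrow> cnj (sol_char d l y) = sol_char d (- l) y"
  using complex_div_cnj[of 1 "sol_char d l y"] norm_sol_char[of y p d l]
  by (simp add: sol_char_def power_int_minus divide_inverse)

text \<open>Stone-Weierstrass is applied to real functions, so the ring consists of the real
  functions whose complexification is a trigonometric polynomial.\<close>

lemma solenoid_function_ring:
  "function_ring_on {f. trig_poly p (\<lambda>y. complex_of_real (f y))} (solenoid p)"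
proof
  show "compact (solenoid p)" by (rule compact_solenoid)
next
  fix f assume "f \<in> {f. trig_poly p (\<lambda>y. complex_of_real (f y))}"
  then have "continuous_on (solenoid p) (\<lambda>y. Re (complex_of_real (f y)))"
    by (intro continuous_intros trig_poly_continuous) auto
  then show "continuous_on (solenoid p) f" by simp
next
  fix x y assume xy: "x \<in> solenoid p" "y \<in> solenoid p" "x \<noteq> y"
  then obtain d where d: "x d \<noteq> y d" by auto
  \<comment> \<open>Points are separated by the real or the imaginary part of some coordinate; both
    are combinations of \<open>sol_char d 1\<close> and its conjugate
    \<open>sol_char d (-1)\<close>.\<close>
  have re: "complex_of_real (Re (z d)) = (1/2) * sol_char d 1 z + (1/2) * sol_char d (-1) z"
    and im: "complex_of_real (Im (z d)) = (1/(2*\<i>)) * sol_char d 1 z + (-1/(2*\<i>)) * sol_char d (-1) z"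
    if "z \<in> solenoid p" for z
  proof -
    have "sol_char d 1 z = z d" "sol_char d (-1) z = cnj (z d)"
      using cnj_sol_char[OF that, of d 1] by (simp_all add: sol_char_def)
    then show "complex_of_real (Re (z d)) = (1/2) * sol_char d 1 z + (1/2) * sol_char d (-1) z"
      and "complex_of_real (Im (z d)) = (1/(2*\<i>)) * sol_char d 1 z + (-1/(2*\<i>)) * sol_char d (-1) z"
      by (simp_all only:) (simp_all add: complex_eq_iff)
  qed
  have m: "trig_poly p (\<lambda>z. c * sol_char d l z)" for c d l
    by (rule trig_poly.monom) (rule refl)
  have "trig_poly p (\<lambda>z. complex_of_real (Re (z d)))"
    by (rule trig_poly_cong[OF trig_poly.add[OF m[of "1/2" d 1] m[of "1/2" d "-1"]]]) (rule re[symmetric])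
  moreover have "trig_poly p (\<lambda>z. complex_of_real (Im (z d)))"
    by (rule trig_poly_cong[OF trig_poly.add[OF m[of "1/(2*\<i>)" d 1] m[of "-1/(2*\<i>)" d "-1"]]]) (rule im[symmetric])
  moreover have "Re (x d) \<noteq> Re (y d) \<or> Im (x d) \<noteq> Im (y d)" using d by (simp add: complex_eq_iff)
  ultimately show "\<exists>f\<in>{f. trig_poly p (\<lambda>y. complex_of_real (f y))}. f x \<noteq> f y"
    by (elim disjE) (intro bexI[of _ "\<lambda>z. Re (z d)"] bexI[of _ "\<lambda>z. Im (z d)"] CollectI; assumption)+
next
  fix f g
  assume fg: "f \<in> {f. trig_poly p (\<lambda>y. complex_of_real (f y))}" "g \<in> {f. trig_poly p (\<lambda>y. complex_of_real (f y))}"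
  show "(\<lambda>x. f x + g x) \<in> {f. trig_poly p (\<lambda>y. complex_of_real (f y))}"
    using trig_poly.add[of p "\<lambda>y. of_real (f y)" "\<lambda>y. of_real (g y)"] fg by simp
  show "(\<lambda>x. f x * g x) \<in> {f. trig_poly p (\<lambda>y. complex_of_real (f y))}"
    using trig_poly_mult[of p "\<lambda>y. of_real (f y)" "\<lambda>y. of_real (g y)"] fg by simp
qed (simp add: trig_poly_const)

lemma tendsto_integral_trig_poly:
  assumes prob: "\<And>n. finite_measure (\<mu> n)" "\<And>n. sets (\<mu> n) = sets (sol_borel p)"
    and nu: "finite_measure \<nu>" "sets \<nu> = sets (sol_borel p)"
    and lim: "\<And>d l. (\<lambda>n. \<integral>y. sol_char d l y \<partial>\<mu> n) \<longlonglongrightarrow> (\<integral>y. sol_char d l y \<partial>\<nu>)"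
    and "trig_poly p g"
  shows "(\<lambda>n. \<integral>y. g y \<partial>\<mu> n) \<longlonglongrightarrow> (\<integral>y. g y \<partial>\<nu>)"
  using \<open>trig_poly p g\<close>
proof induction
  case (monom g c d l)
  have eq: "(\<integral>y. g y \<partial>\<rho>) = c * (\<integral>y. sol_char d l y \<partial>\<rho>)"
    if "finite_measure \<rho>" "sets \<rho> = sets (sol_borel p)" for \<rho>
  proof -
    have "(\<integral>y. g y \<partial>\<rho>) = (\<integral>y. c * sol_char d l y \<partial>\<rho>)"
      using monom space_eq_solenoid[OF that(2)] by (intro Bochner_Integration.integral_cong) auto
    then show ?thesis by simp
  qed
  show ?case using tendsto_mult_left[OF lim, of c d l] eq[OF prob] eq[OF nu] by simp
next
  case (add f g)
  note int = integrable_sol_continuous[OF _ _ trig_poly_continuous[OF add.hyps(1)]]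
    integrable_sol_continuous[OF _ _ trig_poly_continuous[OF add.hyps(2)]]
  show ?case using tendsto_add[OF add.IH] int[OF prob] int[OF nu] by simp
qed

text \<open>A real trigonometric polynomial g is uniformly within r/3 of f on the solenoid.
  Replacing f by g then costs at most r/3 for every probability law simultaneously, and for g
  convergence is known.\<close>

lemma sol_weak_convI:
  assumes prob: "\<And>n. prob_space (\<mu> n)" "\<And>n. sets (\<mu> n) = sets (sol_borel p)"
    and nu: "prob_space \<nu>" "sets \<nu> = sets (sol_borel p)"
    and lim: "\<And>d l. (\<lambda>n. \<integral>y. sol_char d l y \<partial>\<mu> n) \<longlonglongrightarrow> (\<integral>y. sol_char d l y \<partial>\<nu>)"
  shows "sol_weak_conv p \<mu> \<nu>"
  unfolding sol_weak_conv_def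
proof safe
  fix f :: "(nat \<Rightarrow> complex) \<Rightarrow> real"
  assume f: "continuous_on (solenoid p) f"
  interpret function_ring_on "{f. trig_poly p (\<lambda>y. complex_of_real (f y))}" "solenoid p"
    by (rule solenoid_function_ring)
  have fin: "finite_measure (\<mu> n)" "finite_measure \<nu>" for n
    using prob(1) nu(1) by (auto intro: prob_space.finite_measure)
  show "(\<lambda>n. \<integral>y. f y \<partial>\<mu> n) \<longlonglongrightarrow> (\<integral>y. f y \<partial>\<nu>)"
  proof (rule LIMSEQ_I)
    fix r :: real assume r: "0 < r"
    obtain g where g: "trig_poly p (\<lambda>y. complex_of_real (g y))"
      and fg: "\<And>y. y \<in> solenoid p \<Longrightarrow> \<bar>f y - g y\<bar> < r/3"
      using Stone_Weierstrass_basic[OF f, of "r/3"] r by auto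
    have gc: "continuous_on (solenoid p) g" using g by (intro continuous) simp
    have close: "\<bar>(\<integral>y. f y \<partial>\<rho>) - (\<integral>y. g y \<partial>\<rho>)\<bar> \<le> r/3"
      if "prob_space \<rho>" and s: "sets \<rho> = sets (sol_borel p)" for \<rho>
    proof -
      interpret prob_space \<rho> by fact
      have i: "integrable \<rho> f" "integrable \<rho> g"
        using s f gc finite_measure by (auto intro: integrable_sol_continuous)
      have "\<bar>(\<integral>y. f y \<partial>\<rho>) - (\<integral>y. g y \<partial>\<rho>)\<bar> = \<bar>\<integral>y. f y - g y \<partial>\<rho>\<bar>" using i by simp
      also have "\<dots> \<le> (\<integral>y. \<bar>f y - g y\<bar> \<partial>\<rho>)" by (rule integral_abs_bound)
      also have "\<dots> \<le> (\<integral>y. r/3 \<partial>\<rho>)"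
        using i fg space_eq_solenoid[OF s] by (intro integral_mono) (auto intro: less_imp_le)
      finally show ?thesis by (simp add: prob_space)
    qed
    have "(\<lambda>n. \<integral>y. complex_of_real (g y) \<partial>\<mu> n) \<longlonglongrightarrow> (\<integral>y. complex_of_real (g y) \<partial>\<nu>)"
      by (rule tendsto_integral_trig_poly[OF fin(1) prob(2) fin(2) nu(2) lim g])
    then have "(\<lambda>n. \<integral>y. g y \<partial>\<mu> n) \<longlonglongrightarrow> (\<integral>y. g y \<partial>\<nu>)"
      by (simp add: tendsto_of_real_iff)
    from LIMSEQ_D[OF this, of "r/3"] r obtain N
      where N: "\<And>n. n \<ge> N \<Longrightarrow> \<bar>(\<integral>y. g y \<partial>\<mu> n) - (\<integral>y. g y \<partial>\<nu>)\<bar> < r/3" by auto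
    have "norm ((\<integral>y. f y \<partial>\<mu> n) - (\<integral>y. f y \<partial>\<nu>)) < r" if "n \<ge> N" for n
      using N[OF that] close[OF prob(1,2), of n] close[OF nu] unfolding real_norm_def by linarith
    then show "\<exists>N. \<forall>n\<ge>N. norm ((\<integral>y. f y \<partial>\<mu> n) - (\<integral>y. f y \<partial>\<nu>)) < r" by blast
  qed
qed

text \<open>The functions max(0, 1 - n dist(y, C)) are continuous, bounded by 1 and decrease to the
  indicator of the closed set C.\<close>

lemma measure_closed_eq_lim_integral:
  fixes C :: "'a::metric_space set"
  assumes "finite_measure \<mu>" "sets \<mu> = sets (restrict_space borel S)" "closed C" "C \<noteq> {}"
  shows "(\<lambda>n. \<integral>y. max 0 (1 - real n * infdist y C) \<partial>\<mu>) \<longlonglongrightarrow> measure \<mu> (S \<inter> C)"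
proof -
  interpret finite_measure \<mu> by fact
  have sp: "space \<mu> = S" using sets_eq_imp_space_eq[OF assms(2)] by (simp add: space_restrict_space)
  have C: "S \<inter> C \<in> sets \<mu>"
    using assms(2,3) by (auto simp: sets_restrict_space)
  have m: "(\<lambda>y. max 0 (1 - real n * infdist y C)) \<in> borel_measurable \<mu>" for n
    unfolding measurable_cong_sets[OF assms(2) refl]
    by (intro measurable_restrict_space1 borel_measurable_continuous_onI continuous_intros)
  have "(\<lambda>n. \<integral>y. max 0 (1 - real n * infdist y C) \<partial>\<mu>) \<longlonglongrightarrow> (\<integral>y. indicator (S \<inter> C) y \<partial>\<mu>)"
  proof (rule integral_dominated_convergence[where w="\<lambda>_. 1"])
    show "AE y in \<mu>. (\<lambda>n. max 0 (1 - real n * infdist y C)) \<longlonglongrightarrow> indicator (S \<inter> C) y"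
    proof (rule AE_I2)
      fix y assume y: "y \<in> space \<mu>"
      show "(\<lambda>n. max 0 (1 - real n * infdist y C)) \<longlonglongrightarrow> indicator (S \<inter> C) y"
      proof (cases "y \<in> C")
        case True then show ?thesis using y sp by simp
      next
        case False
        then have pos: "infdist y C > 0"
          using in_closed_iff_infdist_zero[OF assms(3,4)] infdist_nonneg[of y C] by fastforce
        obtain N where N: "real N * infdist y C > 1" using ex_less_of_nat_mult[OF pos] by blast
        have "max 0 (1 - real n * infdist y C) = 0" if "n \<ge> N" for n
          using less_le_trans[OF N mult_right_mono[of "real N" "real n" "infdist y C"]] that pos by simp
        then have "eventually (\<lambda>n. max 0 (1 - real n * infdist y C) = 0) sequentially"
          by (auto simp: eventually_sequentially)
        then show ?thesis using False by (simp add: tendsto_eventually)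
      qed
    qed
  qed (use m C in \<open>auto simp: infdist_nonneg\<close>)
  then show ?thesis using C by simp
qed

text \<open>Continuous integrals determine the mass of closed sets, and the traces of closed sets on
  S form an intersection-stable generator of the Borel sets of S.\<close>

lemma measure_eqI_continuous_integrals:
  fixes S :: "'a::metric_space set"
  assumes "finite_measure \<mu>" "finite_measure \<nu>"
    and s: "sets \<mu> = sets (restrict_space borel S)" "sets \<nu> = sets (restrict_space borel S)"
    and eq: "\<And>f :: 'a \<Rightarrow> real. continuous_on UNIV f \<Longrightarrow> bounded (range f) \<Longrightarrow> (\<integral>y. f y \<partial>\<mu>) = (\<integral>y. f y \<partial>\<nu>)"
    and "S \<in> sets borel"
  shows "\<mu> = \<nu>"
proof -
  interpret \<mu>: finite_measure \<mu> by fact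
  interpret \<nu>: finite_measure \<nu> by fact
  have cl: "measure \<mu> (S \<inter> C) = measure \<nu> (S \<inter> C)" if "closed C" for C
  proof (cases "C = {}")
    case False
    have "(\<integral>y. max 0 (1 - real n * infdist y C) \<partial>\<mu>) = (\<integral>y. max 0 (1 - real n * infdist y C) \<partial>\<nu>)" for n
      by (intro eq continuous_intros) (auto simp: bounded_iff infdist_nonneg intro!: exI[of _ 1])
    then show ?thesis
      using LIMSEQ_unique[OF measure_closed_eq_lim_integral[OF assms(1) s(1) that False]]
        measure_closed_eq_lim_integral[OF assms(2) s(2) that False] by simp
  qed simp
  let ?E = "(\<inter>) S ` Collect closed"
  have sig: "sets (restrict_space borel S) = sigma_sets S ?E"
  proof -
    have b: "sets borel = sigma_sets (UNIV :: 'a set) (Collect closed)"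
      by (subst borel_eq_closed, rule sets_measure_of) simp
    show ?thesis
      unfolding sets_restrict_space b
      by (rule sigma_sets_Int[OF _ subset_UNIV]) (use assms(6) in \<open>simp only: b\<close>)
  qed
  show ?thesis
  proof (rule measure_eqI_generator_eq[where \<Omega>=S and E="?E" and A="\<lambda>_. S"])
    show "Int_stable ?E" 
    proof (rule Int_stableI_image)
      fix C D :: "'a set" assume "C \<in> Collect closed" "D \<in> Collect closed"
      then show "\<exists>F\<in>Collect closed. S \<inter> C \<inter> (S \<inter> D) = S \<inter> F"
        by (intro bexI[of _ "C \<inter> D"]) auto
    qed
    show "?E \<subseteq> Pow S" by auto
    show "sets \<mu> = sigma_sets S ?E" "sets \<nu> = sigma_sets S ?E" using s sig by auto
    show "range (\<lambda>_::nat. S) \<subseteq> ?E" by (auto intro!: image_eqI[where x=UNIV])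
    show "emeasure \<mu> X = emeasure \<nu> X" if "X \<in> ?E" for X
      using that cl by (auto simp: \<mu>.emeasure_eq_measure \<nu>.emeasure_eq_measure)
  qed (auto simp: \<mu>.emeasure_eq_measure)
qed

lemma sol_measure_unique:
  assumes "prob_space \<mu>" "sets \<mu> = sets (sol_borel p)" "prob_space \<nu>" "sets \<nu> = sets (sol_borel p)"
    and "\<And>d l. (\<integral>y. sol_char d l y \<partial>\<mu>) = (\<integral>y. sol_char d l y \<partial>\<nu>)"
  shows "\<mu> = \<nu>"
proof (rule measure_eqI_continuous_integrals[where S="solenoid p"])
  show "finite_measure \<mu>" "finite_measure \<nu>" using assms(1,3) by (auto intro: prob_space.finite_measure)
  fix f :: "(nat \<Rightarrow> complex) \<Rightarrow> real" assume f: "continuous_on UNIV f" "bounded (range f)"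
  \<comment> \<open>Weak convergence of the constant sequence \<open>\<mu>\<close> to
    \<open>\<nu>\<close> is equality of all continuous integrals.\<close>
  have "sol_weak_conv p (\<lambda>_. \<mu>) \<nu>"
    by (rule sol_weak_convI) (use assms in auto)
  moreover have "continuous_on (solenoid p) f" "bounded (f ` solenoid p)"
    using f by (auto intro: continuous_on_subset bounded_subset)
  ultimately have "(\<lambda>_::nat. \<integral>y. f y \<partial>\<mu>) \<longlonglongrightarrow> (\<integral>y. f y \<partial>\<nu>)"
    unfolding sol_weak_conv_def by blast
  then show "(\<integral>y. f y \<partial>\<mu>) = (\<integral>y. f y \<partial>\<nu>)" by (simp add: LIMSEQ_const_iff)
qed (use assms(2,4) in \<open>auto simp: sol_borel_def\<close>)

text \<open>Resolves the definite description: uniqueness is already proved, so exhibiting one law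
  with the prescribed coefficients identifies it.\<close>

lemma sol_measure_of:
  assumes "prob_space \<mu>" "sets \<mu> = sets (sol_borel p)" "\<And>d l. (\<integral>y. sol_char d l y \<partial>\<mu>) = \<phi> d l"
  shows "sol_measure_of p \<phi> = \<mu>"
  unfolding sol_measure_of_def
proof (rule the_equality)
  show "prob_space \<mu> \<and> sets \<mu> = sets (sol_borel p) \<and> (\<forall>d l. (\<integral>y. sol_char d l y \<partial>\<mu>) = \<phi> d l)"
    using assms by blast
  fix \<nu>
  assume nu: "prob_space \<nu> \<and> sets \<nu> = sets (sol_borel p) \<and> (\<forall>d l. (\<integral>y. sol_char d l y \<partial>\<nu>) = \<phi> d l)"
  then show "\<nu> = \<mu>"
    by (intro sol_measure_unique[of \<nu> p \<mu>]) (use assms in auto)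
qed

section \<open>Convolution and the Gaussian law\<close>

lemma measurable_sol_mult:
  "(\<lambda>(y, z). sol_mult y z) \<in> measurable (sol_borel p \<Otimes>\<^sub>M sol_borel p) (sol_borel p)"
proof (rule measurable_sol_borelI)
  show "(\<lambda>x. (case x of (y, z) \<Rightarrow> sol_mult y z) j) \<in> borel_measurable (sol_borel p \<Otimes>\<^sub>M sol_borel p)" for j
    unfolding sol_mult_def split_beta by measurable
qed (auto simp: space_pair_measure sol_mult_in)

lemma sol_conv_facts:
  assumes "prob_space \<mu>" "sets \<mu> = sets (sol_borel p)" "prob_space \<nu>" "sets \<nu> = sets (sol_borel p)"
  shows prob_space_sol_conv: "prob_space (sol_conv p \<mu> \<nu>)"
    and sets_sol_conv: "sets (sol_conv p \<mu> \<nu>) = sets (sol_borel p)"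
    and integral_sol_char_sol_conv:
      "(\<integral>y. sol_char d l y \<partial>sol_conv p \<mu> \<nu>) = (\<integral>y. sol_char d l y \<partial>\<mu>) * (\<integral>y. sol_char d l y \<partial>\<nu>)"
proof -
  interpret \<mu>: prob_space \<mu> by fact
  interpret \<nu>: prob_space \<nu> by fact
  interpret pair_prob_space \<mu> \<nu> ..
  have m: "(\<lambda>(y, z). sol_mult y z) \<in> measurable (\<mu> \<Otimes>\<^sub>M \<nu>) (sol_borel p)"
    using measurable_sol_mult measurable_cong_sets[OF sets_pair_measure_cong[OF assms(2,4)] refl] by blast
  show "prob_space (sol_conv p \<mu> \<nu>)"
    unfolding sol_conv_def by (rule prob_space_distr[OF m])
  show "sets (sol_conv p \<mu> \<nu>) = sets (sol_borel p)" by (simp add: sol_conv_def)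
  have i: "integrable \<mu> (sol_char d l)" "integrable \<nu> (sol_char d l)"
    using assms by (auto intro: integrable_sol_char prob_space.finite_measure)
  have "(\<integral>y. sol_char d l y \<partial>sol_conv p \<mu> \<nu>)
      = (\<integral>x. sol_char d l (fst x) * sol_char d l (snd x) \<partial>(\<mu> \<Otimes>\<^sub>M \<nu>))"
    unfolding sol_conv_def
    by (subst integral_distr[OF m]) (auto simp: sol_char_mult split_beta)
  also have "\<dots> = (\<integral>y. sol_char d l y \<partial>\<mu>) * (\<integral>y. sol_char d l y \<partial>\<nu>)"
  proof -
    have "integrable (\<mu> \<Otimes>\<^sub>M \<nu>) (\<lambda>x. sol_char d l (fst x) * sol_char d l (snd x))"
    proof (rule integrable_const_bound[where B = 1])
      show "AE x in \<mu> \<Otimes>\<^sub>M \<nu>. norm (sol_char d l (fst x) * sol_char d l (snd x)) \<le> 1"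
        by (rule AE_I2) (auto simp: space_pair_measure space_eq_solenoid[OF assms(2)]
            space_eq_solenoid[OF assms(4)] norm_mult norm_sol_char)
    qed (use i in measurable)
    from integral_fst'[OF this] show ?thesis by simp
  qed
  finally show "(\<integral>y. sol_char d l y \<partial>sol_conv p \<mu> \<nu>) = (\<integral>y. sol_char d l y \<partial>\<mu>) * (\<integral>y. sol_char d l y \<partial>\<nu>)" .
qed

text \<open>Besides carrying the normal law, this subgroup provides the deterministic shifts that
  centre the Poisson pieces: on it the character (d, l) is exp(i l t / p^d), which has the same form
  as the centring term.\<close>

definition sol_line :: "nat \<Rightarrow> real \<Rightarrow> nat \<Rightarrow> complex" where
  "sol_line p t = (\<lambda>j. cis (t / real p ^ j))"

lemma sol_line_in: "0 < p \<Longrightarrow> sol_line p t \<in> solenoid p"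
  by (rule solenoidI) (simp_all add: sol_line_def Complex.DeMoivre)

lemma sol_char_sol_line: "sol_char d l (sol_line p t) = cis (of_int l * (t / real p ^ d))"
  by (simp add: sol_char_def sol_line_def cis_power_int)

lemma measurable_sol_line:
  assumes "0 < p" shows "sol_line p \<in> measurable borel (sol_borel p)"
proof (rule measurable_sol_borelI)
  show "(\<lambda>x. sol_line p x j) \<in> borel_measurable borel" for j
    unfolding sol_line_def using assms by (intro borel_measurable_continuous_onI continuous_intros) simp
qed (rule sol_line_in[OF assms])

lemma return_sol_facts:
  assumes "a \<in> solenoid p"
  shows prob_space_return_sol: "prob_space (return (sol_borel p) a)"
    and integral_sol_char_return: "(\<integral>y. sol_char d l y \<partial>return (sol_borel p) a) = sol_char d l a"
  using assms by (auto intro: prob_space_return simp: integral_return)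

lemma gauss_sol_facts:
  assumes "0 < p" "0 \<le> b"
  shows prob_space_gauss_sol: "prob_space (gauss_sol p b)"
    and sets_gauss_sol: "sets (gauss_sol p b) = sets (sol_borel p)"
    and integral_sol_char_gauss_sol: "(\<integral>y. sol_char d l y \<partial>gauss_sol p b)
      = of_real (exp (- b * (of_int l)\<^sup>2 / (2 * of_nat p ^ (2 * d))))"
proof -
  \<comment> \<open>Putting sqrt b into the map, rather than into the variance of the normal law,
    covers the degenerate case b = 0 as well.\<close>
  define f where "f = (\<lambda>x. sol_line p (sqrt b * x))"
  define \<mu> where "\<mu> = distr std_normal_distribution (sol_borel p) f"
  interpret N: real_distribution std_normal_distribution by (rule real_dist_normal_dist)
  have f: "f \<in> measurable std_normal_distribution (sol_borel p)"
    unfolding f_def by (rule measurable_compose[OF _ measurable_sol_line[OF assms(1)]]) simp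
  have "prob_space \<mu>" unfolding \<mu>_def by (rule N.prob_space_distr[OF f])
  moreover have "sets \<mu> = sets (sol_borel p)" by (simp add: \<mu>_def)
  moreover have c: "(\<integral>y. sol_char d l y \<partial>\<mu>)
      = of_real (exp (- b * (of_int l)\<^sup>2 / (2 * of_nat p ^ (2 * d))))" for d l
  proof -
    have "(\<integral>y. sol_char d l y \<partial>\<mu>) = char std_normal_distribution (of_int l * sqrt b / real p ^ d)"
      unfolding \<mu>_def char_def
      by (subst integral_distr[OF f measurable_sol_char])
        (simp add: f_def sol_char_sol_line cis_conv_exp mult.assoc)
    also have "\<dots> = of_real (exp (- (of_int l * sqrt b / real p ^ d)\<^sup>2 / 2))"
      by (simp add: char_std_normal_distribution exp_of_real)
    also have "(of_int l * sqrt b / real p ^ d)\<^sup>2 = b * (of_int l)\<^sup>2 / real p ^ (2 * d)"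
      using assms(2) by (simp add: power_divide power_mult_distrib power_mult mult.commute)
    finally show ?thesis by simp
  qed
  ultimately have "gauss_sol p b = \<mu>" unfolding gauss_sol_def by (intro sol_measure_of)
  then show "prob_space (gauss_sol p b)" "sets (gauss_sol p b) = sets (sol_borel p)"
    "(\<integral>y. sol_char d l y \<partial>gauss_sol p b)
      = of_real (exp (- b * (of_int l)\<^sup>2 / (2 * of_nat p ^ (2 * d))))"
    using \<open>prob_space \<mu>\<close> \<open>sets \<mu> = sets (sol_borel p)\<close> c by auto
qed

section \<open>Compound Poisson laws and infinite products\<close>

text \<open>The integrand depends on the coordinates in J alone, so the integral is transported to
  the finite product over J, where Fubini factors it.\<close>

lemma integral_PiM_prod:
  fixes f :: "'i \<Rightarrow> 'a \<Rightarrow> 'b::{real_normed_field,banach,second_countable_topology}"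
  assumes "\<And>i. prob_space (N i)" "finite J" "\<And>i. integrable (N i) (f i)"
  shows "(\<integral>x. (\<Prod>i\<in>J. f i (x i)) \<partial>Pi\<^sub>M UNIV N) = (\<Prod>i\<in>J. \<integral>y. f i y \<partial>N i)"
proof -
  interpret N: prob_space "N i" for i by fact
  interpret product_prob_space N UNIV ..
  have [measurable]: "f i \<in> borel_measurable (N i)" for i
    using assms(3) by (rule borel_measurable_integrable)
  have "(\<Prod>i\<in>J. \<integral>y. f i y \<partial>N i) = (\<integral>x. (\<Prod>i\<in>J. f i (x i)) \<partial>Pi\<^sub>M J N)"
    using assms by (subst product_integral_prod) auto
  also have "\<dots> = (\<integral>x. (\<Prod>i\<in>J. f i (x i)) \<partial>distr (Pi\<^sub>M UNIV N) (Pi\<^sub>M J N) (\<lambda>x. restrict x J))"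
    by (subst distr_PiM_restrict_finite[OF assms(2) subset_UNIV]) (rule refl)
  also have "\<dots> = (\<integral>x. (\<Prod>i\<in>J. f i (restrict x J i)) \<partial>Pi\<^sub>M UNIV N)"
    by (rule integral_distr) auto
  finally show ?thesis by simp
qed

lemma measurable_PiM_sol_component:
  assumes "\<And>i. sets (N i) = sets (sol_borel p)"
  shows "(\<lambda>x. x i j) \<in> borel_measurable (Pi\<^sub>M UNIV N)"
proof -
  have "(\<lambda>x. x i) \<in> measurable (Pi\<^sub>M UNIV N) (N i)" by (rule measurable_component_singleton) simp
  then have "(\<lambda>x. x i) \<in> measurable (Pi\<^sub>M UNIV N) (sol_borel p)"
    using measurable_cong_sets[OF refl assms[of i]] by blast
  from measurable_compose[OF this measurable_sol_coord] show ?thesis .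
qed

lemma space_PiM_sol:
  assumes "\<And>i. sets (N i) = sets (sol_borel p)" "x \<in> space (Pi\<^sub>M UNIV N)"
  shows "x i \<in> solenoid p"
  using assms(2) space_eq_solenoid[OF assms(1)] by (auto simp: space_PiM PiE_iff)

lemma poisson_generating_function:
  fixes z :: complex
  assumes "0 < c"
  shows "(\<integral>n. z ^ n \<partial>measure_pmf (poisson_pmf c)) = exp (of_real c * (z - 1))"
proof -
  have s: "(\<lambda>n. exp (-c) *\<^sub>R ((of_real c * z) ^ n /\<^sub>R fact n)) sums (exp (-c) *\<^sub>R exp (of_real c * z))"
    by (intro sums_scaleR_right exp_converges)
  have eq: "pmf (poisson_pmf c) n *\<^sub>R z ^ n = exp (-c) *\<^sub>R ((of_real c * z) ^ n /\<^sub>R fact n)" for n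
    using assms by (simp add: scaleR_conv_of_real power_mult_distrib field_simps)
  have "summable (\<lambda>n. norm (pmf (poisson_pmf c) n *\<^sub>R z ^ n))"
    unfolding eq using summable_mult[OF summable_norm_exp[of "of_real c * z"], of "exp (-c)"]
    by (simp add: norm_mult mult.assoc)
  then have i: "integrable (count_space UNIV) (\<lambda>n. pmf (poisson_pmf c) n *\<^sub>R z ^ n)"
    by (simp add: integrable_count_space_nat_iff)
  have "(\<integral>n. z ^ n \<partial>measure_pmf (poisson_pmf c)) = (\<integral>n. pmf (poisson_pmf c) n *\<^sub>R z ^ n \<partial>count_space UNIV)"
    unfolding measure_pmf_eq_density by (rule integral_density) auto
  also have "\<dots> = exp (-c) *\<^sub>R exp (of_real c * z)"
    using sums_integral_count_space_nat[OF i] s unfolding eq by (rule sums_unique2)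
  also have "\<dots> = exp (of_real c * (z - 1))"
    by (simp add: scaleR_conv_of_real exp_of_real[symmetric] exp_add[symmetric] algebra_simps)
  finally show ?thesis .
qed

text \<open>The law sought is that of a product of a Poisson(c) number of independent factors of law
  Q. Given the number n, the Fourier coefficient is the n-th power of that of Q; averaging over n
  gives the Poisson generating function.\<close>

lemma random_product_law:
  assumes "prob_space Q" and Q: "sets Q = sets (sol_borel p)" and "0 < c"
  shows "\<exists>\<mu>. prob_space \<mu> \<and> sets \<mu> = sets (sol_borel p) \<and>
    (\<forall>d l. (\<integral>y. sol_char d l y \<partial>\<mu>) = exp (of_real c * ((\<integral>y. sol_char d l y \<partial>Q) - 1)))"
proof -
  interpret Q: prob_space Q by fact
  let ?P = "Pi\<^sub>M (UNIV :: nat set) (\<lambda>_. Q)"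
  interpret P: prob_space ?P by (rule prob_space_PiM) (rule assms(1))
  let ?R = "measure_pmf (poisson_pmf c) \<Otimes>\<^sub>M ?P"
  interpret R: pair_prob_space "measure_pmf (poisson_pmf c)" ?P
    by (intro pair_prob_space.intro pair_sigma_finite.intro measure_pmf.sigma_finite_measure_axioms
        P.sigma_finite_measure_axioms measure_pmf.prob_space_axioms P.prob_space_axioms)
  define Y where "Y = (\<lambda>x :: nat \<times> (nat \<Rightarrow> nat \<Rightarrow> complex). sol_prod (snd x) {..<fst x})"
  have Y: "Y \<in> measurable ?R (sol_borel p)"
  proof (rule measurable_sol_borelI)
    fix j
    have [measurable]: "(\<lambda>x. snd x k j) \<in> borel_measurable ?R" for k
      by (rule measurable_compose[OF measurable_snd measurable_PiM_sol_component[OF Q]])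
    have f: "fst \<in> measurable ?R (count_space UNIV)"
      using measurable_fst[of "measure_pmf (poisson_pmf c)" ?P]
        measurable_cong_sets[OF refl sets_measure_pmf_count_space] by blast
    have "(\<lambda>x. \<Prod>k<fst x. snd x k j) \<in> borel_measurable ?R"
      by (rule measurable_compose_countable[OF _ f]) measurable
    then show "(\<lambda>x. Y x j) \<in> borel_measurable ?R" by (simp add: Y_def sol_prod_def)
  next
    fix x assume "x \<in> space ?R"
    then have "snd x \<in> space ?P" by (auto simp: space_pair_measure)
    then show "Y x \<in> solenoid p" unfolding Y_def by (intro sol_prod_in space_PiM_sol[OF Q])
  qed
  define \<mu> where "\<mu> = distr ?R (sol_borel p) Y"
  have "prob_space \<mu>" unfolding \<mu>_def by (rule R.prob_space_distr[OF Y])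
  moreover have "(\<integral>y. sol_char d l y \<partial>\<mu>) = exp (of_real c * ((\<integral>y. sol_char d l y \<partial>Q) - 1))" for d l
  proof -
    have m: "(\<lambda>x. sol_char d l (Y x)) \<in> borel_measurable ?R"
      by (rule measurable_compose[OF Y measurable_sol_char])
    have i: "integrable ?R (\<lambda>x. sol_char d l (Y x))"
      using m norm_sol_char[OF measurable_space[OF Y, unfolded space_sol_borel]]
      by (intro R.integrable_const_bound[where B=1] AE_I2) simp_all
    have "(\<integral>y. sol_char d l y \<partial>\<mu>) = (\<integral>x. sol_char d l (Y x) \<partial>?R)"
      unfolding \<mu>_def by (rule integral_distr[OF Y measurable_sol_char])
    also have "\<dots> = (\<integral>n. \<integral>x. sol_char d l (Y (n, x)) \<partial>?P \<partial>measure_pmf (poisson_pmf c))"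
      by (rule R.integral_fst'[OF i, symmetric])
    also have "\<dots> = (\<integral>n. (\<integral>y. sol_char d l y \<partial>Q) ^ n \<partial>measure_pmf (poisson_pmf c))"
    proof (rule Bochner_Integration.integral_cong[OF refl])
      fix n
      have "(\<integral>x. (\<Prod>k<n. sol_char d l (x k)) \<partial>?P) = (\<Prod>k<n. \<integral>y. sol_char d l y \<partial>Q)"
        using Q.finite_measure_axioms Q assms(1) by (intro integral_PiM_prod integrable_sol_char) auto
      then show "(\<integral>x. sol_char d l (Y (n, x)) \<partial>?P) = (\<integral>y. sol_char d l y \<partial>Q) ^ n"
        by (simp add: Y_def sol_char_prod)
    qed
    finally show ?thesis by (simp add: poisson_generating_function[OF \<open>0 < c\<close>])
  qed
  ultimately show ?thesis by (auto simp: \<mu>_def)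
qed

text \<open>Total mass c and normalized measure of \<open>\<rho>\<close> serve as rate and law of
  the factors. Mass zero cannot be normalized and corresponds to the unit mass at the
  identity.\<close>

lemma compound_poisson_exists:
  assumes "finite_measure \<rho>" and s: "sets \<rho> = sets (sol_borel p)"
  shows "\<exists>\<mu>. prob_space \<mu> \<and> sets \<mu> = sets (sol_borel p) \<and>
    (\<forall>d l. (\<integral>y. sol_char d l y \<partial>\<mu>) = exp (\<integral>y. sol_char d l y - 1 \<partial>\<rho>))"
proof -
  interpret finite_measure \<rho> by fact
  define c where "c = measure \<rho> (space \<rho>)"
  have e: "(\<integral>y. sol_char d l y - 1 \<partial>\<rho>) = (\<integral>y. sol_char d l y \<partial>\<rho>) - of_real c" for d l
    using integrable_sol_char[OF assms] by (simp add: c_def scaleR_conv_of_real)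
  show ?thesis
  proof (cases "c = 0")
    case True
    then have "emeasure \<rho> (space \<rho>) = 0" by (simp add: c_def emeasure_eq_measure)
    then have n: "\<rho> = null_measure \<rho>" by (intro measure_eqI) (auto intro!: emeasure_eq_0[of "space \<rho>"] dest: sets.sets_into_space)
    have "(\<integral>y. sol_char d l y - 1 \<partial>\<rho>) = 0" for d l by (subst n) simp
    then show ?thesis
      by (intro exI[of _ "return (sol_borel p) sol_one"])
        (simp add: prob_space_return_sol integral_sol_char_return, simp add: sol_char_def sol_one_def)
  next
    case False
    then have c: "c > 0" by (simp add: c_def less_le)
    define Q where "Q = density \<rho> (\<lambda>_. ennreal (1/c))"
    have "emeasure Q (space Q) = ennreal (1/c) * emeasure \<rho> (space \<rho>)"
      unfolding Q_def by (subst emeasure_density) auto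
    also have "\<dots> = 1" using c by (simp add: emeasure_eq_measure c_def[symmetric] ennreal_mult[symmetric])
    finally have "prob_space Q" by (rule prob_spaceI)
    moreover have "sets Q = sets (sol_borel p)" by (simp add: Q_def s)
    moreover have "of_real c * ((\<integral>y. sol_char d l y \<partial>Q) - 1) = (\<integral>y. sol_char d l y - 1 \<partial>\<rho>)" for d l
    proof -
      have "sol_char d l \<in> borel_measurable \<rho>"
        using measurable_sol_char measurable_cong_sets[OF s refl] by blast
      then have "(\<integral>y. sol_char d l y \<partial>Q) = (1/c) *\<^sub>R (\<integral>y. sol_char d l y \<partial>\<rho>)"
        unfolding Q_def using c by (subst integral_density) auto
      then show ?thesis unfolding e using c by (simp add: scaleR_conv_of_real field_simps)
    qed
    ultimately show ?thesis using random_product_law[of Q p c] c by simp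
  qed
qed

text \<open>The partial products converge almost surely because their increments are summable in mean.\<close>

lemma infinite_product_law:
  assumes pr: "\<And>k::nat. prob_space (N k)" and s: "\<And>k. sets (N k) = sets (sol_borel p)"
    and sm: "\<And>d. summable (\<lambda>k. \<integral>y. cmod (y d - 1) \<partial>N k)"
  shows "\<exists>\<mu>. prob_space \<mu> \<and> sets \<mu> = sets (sol_borel p) \<and>
    (\<forall>d l. (\<lambda>n. \<Prod>k<n. \<integral>y. sol_char d l y \<partial>N k) \<longlonglongrightarrow> (\<integral>y. sol_char d l y \<partial>\<mu>))"
proof -
  interpret N: prob_space "N k" for k by (rule pr)
  let ?P = "Pi\<^sub>M (UNIV :: nat set) N"
  interpret P: prob_space ?P by (rule prob_space_PiM) (rule pr)
  note [measurable] = measurable_PiM_sol_component[OF s]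
  define S where "S = (\<lambda>n x. sol_prod x {..<n::nat})"
  have S_in: "S n x \<in> solenoid p" if "x \<in> space ?P" for n x
    unfolding S_def by (intro sol_prod_in space_PiM_sol[OF s that])
  have S_meas [measurable]: "(\<lambda>x. S n x d) \<in> borel_measurable ?P" for n d
    unfolding S_def sol_prod_def by measurable
  have "AE x in ?P. convergent (\<lambda>n. S n x d)" for d
  proof -
    have int: "(\<integral>\<^sup>+x. ennreal (cmod (x k d - 1)) \<partial>?P) = ennreal (\<integral>y. cmod (y d - 1) \<partial>N k)" for k
    proof -
      have m: "(\<lambda>y. y d) \<in> borel_measurable (N k)"
        using measurable_sol_coord measurable_cong_sets[OF s refl] by blast
      have "(\<integral>\<^sup>+x. ennreal (cmod (x k d - 1)) \<partial>?P)
          = (\<integral>\<^sup>+y. ennreal (cmod (y d - 1)) \<partial>distr ?P (N k) (\<lambda>x. x k))"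
        using m by (subst nn_integral_distr) auto
      also have "distr ?P (N k) (\<lambda>x. x k) = N k"
        by (rule distr_PiM_component) (auto intro: pr)
      also have "(\<integral>\<^sup>+y. ennreal (cmod (y d - 1)) \<partial>N k) = ennreal (\<integral>y. cmod (y d - 1) \<partial>N k)"
        by (intro nn_integral_eq_integral integrable_sol_continuous[OF N.finite_measure_axioms s])
          (auto intro!: continuous_intros)
      finally show ?thesis .
    qed
    have eq: "(\<integral>\<^sup>+x. (\<Sum>k. ennreal (cmod (x k d - 1))) \<partial>?P)
        = (\<Sum>k. ennreal (\<integral>y. cmod (y d - 1) \<partial>N k))"
      by (subst nn_integral_suminf) (auto simp: int)
    have "(\<Sum>k. ennreal (\<integral>y. cmod (y d - 1) \<partial>N k)) \<noteq> top"
      by (rule ennreal_suminf_neq_top[OF sm]) simp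
    then have "(\<integral>\<^sup>+x. (\<Sum>k. ennreal (cmod (x k d - 1))) \<partial>?P) \<noteq> \<infinity>"
      unfolding eq infinity_ennreal_def .
    then have "AE x in ?P. (\<Sum>k. ennreal (cmod (x k d - 1))) \<noteq> \<infinity>"
      by (rule nn_integral_PInf_AE[rotated]) measurable
    then show ?thesis
    proof (rule AE_mp, intro AE_I2 impI)
      fix x assume x: "x \<in> space ?P" and "(\<Sum>k. ennreal (cmod (x k d - 1))) \<noteq> \<infinity>"
      then have "summable (\<lambda>k. cmod (x k d - 1))"
        by (intro summable_suminf_not_top) (auto simp: infinity_ennreal_def)
      \<comment> \<open>Partial products have modulus 1, so an increment is exactly as long as the
        distance of the new factor from 1, and the product converges once these distances are
        summable.\<close>
      moreover have "cmod (S (Suc k) x d - S k x d) = cmod (x k d - 1)" for k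
      proof -
        have "S (Suc k) x d - S k x d = S k x d * (x k d - 1)"
          by (simp add: S_def sol_prod_def algebra_simps)
        then show ?thesis using solenoid_norm[OF S_in[OF x]] by (simp add: norm_mult)
      qed
      ultimately have "summable (\<lambda>k. S (Suc k) x d - S k x d)"
        by (intro summable_norm_cancel[of "\<lambda>k. S (Suc k) x d - S k x d"]) simp
      then have "convergent (\<lambda>n. \<Sum>k<n. S (Suc k) x d - S k x d)"
        by (rule summable_iff_convergent[THEN iffD1])
      then have "convergent (\<lambda>n. S n x d - S 0 x d)"
        by (simp only: sum_lessThan_telescope[of "\<lambda>k. S k x d"])
      then have "convergent (\<lambda>n. (S n x d - S 0 x d) + S 0 x d)"
        by (rule convergent_add) (rule convergent_const)
      then show "convergent (\<lambda>n. S n x d)" by simp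
    qed
  qed
  then have conv: "AE x in ?P. \<forall>d. convergent (\<lambda>n. S n x d)" by (simp add: AE_all_countable)
  \<comment> \<open>The test quantifies over all coordinates: one divergent coordinate resets the
    whole sequence to the identity, which keeps \<open>Y x\<close> in the solenoid for every x. It
    is phrased by \<open>Cauchy\<close> because the set where a sequence of measurable functions is
    Cauchy is known to be measurable.\<close>
  define Y where "Y = (\<lambda>x d. if \<forall>d. Cauchy (\<lambda>n. S n x d) then lim (\<lambda>n. S n x d) else 1)"
  have Ylim: "(\<lambda>n. S n x d) \<longlonglongrightarrow> Y x d" if "\<forall>d. convergent (\<lambda>n. S n x d)" for x d
    using that by (simp add: Y_def Cauchy_convergent_iff convergent_LIMSEQ_iff)
  have Y: "Y \<in> measurable ?P (sol_borel p)"
  proof (rule measurable_sol_borelI)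
    show "(\<lambda>x. Y x j) \<in> borel_measurable ?P" for j
    proof -
      note [measurable del] = measurable_sol_coord
      have [measurable]: "{x \<in> space ?P. Cauchy (\<lambda>n. S n x d)} \<in> sets ?P" for d
        by (rule sets_Collect_Cauchy) measurable
      show ?thesis unfolding Y_def by measurable
    qed
    fix x assume x: "x \<in> space ?P"
    show "Y x \<in> solenoid p"
    proof (cases "\<forall>d. convergent (\<lambda>n. S n x d)")
      case True
      note L = Ylim[OF True]
      show ?thesis
      proof (rule solenoidI)
        fix j
        show "cmod (Y x j) = 1"
          using tendsto_norm[OF L[of j]] solenoid_norm[OF S_in[OF x]] by (simp add: LIMSEQ_const_iff)
        show "Y x (Suc j) ^ p = Y x j"
        proof (rule LIMSEQ_unique)
          show "(\<lambda>n. S n x j) \<longlonglongrightarrow> Y x (Suc j) ^ p"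
            using tendsto_power[OF L[of "Suc j"], of p] by (simp only: solenoid_Suc[OF S_in[OF x]])
        qed (rule L)
      qed
    next
      case False
      then have "Y x = sol_one" by (intro ext) (auto simp: Y_def sol_one_def Cauchy_convergent_iff)
      then show ?thesis by simp
    qed
  qed
  define \<mu> where "\<mu> = distr ?P (sol_borel p) Y"
  have "prob_space \<mu>" unfolding \<mu>_def by (rule P.prob_space_distr[OF Y])
  moreover have "(\<lambda>n. \<Prod>k<n. \<integral>y. sol_char d l y \<partial>N k) \<longlonglongrightarrow> (\<integral>y. sol_char d l y \<partial>\<mu>)" for d l
  proof -
    have mS: "S n \<in> measurable ?P (sol_borel p)" for n
      by (rule measurable_sol_borelI) (auto intro: S_in)
    have "(\<lambda>n. \<integral>x. sol_char d l (S n x) \<partial>?P) \<longlonglongrightarrow> (\<integral>x. sol_char d l (Y x) \<partial>?P)"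
    proof (rule integral_dominated_convergence[where w="\<lambda>_. 1"])
      show "AE x in ?P. (\<lambda>n. sol_char d l (S n x)) \<longlonglongrightarrow> sol_char d l (Y x)"
        using conv
      proof (rule AE_mp, intro AE_I2 impI)
        fix x assume x: "x \<in> space ?P" "\<forall>d. convergent (\<lambda>n. S n x d)"
        show "(\<lambda>n. sol_char d l (S n x)) \<longlonglongrightarrow> sol_char d l (Y x)"
          unfolding sol_char_def
          by (intro tendsto_power_int Ylim[OF x(2)] solenoid_nonzero[OF measurable_space[OF Y x(1), simplified]])
      qed
    qed (auto intro!: AE_I2 measurable_compose[OF Y] measurable_compose[OF mS] simp: norm_sol_char[OF S_in])
    moreover have "(\<integral>x. sol_char d l (S n x) \<partial>?P) = (\<Prod>k<n. \<integral>y. sol_char d l y \<partial>N k)" for n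
      unfolding S_def sol_char_prod
      by (intro integral_PiM_prod pr integrable_sol_char[OF N.finite_measure_axioms s]) simp
    moreover have "(\<integral>y. sol_char d l y \<partial>\<mu>) = (\<integral>x. sol_char d l (Y x) \<partial>?P)"
      unfolding \<mu>_def by (rule integral_distr[OF Y measurable_sol_char])
    ultimately show ?thesis by simp
  qed
  ultimately show ?thesis by (auto simp: \<mu>_def)
qed

section \<open>Estimates near the identity\<close>

definition sol_H :: "(nat \<Rightarrow> complex) \<Rightarrow> real" where
  "sol_H y = arcsin (Im (y 0))"

lemma h_fun_solenoid: "y \<in> solenoid p \<Longrightarrow> h_fun (circ_arg (y 0)) = sol_H y"
  by (simp add: sol_H_def h_fun_circ_arg solenoid_circle)

lemma abs_Im_solenoid: "y \<in> solenoid p \<Longrightarrow> \<bar>Im (y j)\<bar> \<le> 1"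
  using abs_Im_le_cmod[of "y j"] solenoid_norm[of y p j] by simp

lemma continuous_on_sol_H: "continuous_on (solenoid p) sol_H"
  unfolding sol_H_def using abs_Im_solenoid[of _ p 0]
  by (intro continuous_intros) (auto simp: abs_le_iff)

lemma abs_sol_H: assumes "y \<in> solenoid p" shows "\<bar>sol_H y\<bar> \<le> 2"
proof -
  have "-1 \<le> Im (y 0)" "Im (y 0) \<le> 1" using abs_Im_solenoid[OF assms, of 0] by auto
  from arcsin_bounded[OF this] show ?thesis using pi_less_4 by (auto simp: sol_H_def)
qed

text \<open>Write y_d = cis t with |t| <= 2 |y_d - 1|. The radius is chosen so that |p^d t| <= 1/2 <
  pi/2; then arcsin inverts the sine of the argument of y_0 = cis(p^d t), and H equals p^d t without
  error.\<close>

lemma sol_local: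
  assumes "0 < p" and y: "y \<in> solenoid p" and close: "cmod (y d - 1) < 1 / (4 * real p ^ d)"
  shows "sol_char d l y = iexp (of_int l / real p ^ d * sol_H y)"
    and "\<bar>sol_H y\<bar> \<le> 2 * real p ^ d * cmod (y d - 1)"
proof -
  define t where "t = Arg (y d)"
  have P: "real p ^ d \<ge> 1" using assms(1) by simp
  have "1 / (4 * real p ^ d) \<le> 1/4" using P by (intro frac_le) auto
  then have half: "cmod (y d - 1) < 1/2" using close by linarith
  have "\<bar>t\<bar> \<le> cmod (Ln (1 + (y d - 1)))"
    unfolding t_def using Arg_eq_Im_Ln[OF solenoid_nonzero[OF y, of d]] abs_Im_le_cmod by simp
  also have "\<dots> \<le> 2 * cmod (y d - 1)" by (rule norm_Ln_le[OF half])
  finally have t: "\<bar>t\<bar> \<le> 2 * cmod (y d - 1)" .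
  have yd: "y d = cis t"
    unfolding t_def using cis_Arg[OF solenoid_nonzero[OF y, of d]] solenoid_norm[OF y, of d]
    by (simp add: sgn_div_norm)
  have Pt: "\<bar>real p ^ d * t\<bar> \<le> 2 * real p ^ d * cmod (y d - 1)"
    using mult_left_mono[OF t, of "real p ^ d"] P by (simp add: abs_mult mult.assoc mult.left_commute)
  also have "\<dots> \<le> 1/2"
    using mult_strict_left_mono[OF close, of "real p ^ d"] P assms(1) by (simp add: mult.assoc mult.left_commute)
  finally have small: "\<bar>real p ^ d * t\<bar> \<le> 1/2" .
  have "y 0 = cis (real p ^ d * t)"
    using solenoid_power[OF y, of 0 d] by (simp add: yd Complex.DeMoivre)
  then have H: "sol_H y = real p ^ d * t"
    using small pi_gt3 by (simp add: sol_H_def arcsin_sin abs_le_iff)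
  show "\<bar>sol_H y\<bar> \<le> 2 * real p ^ d * cmod (y d - 1)" using Pt by (simp add: H)
  show "sol_char d l y = iexp (of_int l / real p ^ d * sol_H y)"
  proof -
    have "of_int l / real p ^ d * sol_H y = of_int l * t" using P assms(1) by (simp add: H)
    then show ?thesis unfolding sol_char_def yd cis_power_int by (simp only: cis_conv_exp)
  qed
qed

text \<open>The integrand in the exponent of the generalized Poisson law, a remainder of second
  order at the identity.\<close>

definition sol_J :: "nat \<Rightarrow> nat \<Rightarrow> int \<Rightarrow> (nat \<Rightarrow> complex) \<Rightarrow> complex" where
  "sol_J p d l y = sol_char d l y - 1 - \<i> * of_real (of_int l / real p ^ d * sol_H y)"

text \<open>Adding the quadratic Taylor term makes the remainder of third order. One factor of
  distance is thus to spare over square integrability, so cutting it off near the identity changes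
  its integral by only O(\<delta>).\<close>

definition sol_F :: "nat \<Rightarrow> nat \<Rightarrow> int \<Rightarrow> (nat \<Rightarrow> complex) \<Rightarrow> complex" where
  "sol_F p d l y = sol_J p d l y + of_real ((of_int l / real p ^ d * sol_H y)\<^sup>2 / 2)"

lemma continuous_on_sol_J: "continuous_on (solenoid p) (sol_J p d l)"
  unfolding sol_J_def by (intro continuous_intros continuous_on_sol_H continuous_on_sol_char)

lemma continuous_on_sol_F: "continuous_on (solenoid p) (sol_F p d l)"
  unfolding sol_F_def by (intro continuous_intros continuous_on_sol_H continuous_on_sol_J) simp

lemma iexp_quadratic: "cmod (iexp x - 1 - \<i> * of_real x) \<le> x\<^sup>2 / 2"
  using iexp_approx1[of x 1] by (simp add: atMost_Suc power2_eq_square diff_diff_eq add.commute)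

lemma iexp_cubic: "cmod (iexp x - 1 - \<i> * of_real x + of_real (x\<^sup>2 / 2)) \<le> \<bar>x\<bar> ^ 3 / 6"
proof -
  have "(\<Sum>k\<le>2. (\<i> * complex_of_real x) ^ k / fact k) = 1 + \<i> * of_real x - of_real (x\<^sup>2 / 2)"
    by (simp add: numeral_2_eq_2 atMost_Suc power_mult_distrib)
  then show ?thesis using iexp_approx1[of x 2] by (simp add: algebra_simps numeral_3_eq_3 numeral_2_eq_2)
qed

text \<open>Extends a local estimate to the whole solenoid: outside the radius \<delta> the power of
  the distance is at least \<delta>^k, so the uniform bound B is at most B/\<delta>^k times
  it.\<close>

lemma bound_by_power_of_distance:
  fixes f :: "(nat \<Rightarrow> complex) \<Rightarrow> 'b::real_normed_vector"
  assumes "0 < \<delta>" "0 \<le> C" "0 \<le> B"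
    and "\<And>y. y \<in> solenoid p \<Longrightarrow> cmod (y d - 1) < \<delta> \<Longrightarrow> norm (f y) \<le> C * cmod (y d - 1) ^ k"
    and "\<And>y. y \<in> solenoid p \<Longrightarrow> norm (f y) \<le> B"
  shows "\<exists>C\<ge>0. \<forall>y\<in>solenoid p. norm (f y) \<le> C * cmod (y d - 1) ^ k"
proof (intro exI conjI ballI)
  show "0 \<le> C + B / \<delta> ^ k" using assms by simp
  fix y assume y: "y \<in> solenoid p"
  show "norm (f y) \<le> (C + B / \<delta> ^ k) * cmod (y d - 1) ^ k"
  proof (cases "cmod (y d - 1) < \<delta>")
    case True
    have "C * cmod (y d - 1) ^ k \<le> (C + B / \<delta> ^ k) * cmod (y d - 1) ^ k"
      using assms(1,3) by (intro mult_right_mono) auto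
    then show ?thesis using assms(4)[OF y True] by simp
  next
    case False
    have "B = B / \<delta> ^ k * \<delta> ^ k" using assms(1) by simp
    also have "\<dots> \<le> (C + B / \<delta> ^ k) * cmod (y d - 1) ^ k"
      using assms(1-3) False by (intro mult_mono power_mono) auto
    finally show ?thesis using assms(5)[OF y] by simp
  qed
qed

lemma distance_radius_pos: "0 < p \<Longrightarrow> 0 < 1 / (4 * real p ^ d)"
  by simp

lemma sol_H_bound:
  assumes "0 < p"
  shows "\<exists>C\<ge>0. \<forall>y\<in>solenoid p. \<bar>sol_H y\<bar> \<le> C * cmod (y d - 1)"
  using bound_by_power_of_distance[OF distance_radius_pos[OF assms], of "2 * real p ^ d" 2 p d d sol_H 1]
    sol_local(2)[OF assms] abs_sol_H by simp

text \<open>Near the identity \<open>sol_local\<close> turns \<open>sol_J\<close> into exp(ix) - 1 -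
  ix with x = \<theta> H, and H is itself bounded by a multiple of the distance.\<close>

lemma sol_J_bound:
  assumes "0 < p"
  shows "\<exists>C\<ge>0. \<forall>y\<in>solenoid p. cmod (sol_J p d l y) \<le> C * (cmod (y d - 1))\<^sup>2"
proof -
  define \<theta> where "\<theta> = of_int l / real p ^ d"
  define P where "P = real p ^ d"
  obtain B where B: "\<forall>y\<in>solenoid p. norm (sol_J p d l y) \<le> B"
    using bounded_sol_continuous[OF continuous_on_sol_J] ..
  show ?thesis
  proof (rule bound_by_power_of_distance[OF distance_radius_pos[OF assms, of d]])
    fix y assume y: "y \<in> solenoid p"
    then show "cmod (sol_J p d l y) \<le> \<bar>B\<bar>" using B by fastforce
    assume cl: "cmod (y d - 1) < 1 / (4 * real p ^ d)"
    have "cmod (sol_J p d l y) \<le> (\<theta> * sol_H y)\<^sup>2 / 2"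
      unfolding sol_J_def sol_local(1)[OF assms y cl] \<theta>_def[symmetric] by (rule iexp_quadratic)
    also have "\<dots> = \<theta>\<^sup>2 / 2 * \<bar>sol_H y\<bar>\<^sup>2" by (simp add: power_mult_distrib)
    also have "\<dots> \<le> \<theta>\<^sup>2 / 2 * (2 * P * cmod (y d - 1))\<^sup>2"
      by (intro mult_left_mono power_mono sol_local(2)[OF assms y cl, folded P_def]) auto
    finally show "cmod (sol_J p d l y) \<le> (\<theta>\<^sup>2 / 2 * (2 * P)\<^sup>2) * (cmod (y d - 1))\<^sup>2"
      by (simp add: power_mult_distrib mult.assoc)
  qed (auto simp: P_def)
qed

lemma sol_F_bound:
  assumes "0 < p"
  shows "\<exists>C\<ge>0. \<forall>y\<in>solenoid p. cmod (sol_F p d l y) \<le> C * (cmod (y d - 1)) ^ 3"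
proof -
  define \<theta> where "\<theta> = of_int l / real p ^ d"
  define P where "P = real p ^ d"
  obtain B where B: "\<forall>y\<in>solenoid p. norm (sol_F p d l y) \<le> B"
    using bounded_sol_continuous[OF continuous_on_sol_F] ..
  show ?thesis
  proof (rule bound_by_power_of_distance[OF distance_radius_pos[OF assms, of d]])
    fix y assume y: "y \<in> solenoid p"
    then show "cmod (sol_F p d l y) \<le> \<bar>B\<bar>" using B by fastforce
    assume cl: "cmod (y d - 1) < 1 / (4 * real p ^ d)"
    have "cmod (sol_F p d l y) \<le> \<bar>\<theta> * sol_H y\<bar> ^ 3 / 6"
      unfolding sol_F_def sol_J_def sol_local(1)[OF assms y cl] \<theta>_def[symmetric] by (rule iexp_cubic)
    also have "\<dots> = \<bar>\<theta>\<bar> ^ 3 / 6 * \<bar>sol_H y\<bar> ^ 3" by (simp add: power_mult_distrib power_divide abs_mult)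
    also have "\<dots> \<le> \<bar>\<theta>\<bar> ^ 3 / 6 * (2 * P * cmod (y d - 1)) ^ 3"
      by (intro mult_left_mono power_mono sol_local(2)[OF assms y cl, folded P_def]) auto
    finally show "cmod (sol_F p d l y) \<le> (\<bar>\<theta>\<bar> ^ 3 / 6 * (2 * P) ^ 3) * (cmod (y d - 1)) ^ 3"
      by (simp add: power_mult_distrib mult.assoc)
  qed (auto simp: P_def)
qed

text \<open>Translates the character condition on a Levy measure into square integrability of the
  distance |y_d - 1|, the form in which it is used throughout.\<close>

lemma one_minus_Re_sol_char:
  assumes "y \<in> solenoid p"
  shows "(cmod (y d - 1))\<^sup>2 = 2 * (1 - Re (sol_char d 1 y))"
proof -
  have "(Re (y d))\<^sup>2 + (Im (y d))\<^sup>2 = 1"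
    using solenoid_norm[OF assms, of d] by (simp add: cmod_def)
  then show ?thesis unfolding cmod_power2 by (simp add: sol_char_def power2_eq_square algebra_simps)
qed

section \<open>Integrability with respect to a Levy measure\<close>

lemma levy_measure_sets: "levy_measure p \<eta> \<Longrightarrow> sets \<eta> = sets (sol_borel p)"
  by (simp add: levy_measure_def)

lemma levy_integrable_distance:
  assumes "levy_measure p \<eta>"
  shows "integrable \<eta> (\<lambda>y. (cmod (y d - 1))\<^sup>2)"
proof -
  note s = levy_measure_sets[OF assms]
  have "integrable \<eta> (\<lambda>y. 1 - Re (sol_char d 1 y))"
  proof (rule integrableI_nonneg)
    show "(\<lambda>y. 1 - Re (sol_char d 1 y)) \<in> borel_measurable \<eta>"
      unfolding measurable_cong_sets[OF s refl] by measurable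
    show "AE y in \<eta>. 0 \<le> 1 - Re (sol_char d 1 y)"
      using space_eq_solenoid[OF s] norm_sol_char[of _ p d 1]
      by (intro AE_I2) (metis complex_Re_le_cmod diff_ge_0_iff_ge)
    show "(\<integral>\<^sup>+y. ennreal (1 - Re (sol_char d 1 y)) \<partial>\<eta>) < \<infinity>"
      using assms unfolding levy_measure_def by blast
  qed
  then have "integrable \<eta> (\<lambda>y. 2 * (1 - Re (sol_char d 1 y)))" by (rule integrable_mult_right)
  then show ?thesis
    by (rule Bochner_Integration.integrable_cong[THEN iffD1, rotated 2])
      (auto simp: one_minus_Re_sol_char space_eq_solenoid[OF s])
qed

lemma levy_integrable:
  fixes f :: "(nat \<Rightarrow> complex) \<Rightarrow> 'b::{banach, second_countable_topology}"
  assumes "levy_measure p \<eta>" and "f \<in> borel_measurable (sol_borel p)"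
    and bd: "\<And>y. y \<in> solenoid p \<Longrightarrow> norm (f y) \<le> C * (cmod (y d - 1))\<^sup>2"
  shows "integrable \<eta> f"
proof -
  note s = levy_measure_sets[OF assms(1)]
  show ?thesis
  proof (rule Bochner_Integration.integrable_bound)
    show "integrable \<eta> (\<lambda>y. C * (cmod (y d - 1))\<^sup>2)"
      by (rule integrable_mult_right[OF levy_integrable_distance[OF assms(1)]])
    show "f \<in> borel_measurable \<eta>" using assms(2) unfolding measurable_cong_sets[OF s refl] .
    show "AE y in \<eta>. norm (f y) \<le> norm (C * (cmod (y d - 1))\<^sup>2)"
      using bd space_eq_solenoid[OF s] by (intro AE_I2) (auto intro: order_trans[OF _ abs_ge_self])
  qed
qed

lemma levy_integrable_sol_J:
  assumes "0 < p" "levy_measure p \<eta>"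
  shows "integrable \<eta> (sol_J p d l)"
proof -
  obtain C where "\<forall>y\<in>solenoid p. cmod (sol_J p d l y) \<le> C * (cmod (y d - 1))\<^sup>2"
    using sol_J_bound[OF assms(1)] by blast
  then show ?thesis
    by (intro levy_integrable[OF assms(2) borel_measurable_sol_continuous[OF continuous_on_sol_J], where C = C and d = d]) auto
qed

lemma levy_integrable_sol_H_squared:
  assumes "0 < p" "levy_measure p \<eta>"
  shows "integrable \<eta> (\<lambda>y. (sol_H y)\<^sup>2)"
proof -
  obtain C where C: "\<forall>y\<in>solenoid p. \<bar>sol_H y\<bar> \<le> C * cmod (y 0 - 1)"
    using sol_H_bound[OF assms(1)] by blast
  have "continuous_on (solenoid p) (\<lambda>y. (sol_H y)\<^sup>2)" by (intro continuous_intros continuous_on_sol_H)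
  moreover have "norm ((sol_H y)\<^sup>2) \<le> C\<^sup>2 * (cmod (y 0 - 1))\<^sup>2" if "y \<in> solenoid p" for y
    using power_mono[of "\<bar>sol_H y\<bar>" "C * cmod (y 0 - 1)" 2] C that by (simp add: power_mult_distrib)
  ultimately show ?thesis
    by (intro levy_integrable[OF assms(2) borel_measurable_sol_continuous])
qed

text \<open>Chebyshev's inequality: the indicator of the set is at most |y_d - 1|^2 / r^2.\<close>

lemma levy_measure_finite:
  assumes "levy_measure p \<eta>" "0 < r"
  shows "emeasure \<eta> {y \<in> solenoid p. r \<le> cmod (y d - 1)} < \<infinity>"
proof -
  note s = levy_measure_sets[OF assms(1)]
  have i: "integrable \<eta> (\<lambda>y. (cmod (y d - 1))\<^sup>2 / r\<^sup>2)"
    using levy_integrable_distance[OF assms(1)] by simp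
  have sp: "space \<eta> = solenoid p" by (rule space_eq_solenoid[OF s])
  have "(\<lambda>y. y d) \<in> borel_measurable \<eta>"
    using measurable_sol_coord unfolding measurable_cong_sets[OF s refl] .
  then have A: "{y \<in> space \<eta>. r \<le> cmod (y d - 1)} \<in> sets \<eta>" by measurable
  have "integrable \<eta> (indicat_real {y \<in> space \<eta>. r \<le> cmod (y d - 1)})"
  proof (rule Bochner_Integration.integrable_bound[OF i])
    show "AE y in \<eta>. norm (indicat_real {y \<in> space \<eta>. r \<le> cmod (y d - 1)} y) \<le> norm ((cmod (y d - 1))\<^sup>2 / r\<^sup>2)"
      using assms(2) by (intro AE_I2) (auto simp: indicator_def divide_simps)
  qed (use A in simp)
  then show ?thesis using A by (auto simp: integrable_indicator_iff sp less_top Int_absorb2)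
qed

section \<open>The generalized Poisson law\<close>

lemma norm_exp_minus_one_le:
  fixes z :: complex
  assumes "cmod z \<le> 1"
  shows "cmod (exp z - 1) \<le> 3 * cmod z"
proof -
  have "cmod (exp z - 1) \<le> exp (cmod z) * cmod z" using Taylor_exp_field[of z 0] by simp
  also have "\<dots> \<le> 3 * cmod z"
    using assms exp_le by (intro mult_right_mono) (auto intro: order_trans[of _ "exp 1"])
  finally show ?thesis .
qed

text \<open>Restricted to A, \<eta> is a finite measure \<rho> and has a compound Poisson law with
  exponent the integral of \<open>sol_char d l y - 1\<close>. The missing compensator is linear in
  l/p^d, hence a deterministic shift along \<open>sol_line\<close> by minus the integral of H over
  \<rho>.\<close>

lemma centered_poisson_piece:
  assumes "0 < p" and s: "sets \<eta> = sets (sol_borel p)" and A: "A \<in> sets \<eta>" "emeasure \<eta> A < \<infinity>"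
  shows "\<exists>\<mu>. prob_space \<mu> \<and> sets \<mu> = sets (sol_borel p) \<and>
    (\<forall>d l. (\<integral>y. sol_char d l y \<partial>\<mu>) = exp (\<integral>y. indicator A y *\<^sub>R sol_J p d l y \<partial>\<eta>))"
proof -
  define \<rho> where "\<rho> = density \<eta> (\<lambda>y. ennreal (indicator A y))"
  have sr: "sets \<rho> = sets (sol_borel p)" by (simp add: \<rho>_def s)
  have "emeasure \<rho> (space \<rho>) = (\<integral>\<^sup>+y. indicator A y \<partial>\<eta>)"
    unfolding \<rho>_def using A(1)
    by (subst emeasure_density) (auto intro!: nn_integral_cong split: split_indicator simp del: nn_integral_indicator)
  then have "emeasure \<rho> (space \<rho>) = emeasure \<eta> A" using A(1) by (simp add: ennreal_indicator[abs_def])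
  then have fin: "finite_measure \<rho>" using A(2) by (intro finite_measureI) auto
  have int: "integrable \<rho> f" if "continuous_on (solenoid p) f" for f :: "(nat \<Rightarrow> complex) \<Rightarrow> complex"
    by (rule integrable_sol_continuous[OF fin sr that])
  obtain \<mu> where \<mu>: "prob_space \<mu>" "sets \<mu> = sets (sol_borel p)"
    "\<And>d l. (\<integral>y. sol_char d l y \<partial>\<mu>) = exp (\<integral>y. sol_char d l y - 1 \<partial>\<rho>)"
    using compound_poisson_exists[OF fin sr] by blast
  define t where "t = - (\<integral>y. sol_H y \<partial>\<rho>)"
  define r where "r = return (sol_borel p) (sol_line p t)"
  have r: "prob_space r" "sets r = sets (sol_borel p)"
    unfolding r_def using sol_line_in[OF assms(1)] by (auto intro: prob_space_return_sol)
  have "(\<integral>y. sol_char d l y \<partial>sol_conv p \<mu> r) = exp (\<integral>y. indicator A y *\<^sub>R sol_J p d l y \<partial>\<eta>)" for d l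
  proof -
    let ?\<theta> = "of_int l / real p ^ d"
    have "(\<integral>y. sol_char d l y \<partial>sol_conv p \<mu> r) = exp (\<integral>y. sol_char d l y - 1 \<partial>\<rho>) * cis (?\<theta> * t)"
      unfolding integral_sol_char_sol_conv[OF \<mu>(1,2) r] \<mu>(3)
      by (simp add: r_def integral_sol_char_return[OF sol_line_in[OF assms(1)]] sol_char_sol_line)
    also have "\<dots> = exp ((\<integral>y. sol_char d l y - 1 \<partial>\<rho>) + \<i> * of_real (?\<theta> * t))"
      by (simp add: cis_conv_exp exp_add)
    also have "\<i> * of_real (?\<theta> * t) = - (\<integral>y. \<i> * of_real (?\<theta> * sol_H y) \<partial>\<rho>)"
      by (simp add: t_def integral_complex_of_real[symmetric] del: integral_complex_of_real)
    also have "(\<integral>y. sol_char d l y - 1 \<partial>\<rho>) + - (\<integral>y. \<i> * of_real (?\<theta> * sol_H y) \<partial>\<rho>) = (\<integral>y. sol_J p d l y \<partial>\<rho>)"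
      unfolding sol_J_def add_uminus_conv_diff
      by (rule Bochner_Integration.integral_diff[symmetric])
        (use assms(1) in \<open>auto intro!: int continuous_intros continuous_on_sol_H continuous_on_sol_char\<close>)
    also have "\<dots> = (\<integral>y. indicator A y *\<^sub>R sol_J p d l y \<partial>\<eta>)"
    proof -
      have "sol_J p d l \<in> borel_measurable \<eta>"
        using borel_measurable_sol_continuous[OF continuous_on_sol_J] unfolding measurable_cong_sets[OF s refl] .
      then show ?thesis unfolding \<rho>_def using A(1) by (intro integral_density) auto
    qed
    finally show ?thesis .
  qed
  then show ?thesis
    using prob_space_sol_conv[OF \<mu>(1,2) r] sets_sol_conv[OF \<mu>(1,2) r] by blast
qed

text \<open>The second moment of the distance is 2 (1 - Re exp z) <= 6 |z|, and u <= r u^2 + 1/r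
  passes to the first moment. The free parameter r later balances the two terms on each
  shell.\<close>

lemma mean_distance_le:
  assumes "prob_space \<mu>" and s: "sets \<mu> = sets (sol_borel p)" and "0 < r"
    and \<phi>: "(\<integral>y. sol_char d 1 y \<partial>\<mu>) = exp z" "cmod z \<le> 1"
  shows "(\<integral>y. cmod (y d - 1) \<partial>\<mu>) \<le> r * (6 * cmod z) + 1 / r"
proof -
  interpret prob_space \<mu> by fact
  have i: "integrable \<mu> f" if "continuous_on (solenoid p) f" for f :: "(nat \<Rightarrow> complex) \<Rightarrow> real"
    by (rule integrable_sol_continuous[OF finite_measure_axioms s that])
  have "(\<integral>y. (cmod (y d - 1))\<^sup>2 \<partial>\<mu>) = (\<integral>y. 2 * (1 - Re (sol_char d 1 y)) \<partial>\<mu>)"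
    by (intro Bochner_Integration.integral_cong refl one_minus_Re_sol_char)
      (simp add: space_eq_solenoid[OF s])
  also have "\<dots> = 2 * (1 - Re (exp z))"
    using integrable_sol_char[OF finite_measure_axioms s] by (simp add: \<phi>(1)[symmetric] prob_space)
  also have "1 - Re (exp z) \<le> cmod (exp z - 1)"
    using abs_Re_le_cmod[of "exp z - 1"] by simp
  also have "\<dots> \<le> 3 * cmod z" by (rule norm_exp_minus_one_le[OF \<phi>(2)])
  finally have sq: "(\<integral>y. (cmod (y d - 1))\<^sup>2 \<partial>\<mu>) \<le> 6 * cmod z" by simp
  have "(\<integral>y. cmod (y d - 1) \<partial>\<mu>) \<le> (\<integral>y. r * (cmod (y d - 1))\<^sup>2 + 1 / r \<partial>\<mu>)"
  proof (rule integral_mono)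
    fix y
    define u where "u = cmod (y d - 1)"
    have "0 \<le> (r * u - 1)\<^sup>2" by simp
    then have "2 * (r * u) \<le> r * (r * u\<^sup>2) + 1" by (simp add: power2_eq_square algebra_simps)
    moreover have "0 \<le> r * u" using assms(3) by (simp add: u_def)
    ultimately have "r * u \<le> r * (r * u\<^sup>2) + 1" by linarith
    also have "\<dots> = r * (r * u\<^sup>2 + 1 / r)" using assms(3) by (simp add: field_simps)
    finally have "u \<le> r * u\<^sup>2 + 1 / r" using assms(3) by simp
    then show "cmod (y d - 1) \<le> r * (cmod (y d - 1))\<^sup>2 + 1 / r" by (simp add: u_def)
  qed (auto intro!: i continuous_intros)
  also have "\<dots> = r * (\<integral>y. (cmod (y d - 1))\<^sup>2 \<partial>\<mu>) + 1 / r"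
    by (subst Bochner_Integration.integral_add) (auto intro!: i continuous_intros simp: prob_space)
  also have "\<dots> \<le> r * (6 * cmod z) + 1 / r"
    using sq assms(3) by simp
  finally show ?thesis .
qed

text \<open>\<open>sol_J\<close> is integrable and vanishes at the identity, so its integral outside
  an exhausting sequence of sets tends to 0. The rate 4^-k is demanded only for the finitely many d
  <= k, so one index serves them all; every fixed d is still covered from k = d on.\<close>

lemma levy_exhaustion:
  assumes "0 < p" "levy_measure p \<eta>"
  obtains U :: "nat \<Rightarrow> (nat \<Rightarrow> complex) set" where "incseq U" "U 0 = {}"
    "\<And>k. U k \<in> sets \<eta>" "\<And>k. emeasure \<eta> (U k) < \<infinity>"
    "(\<Union>k. U k) = solenoid p - {sol_one}"
    "\<And>d k. d \<le> k \<Longrightarrow> (\<integral>y. indicator (- U (Suc k)) y * cmod (sol_J p d 1 y) \<partial>\<eta>) \<le> (1/4) ^ k"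
proof -
  note s = levy_measure_sets[OF assms(2)]
  have sp: "space \<eta> = solenoid p" by (rule space_eq_solenoid[OF s])
  \<comment> \<open>The number of inspected coordinates grows while the threshold shrinks, so the
    \<open>V n\<close> increase to the complement of the identity.\<close>
  define V where "V n = (\<Union>j\<le>n. {y \<in> solenoid p. 1 / real (Suc n) \<le> cmod (y j - 1)})" for n
  have [measurable]: "(\<lambda>y. y j) \<in> borel_measurable \<eta>" for j
    using measurable_sol_coord unfolding measurable_cong_sets[OF s refl] .
  have V1: "{y \<in> solenoid p. c \<le> cmod (y j - 1)} \<in> sets \<eta>" for c j
    unfolding sp[symmetric] by measurable
  have V_sets: "V n \<in> sets \<eta>" for n unfolding V_def by (intro sets.finite_UN V1) auto
  have V_fin: "emeasure \<eta> (V n) < \<infinity>" for n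
  proof -
    have "emeasure \<eta> (V n) \<le> (\<Sum>j\<le>n. emeasure \<eta> {y \<in> solenoid p. 1 / real (Suc n) \<le> cmod (y j - 1)})"
      unfolding V_def by (intro emeasure_subadditive_finite) (auto intro: V1)
    also have "\<dots> < \<infinity>" using levy_measure_finite[OF assms(2)] by simp
    finally show ?thesis .
  qed
  have V_mono: "V m \<subseteq> V n" if "m \<le> n" for m n
  proof
    fix y assume "y \<in> V m"
    then obtain j where "j \<le> m" "y \<in> solenoid p" "1 / real (Suc m) \<le> cmod (y j - 1)" by (auto simp: V_def)
    moreover have "1 / real (Suc n) \<le> 1 / real (Suc m)" using that by (simp add: frac_le)
    ultimately have "j \<le> n" "y \<in> solenoid p" "1 / real (Suc n) \<le> cmod (y j - 1)"
      using that by linarith+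
    then show "y \<in> V n" unfolding V_def by blast
  qed
  have V_ex: "\<exists>n. y \<in> V n" if y: "y \<in> solenoid p" "y \<noteq> sol_one" for y
  proof -
    obtain j where "y j \<noteq> 1" using y(2) by (auto simp: sol_one_def)
    then have "0 < cmod (y j - 1)" by simp
    then obtain n where "inverse (real (Suc n)) < cmod (y j - 1)" using reals_Archimedean by blast
    then have "1 / real (Suc (max n j)) \<le> cmod (y j - 1)"
      using frac_le[of 1 1 "real (Suc n)" "real (Suc (max n j))"]
      unfolding divide_inverse mult_1_left by linarith
    then show ?thesis using y(1) unfolding V_def by (intro exI[of _ "max n j"]) auto
  qed
  have V_one: "sol_one \<notin> V n" for n by (auto simp: V_def sol_one_def)
  define T where "T d n = (\<integral>y. indicator (- V n) y * cmod (sol_J p d 1 y) \<partial>\<eta>)" for d n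
  have T: "T d \<longlonglongrightarrow> 0" for d
  proof -
    have [measurable]: "sol_J p d 1 \<in> borel_measurable \<eta>"
      using levy_integrable_sol_J[OF assms] by (rule borel_measurable_integrable)
    note [measurable] = V_sets
    have "(\<lambda>n. \<integral>y. indicator (- V n) y * cmod (sol_J p d 1 y) \<partial>\<eta>) \<longlonglongrightarrow> (\<integral>y. 0 \<partial>\<eta>)"
    proof (rule integral_dominated_convergence[where w="\<lambda>y. cmod (sol_J p d 1 y)"])
      show "integrable \<eta> (\<lambda>y. cmod (sol_J p d 1 y))" using levy_integrable_sol_J[OF assms] by simp
      show "AE y in \<eta>. (\<lambda>n. indicator (- V n) y * cmod (sol_J p d 1 y)) \<longlonglongrightarrow> 0"
      proof (rule AE_I2)
        fix y assume "y \<in> space \<eta>"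
        then have y: "y \<in> solenoid p" by (simp add: sp)
        show "(\<lambda>n. indicator (- V n) y * cmod (sol_J p d 1 y)) \<longlonglongrightarrow> 0"
        proof (cases "y = sol_one")
          case True
          then have "sol_J p d 1 y = 0" by (simp add: sol_J_def sol_H_def sol_char_def sol_one_def)
          then show ?thesis by simp
        next
          case False
          then obtain n where "y \<in> V n" using V_ex[OF y] by blast
          then have "eventually (\<lambda>m. indicator (- V m) y * cmod (sol_J p d 1 y) = 0) sequentially"
            using V_mono by (auto simp: eventually_sequentially indicator_def intro!: exI[of _ n])
          then show ?thesis by (rule tendsto_eventually)
        qed
      qed
      show "(\<lambda>y. indicator (- V n) y * cmod (sol_J p d 1 y)) \<in> borel_measurable \<eta>" for n
      proof (rule borel_measurable_times)
        have "indicat_real (space \<eta> - V n) \<in> borel_measurable \<eta>" by measurable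
        then show "indicat_real (- V n) \<in> borel_measurable \<eta>"
          by (rule measurable_cong[THEN iffD1, rotated]) (simp add: indicator_def)
      qed measurable
    qed (auto simp: indicator_def)
    then show ?thesis by (simp add: T_def[abs_def])
  qed
  have "\<forall>k. \<exists>m. \<forall>n\<ge>m. \<forall>d\<in>{..k}. T d n \<le> (1/4) ^ k"
  proof
    fix k :: nat
    have "eventually (\<lambda>n. \<forall>d\<in>{..k}. T d n < (1/4) ^ k) sequentially"
      using order_tendstoD(2)[OF T] by (intro eventually_ball_finite) auto
    then show "\<exists>m. \<forall>n\<ge>m. \<forall>d\<in>{..k}. T d n \<le> (1/4) ^ k"
      unfolding eventually_sequentially by (meson less_imp_le)
  qed
  then obtain m where m: "\<And>k n d. m k \<le> n \<Longrightarrow> d \<le> k \<Longrightarrow> T d n \<le> (1/4) ^ k"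
    by (metis atMost_iff)
  \<comment> \<open>Summing the \<open>Suc (m i)\<close> yields a monotone index that dominates
    \<open>m k\<close>, for the tail bound, and k, so that the sets chosen still exhaust.\<close>
  define N where "N k = (\<Sum>i\<le>k. Suc (m i))" for k
  have N_ge: "m k \<le> N k" "k \<le> N k" for k
  proof -
    show "m k \<le> N k" unfolding N_def using member_le_sum[of k "{..k}" "\<lambda>i. Suc (m i)"] by simp
    show "k \<le> N k" by (induction k) (auto simp: N_def)
  qed
  have N_mono: "N i \<le> N j" if "i \<le> j" for i j
    unfolding N_def using that by (intro sum_mono2) auto
  \<comment> \<open>The shift by one makes room for \<open>U 0 = {}\<close>; this is why the tail
    estimate speaks of \<open>U (Suc k)\<close>.\<close>
  define U where "U k = (case k of 0 \<Rightarrow> {} | Suc i \<Rightarrow> V (N i))" for k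
  show ?thesis
  proof (rule that[of U])
    show "incseq U" unfolding incseq_def U_def using V_mono N_mono by (auto split: nat.split) 
    show "U 0 = {}" by (simp add: U_def)
    show "U k \<in> sets \<eta>" "emeasure \<eta> (U k) < \<infinity>" for k
      using V_sets V_fin by (auto simp: U_def split: nat.split)
    show "(\<Union>k. U k) = solenoid p - {sol_one}"
    proof (intro equalityI subsetI)
      fix y assume "y \<in> (\<Union>k. U k)"
      then obtain k where "y \<in> U k" by blast
      then obtain n where n: "y \<in> V n" by (cases k) (auto simp: U_def)
      then show "y \<in> solenoid p - {sol_one}" using V_one by (auto simp: V_def)
    next
      fix y assume "y \<in> solenoid p - {sol_one}"
      then obtain n where "y \<in> V n" using V_ex by blast
      then have "y \<in> U (Suc n)" using V_mono[OF N_ge(2)[of n]] by (auto simp: U_def)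
      then show "y \<in> (\<Union>k. U k)" by blast
    qed
    show "(\<integral>y. indicator (- U (Suc k)) y * cmod (sol_J p d 1 y) \<partial>\<eta>) \<le> (1/4) ^ k" if "d \<le> k" for d k
      using m[OF N_ge(1) that] by (simp add: U_def T_def)
  qed
qed

lemma gen_poisson_exists:
  assumes "0 < p" "levy_measure p \<eta>"
  shows "\<exists>\<mu>. prob_space \<mu> \<and> sets \<mu> = sets (sol_borel p) \<and>
    (\<forall>d l. (\<integral>y. sol_char d l y \<partial>\<mu>) = exp (\<integral>y. sol_J p d l y \<partial>\<eta>))"
proof (rule levy_exhaustion[OF assms])
  fix U :: "nat \<Rightarrow> (nat \<Rightarrow> complex) set"
  assume U: "incseq U" "U 0 = {}" "\<And>k. U k \<in> sets \<eta>" "\<And>k. emeasure \<eta> (U k) < \<infinity>"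
    "(\<Union>k. U k) = solenoid p - {sol_one}"
    "\<And>d k. d \<le> k \<Longrightarrow> (\<integral>y. indicator (- U (Suc k)) y * cmod (sol_J p d 1 y) \<partial>\<eta>) \<le> (1/4) ^ k"
  note s = levy_measure_sets[OF assms(2)]
  have sp: "space \<eta> = solenoid p" by (rule space_eq_solenoid[OF s])
  note J_int = levy_integrable_sol_J[OF assms]
  define A where "A k = U (Suc k) - U k" for k
  have A: "A k \<in> sets \<eta>" "emeasure \<eta> (A k) < \<infinity>" for k
  proof -
    show "A k \<in> sets \<eta>" unfolding A_def using U(3) by auto
    have "emeasure \<eta> (A k) \<le> emeasure \<eta> (U (Suc k))" unfolding A_def using U(3) by (intro emeasure_mono) auto
    then show "emeasure \<eta> (A k) < \<infinity>" using U(4)[of "Suc k"] by (rule le_less_trans)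
  qed
  have AJ: "integrable \<eta> (\<lambda>y. indicator B y *\<^sub>R sol_J p d l y)" if "B \<in> sets \<eta>" for B d l
    by (rule integrable_mult_indicator[OF that J_int])
  define z where "z k d l = (\<integral>y. indicator (A k) y *\<^sub>R sol_J p d l y \<partial>\<eta>)" for k d l
  have "\<forall>k. \<exists>\<mu>. prob_space \<mu> \<and> sets \<mu> = sets (sol_borel p) \<and> (\<forall>d l. (\<integral>y. sol_char d l y \<partial>\<mu>) = exp (z k d l))"
    unfolding z_def by (intro allI centered_poisson_piece[OF assms(1) s A])
  then obtain N where N: "\<And>k. prob_space (N k)" "\<And>k. sets (N k) = sets (sol_borel p)"
    "\<And>k d l. (\<integral>y. sol_char d l y \<partial>N k) = exp (z k d l)" by metis
  \<comment> \<open>The shell \<open>A (Suc k)\<close> lies outside \<open>U (Suc k)\<close>, so the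
    tail bound applies to it. The first shell \<open>A 0\<close> has no such bound; as a single term
    it does not affect summability.\<close>
  have z_le: "cmod (z (Suc k) d 1) \<le> (1/4) ^ k" if "d \<le> k" for k d
  proof -
    have "cmod (z (Suc k) d 1) \<le> (\<integral>y. norm (indicator (A (Suc k)) y *\<^sub>R sol_J p d 1 y) \<partial>\<eta>)"
      unfolding z_def by (rule integral_norm_bound)
    also have "\<dots> \<le> (\<integral>y. indicator (- U (Suc k)) y * cmod (sol_J p d 1 y) \<partial>\<eta>)"
    proof (rule integral_mono)
      show "integrable \<eta> (\<lambda>y. norm (indicator (A (Suc k)) y *\<^sub>R sol_J p d 1 y))"
        using AJ[OF A(1)] by (rule integrable_norm)
      have "integrable \<eta> (\<lambda>y. indicator (space \<eta> - U (Suc k)) y *\<^sub>R cmod (sol_J p d 1 y))"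
        using U(3) by (intro integrable_mult_indicator integrable_norm J_int) auto
      then show "integrable \<eta> (\<lambda>y. indicator (- U (Suc k)) y * cmod (sol_J p d 1 y))"
        by (rule Bochner_Integration.integrable_cong[THEN iffD1, rotated 2]) (auto simp: indicator_def)
    qed (auto simp: A_def indicator_def)
    also have "\<dots> \<le> (1/4) ^ k" by (rule U(6)[OF that])
    finally show ?thesis .
  qed
  have "summable (\<lambda>k. \<integral>y. cmod (y d - 1) \<partial>N k)" for d
  proof -
    \<comment> \<open>With r = 2^k in \<open>mean_distance_le\<close> the bound is 6 * 2^k * 4^-k +
      2^-k = 7 * 2^-k; this is the reason for the rate 4^-k in the exhaustion.\<close>
    have "norm (\<integral>y. cmod (y d - 1) \<partial>N (Suc k)) \<le> 7 * (1/2) ^ k" if "k \<ge> d" for k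
    proof -
      have "cmod (z (Suc k) d 1) \<le> 1" using z_le[OF that] power_le_one[of "1/4::real" k] by simp
      then have "(\<integral>y. cmod (y d - 1) \<partial>N (Suc k)) \<le> 2 ^ k * (6 * cmod (z (Suc k) d 1)) + 1 / 2 ^ k"
        by (intro mean_distance_le[OF N(1,2) _ N(3)]) auto
      also have "\<dots> \<le> 2 ^ k * (6 * (1/4) ^ k) + 1 / 2 ^ k"
        using z_le[OF that] by (intro add_right_mono mult_left_mono) auto
      also have "\<dots> = 6 * (2 * (1/4)) ^ k + (1/2) ^ k"
        unfolding power_mult_distrib by (simp add: power_one_over)
      finally show ?thesis by simp
    qed
    moreover have "summable (\<lambda>k. 7 * (1/2) ^ k :: real)"
      by (intro summable_mult summable_geometric) simp
    ultimately have "summable (\<lambda>k. \<integral>y. cmod (y d - 1) \<partial>N (Suc k))"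
      by (rule summable_comparison_test'[rotated])
    then show ?thesis by (simp only: summable_Suc_iff[of "\<lambda>k. \<integral>y. cmod (y d - 1) \<partial>N k"])
  qed
  from infinite_product_law[OF N(1,2) this] obtain \<mu> where \<mu>: "prob_space \<mu>" "sets \<mu> = sets (sol_borel p)"
    "\<And>d l. (\<lambda>n. \<Prod>k<n. \<integral>y. sol_char d l y \<partial>N k) \<longlonglongrightarrow> (\<integral>y. sol_char d l y \<partial>\<mu>)" by blast
  have "(\<integral>y. sol_char d l y \<partial>\<mu>) = exp (\<integral>y. sol_J p d l y \<partial>\<eta>)" for d l
  proof (rule LIMSEQ_unique[OF \<mu>(3)])
    \<comment> \<open>The shells below n are disjoint with union \<open>U n\<close>, so the
      exponents of the pieces telescope.\<close>
    have partial: "(\<Sum>k<n. z k d l) = (\<integral>y. indicator (U n) y *\<^sub>R sol_J p d l y \<partial>\<eta>)" for n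
    proof (induction n)
      case (Suc n)
      have ind: "indicat_real (U (Suc n)) y = indicator (U n) y + indicator (A n) y" for y
        using incseq_SucD[OF U(1), of n] by (auto simp: A_def indicator_def)
      show ?case
        unfolding ind scaleR_add_left using Suc AJ[OF U(3)] AJ[OF A(1)] by (simp add: z_def)
    qed (simp add: U(2))
    have "(\<lambda>n. \<integral>y. indicator (U n) y *\<^sub>R sol_J p d l y \<partial>\<eta>) \<longlonglongrightarrow> (\<integral>y. sol_J p d l y \<partial>\<eta>)"
    proof (rule integral_dominated_convergence[where w="\<lambda>y. cmod (sol_J p d l y)"])
      show "AE y in \<eta>. (\<lambda>n. indicator (U n) y *\<^sub>R sol_J p d l y) \<longlonglongrightarrow> sol_J p d l y"
      proof (rule AE_I2)
        fix y assume "y \<in> space \<eta>"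
        then have y: "y \<in> solenoid p" by (simp add: sp)
        show "(\<lambda>n. indicator (U n) y *\<^sub>R sol_J p d l y) \<longlonglongrightarrow> sol_J p d l y"
        proof (cases "y = sol_one")
          case True
          then have "sol_J p d l y = 0" by (simp add: sol_J_def sol_H_def sol_char_def sol_one_def)
          then show ?thesis by simp
        next
          case False
          then obtain n where n: "y \<in> U n" using U(5) y by blast
          have "indicator (U k) y *\<^sub>R sol_J p d l y = sol_J p d l y" if "k \<ge> n" for k
            using n incseqD[OF U(1) that] by auto
          then have "eventually (\<lambda>k. indicator (U k) y *\<^sub>R sol_J p d l y = sol_J p d l y) sequentially"
            unfolding eventually_sequentially by blast
          then show ?thesis by (rule tendsto_eventually)
        qed
      qed
      show "(\<lambda>y. indicator (U n) y *\<^sub>R sol_J p d l y) \<in> borel_measurable \<eta>" for n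
        using AJ[OF U(3)] by (rule borel_measurable_integrable)
      show "integrable \<eta> (\<lambda>y. cmod (sol_J p d l y))" using J_int by (rule integrable_norm)
    qed (auto simp: indicator_def J_int intro: borel_measurable_integrable)
    from tendsto_exp[OF this]
    show "(\<lambda>n. \<Prod>k<n. \<integral>y. sol_char d l y \<partial>N k) \<longlonglongrightarrow> exp (\<integral>y. sol_J p d l y \<partial>\<eta>)"
      by (simp add: N(3) partial[symmetric] exp_sum)
  qed
  then show ?thesis using \<mu>(1,2) by blast
qed

lemma gen_poisson_sol_facts:
  assumes "0 < p" "levy_measure p \<eta>"
  shows prob_space_gen_poisson_sol: "prob_space (gen_poisson_sol p \<eta>)"
    and sets_gen_poisson_sol: "sets (gen_poisson_sol p \<eta>) = sets (sol_borel p)"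
    and integral_sol_char_gen_poisson_sol:
      "(\<integral>y. sol_char d l y \<partial>gen_poisson_sol p \<eta>) = exp (\<integral>y. sol_J p d l y \<partial>\<eta>)"
proof -
  obtain \<mu> where \<mu>: "prob_space \<mu>" "sets \<mu> = sets (sol_borel p)"
    "\<And>d l. (\<integral>y. sol_char d l y \<partial>\<mu>) = exp (\<integral>y. sol_J p d l y \<partial>\<eta>)"
    using gen_poisson_exists[OF assms] by blast
  have "(\<integral>y. sol_J p d l y \<partial>\<eta>) = (\<integral>y. (sol_char d l y - 1 - \<i> * of_real (g_sol p y d l)) \<partial>\<eta>)" for d l
    by (intro Bochner_Integration.integral_cong refl)
      (simp add: sol_J_def g_sol_def h_fun_solenoid space_eq_solenoid[OF levy_measure_sets[OF assms(2)]])
  then have "gen_poisson_sol p \<eta> = \<mu>"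
    unfolding gen_poisson_sol_def by (intro sol_measure_of \<mu>(1,2)) (simp add: \<mu>(3))
  then show "prob_space (gen_poisson_sol p \<eta>)" "sets (gen_poisson_sol p \<eta>) = sets (sol_borel p)"
    "(\<integral>y. sol_char d l y \<partial>gen_poisson_sol p \<eta>) = exp (\<integral>y. sol_J p d l y \<partial>\<eta>)"
    using \<mu> by auto
qed

section \<open>Cutoffs and centred remainders\<close>

text \<open>Replace each factor by exp(\<psi> - 1), the transform of its accompanying Poisson law.
  Both have modulus at most 1, the latter because Re \<psi> <= 1, so the products differ by at most
  the sum of the differences of factors. Each of these is quadratic in \<psi> - 1, hence at most a
  small constant times |\<psi> - 1|.\<close>

lemma tendsto_prod_exp:
  fixes \<psi> :: "nat \<Rightarrow> nat \<Rightarrow> complex"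
  assumes le1: "\<And>n k. k \<in> I n \<Longrightarrow> cmod (\<psi> n k) \<le> 1"
    and bd: "eventually (\<lambda>n. (\<Sum>k\<in>I n. cmod (\<psi> n k - 1)) \<le> B) sequentially"
    and small: "\<And>e. 0 < e \<Longrightarrow> eventually (\<lambda>n. \<forall>k\<in>I n. cmod (\<psi> n k - 1) \<le> e) sequentially"
    and lim: "(\<lambda>n. \<Sum>k\<in>I n. (\<psi> n k - 1)) \<longlonglongrightarrow> L"
    and fin: "\<And>n. finite (I n)"
  shows "(\<lambda>n. \<Prod>k\<in>I n. \<psi> n k) \<longlonglongrightarrow> exp L"
proof -
  have "(\<lambda>n. (\<Prod>k\<in>I n. \<psi> n k) - exp (\<Sum>k\<in>I n. (\<psi> n k - 1))) \<longlonglongrightarrow> 0"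
  proof (rule tendstoI)
    fix e :: real assume e: "0 < e"
    \<comment> \<open>Adding 1 avoids division by zero; c <= e/(6q) makes the total error 3 c |B| at
      most e/2.\<close>
    define q where "q = \<bar>B\<bar> + 1"
    have q: "0 < q" "\<bar>B\<bar> \<le> q" by (simp_all add: q_def)
    define c where "c = min 1 (e / (6 * q))"
    have c: "0 < c" "c \<le> 1" "c \<le> e / (6 * q)" using e q(1) by (auto simp: c_def)
    have cB: "3 * c * \<bar>B\<bar> < e"
    proof -
      have "3 * c * \<bar>B\<bar> \<le> 3 * (e / (6 * q)) * q"
        using e c q by (intro mult_mono) auto
      also have "\<dots> < e" using e q(1) by simp
      finally show ?thesis .
    qed
    from small[OF c(1)] bd
    show "eventually (\<lambda>n. dist ((\<Prod>k\<in>I n. \<psi> n k) - exp (\<Sum>k\<in>I n. (\<psi> n k - 1))) 0 < e) sequentially"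
    proof eventually_elim
      case (elim n)
      have t: "cmod (\<psi> n k - exp (\<psi> n k - 1)) \<le> 3 * c * cmod (\<psi> n k - 1)" if k: "k \<in> I n" for k
      proof -
        define z where "z = \<psi> n k - 1"
        have z: "cmod z \<le> c" using elim(1) k by (simp add: z_def)
        have "cmod (exp z - (1 + z)) \<le> exp (cmod z) * (cmod z * cmod z)"
          using Taylor_exp_field[of z 1] by (simp add: power2_eq_square)
        also have "\<dots> \<le> 3 * (c * cmod z)"
          using z c exp_le by (intro mult_mono) (auto intro: order_trans[of _ "exp 1"])
        finally show ?thesis by (simp add: z_def norm_minus_commute mult.assoc)
      qed
      have "cmod ((\<Prod>k\<in>I n. \<psi> n k) - (\<Prod>k\<in>I n. exp (\<psi> n k - 1)))
          \<le> (\<Sum>k\<in>I n. cmod (\<psi> n k - exp (\<psi> n k - 1)))"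
      proof (rule norm_prod_diff)
        fix k assume k: "k \<in> I n"
        have "Re (\<psi> n k) \<le> 1" using complex_Re_le_cmod[of "\<psi> n k"] le1[OF k] by linarith
        then show "cmod (exp (\<psi> n k - 1)) \<le> 1" by simp
      qed (rule le1)
      also have "\<dots> \<le> (\<Sum>k\<in>I n. 3 * c * cmod (\<psi> n k - 1))" by (intro sum_mono t)
      also have "\<dots> \<le> 3 * c * \<bar>B\<bar>"
        using elim(2) c unfolding sum_distrib_left[symmetric] by (intro mult_left_mono) auto
      finally show ?case using cB by (simp add: exp_sum[OF fin])
    qed
  qed
  from tendsto_add[OF this tendsto_exp[OF lim]] show ?thesis by simp
qed

lemma sol_char_bound:
  assumes "0 < p"
  shows "\<exists>C\<ge>0. \<forall>y\<in>solenoid p. cmod (sol_char d l y - 1) \<le> C * cmod (y d - 1)"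
proof -
  define \<theta> where "\<theta> = real_of_int l / real p ^ d"
  obtain C1 where C1: "C1 \<ge> 0" "\<And>y. y\<in>solenoid p \<Longrightarrow> cmod (sol_J p d l y) \<le> C1 * (cmod (y d - 1))\<^sup>2"
    using sol_J_bound[OF assms] by blast
  obtain C2 where C2: "C2 \<ge> 0" "\<And>y. y\<in>solenoid p \<Longrightarrow> \<bar>sol_H y\<bar> \<le> C2 * cmod (y d - 1)"
    using sol_H_bound[OF assms] by blast
  have "cmod (sol_char d l y - 1) \<le> (C1 * 2 + \<bar>\<theta>\<bar> * C2) * cmod (y d - 1)" if y: "y \<in> solenoid p" for y
  proof -
    have u: "cmod (y d - 1) \<le> 2" using norm_triangle_ineq4[of "y d" 1] solenoid_norm[OF y, of d] by simp
    have "sol_char d l y - 1 = sol_J p d l y + \<i> * of_real (\<theta> * sol_H y)"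
      by (simp add: sol_J_def \<theta>_def)
    then have "cmod (sol_char d l y - 1) \<le> cmod (sol_J p d l y) + \<bar>\<theta>\<bar> * \<bar>sol_H y\<bar>"
      using norm_triangle_ineq[of "sol_J p d l y" "\<i> * of_real (\<theta> * sol_H y)"]
      by (simp add: norm_mult abs_mult)
    also have "\<dots> \<le> C1 * (2 * cmod (y d - 1)) + \<bar>\<theta>\<bar> * (C2 * cmod (y d - 1))"
    proof (intro add_mono mult_left_mono C2(2) y)
      have "(cmod (y d - 1))\<^sup>2 \<le> 2 * cmod (y d - 1)"
        using mult_right_mono[OF u, of "cmod (y d - 1)"] by (simp add: power2_eq_square)
      then show "cmod (sol_J p d l y) \<le> C1 * (2 * cmod (y d - 1))"
        using C1(2)[OF y] mult_left_mono[OF _ C1(1)] order_trans by blast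
    qed auto
    finally show ?thesis by (simp add: algebra_simps)
  qed
  then show ?thesis using C1(1) C2(1) by (intro exI[of _ "C1 * 2 + \<bar>\<theta>\<bar> * C2"]) auto
qed

text \<open>A continuous ramp in the distance, rising from 0 at \<delta> to 1 at 2 \<delta>.
  Multiplied by it, any continuous function becomes admissible in condition (iv).\<close>

definition sol_cutoff :: "nat \<Rightarrow> real \<Rightarrow> (nat \<Rightarrow> complex) \<Rightarrow> real" where
  "sol_cutoff d \<delta> y = min 1 (max 0 (cmod (y d - 1) / \<delta> - 1))"

lemma sol_cutoff_nonneg: "0 \<le> sol_cutoff d \<delta> y" and sol_cutoff_le_1: "sol_cutoff d \<delta> y \<le> 1"
  by (auto simp: sol_cutoff_def)

lemma sol_cutoff_eq_0: "0 < \<delta> \<Longrightarrow> cmod (y d - 1) < \<delta> \<Longrightarrow> sol_cutoff d \<delta> y = 0"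
  by (simp add: sol_cutoff_def)

lemma sol_cutoff_eq_1: "0 < \<delta> \<Longrightarrow> 2 * \<delta> \<le> cmod (y d - 1) \<Longrightarrow> sol_cutoff d \<delta> y = 1"
  by (simp add: sol_cutoff_def field_simps)

lemma sol_cutoff_le: "0 < \<delta> \<Longrightarrow> sol_cutoff d \<delta> y \<le> (1 / \<delta>\<^sup>2) * (cmod (y d - 1))\<^sup>2"
proof -
  assume \<delta>: "0 < \<delta>"
  show ?thesis
  proof (cases "cmod (y d - 1) < \<delta>")
    case False
    then have "1 \<le> (1 / \<delta>\<^sup>2) * (cmod (y d - 1))\<^sup>2" using \<delta> by (simp add: field_simps)
    then show ?thesis using sol_cutoff_le_1[of d \<delta> y] by linarith
  qed (simp add: sol_cutoff_eq_0[OF \<delta>])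
qed

lemma continuous_on_sol_cutoff: "continuous_on S (sol_cutoff d \<delta>)"
  unfolding sol_cutoff_def divide_inverse by (intro continuous_intros)

lemma borel_nbhd_ball:
  assumes "0 < \<delta>"
  shows "borel_nbhd p {y \<in> solenoid p. cmod (y d - 1) < \<delta>}"
proof -
  have o: "openin (top_of_set (solenoid p)) {y \<in> solenoid p. cmod (y d - 1) < \<delta>}"
  proof -
    have "open {y :: nat \<Rightarrow> complex. cmod (y d - 1) < \<delta>}"
      by (intro open_Collect_less continuous_intros)
    then show ?thesis by (auto simp: openin_open)
  qed
  have "{y \<in> space (sol_borel p). cmod (y d - 1) < \<delta>} \<in> sets (sol_borel p)" by measurable
  then show ?thesis unfolding borel_nbhd_def using o assms sol_one_in[of p] by (auto simp: sol_one_def intro!: exI[of _ "{y \<in> solenoid p. cmod (y d - 1) < \<delta>}"])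
qed

lemma C0_sol_cutoff_times:
  assumes "0 < \<delta>" "continuous_on (solenoid p) f"
  shows "(\<lambda>y. sol_cutoff d \<delta> y * f y) \<in> C0_sol p"
proof -
  have c: "continuous_on (solenoid p) (\<lambda>y. sol_cutoff d \<delta> y * f y)"
    by (intro continuous_intros continuous_on_sol_cutoff assms(2))
  then have "bounded ((\<lambda>y. sol_cutoff d \<delta> y * f y) ` solenoid p)"
    by (intro compact_imp_bounded compact_continuous_image compact_solenoid)
  then show ?thesis
    unfolding C0_sol_def using c borel_nbhd_ball[OF assms(1), of p d] sol_cutoff_eq_0[OF assms(1)] by fastforce
qed

text \<open>The second-order remainder of the character after centring at \<open>m\<close>.\<close>

definition sol_R :: "nat \<Rightarrow> nat \<Rightarrow> int \<Rightarrow> real \<Rightarrow> (nat \<Rightarrow> complex) \<Rightarrow> complex" where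
  "sol_R p d l m y = sol_char d l y * iexp (- (of_int l / real p ^ d * m)) - 1
    - \<i> * of_real (of_int l / real p ^ d * (sol_H y - m))
    + of_real ((of_int l / real p ^ d * (sol_H y - m))\<^sup>2 / 2)"

lemma continuous_on_sol_R: "continuous_on (solenoid p) (sol_R p d l m)"
  unfolding sol_R_def by (intro continuous_intros continuous_on_sol_H continuous_on_sol_char) simp

text \<open>Here the centred character is exactly exp(i \<theta> (H - m)), so the cubic Taylor bound
  applies. One factor |H - m| is estimated by a small quantity, and the square is kept so that
  expectations produce the variance.\<close>

lemma sol_R_local:
  assumes "0 < p" and y: "y \<in> solenoid p" and close: "cmod (y d - 1) < 1 / (4 * real p ^ d)"
  shows "cmod (sol_R p d l m y)
    \<le> \<bar>of_int l / real p ^ d\<bar> ^ 3 * (2 * real p ^ d * cmod (y d - 1) + \<bar>m\<bar>) * (sol_H y - m)\<^sup>2"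
proof -
  define \<theta> where "\<theta> = real_of_int l / real p ^ d"
  have cube: "\<bar>x\<bar> ^ 3 = \<bar>x\<bar> * x\<^sup>2" for x :: real
    by (simp only: power3_eq_cube power2_eq_square mult.assoc abs_mult_self_eq)
  have "sol_char d l y * iexp (- (\<theta> * m)) = iexp (\<theta> * (sol_H y - m))"
    unfolding sol_local(1)[OF assms] \<theta>_def[symmetric] by (simp add: exp_add[symmetric] algebra_simps)
  then have "cmod (sol_R p d l m y) \<le> \<bar>\<theta> * (sol_H y - m)\<bar> ^ 3 / 6"
    unfolding sol_R_def \<theta>_def[symmetric] using iexp_cubic[of "\<theta> * (sol_H y - m)"] by simp
  also have "\<dots> \<le> \<bar>\<theta> * (sol_H y - m)\<bar> ^ 3" by simp
  also have "\<dots> = \<bar>\<theta>\<bar> ^ 3 * (\<bar>sol_H y - m\<bar> * (sol_H y - m)\<^sup>2)"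
    by (simp only: abs_mult power_mult_distrib cube)
  also have "\<dots> \<le> \<bar>\<theta>\<bar> ^ 3 * ((2 * real p ^ d * cmod (y d - 1) + \<bar>m\<bar>) * (sol_H y - m)\<^sup>2)"
    using sol_local(2)[OF assms] by (intro mult_left_mono mult_right_mono) auto
  finally show ?thesis by (simp add: \<theta>_def mult.assoc)
qed

text \<open>Valid on the whole solenoid: centring alters the remainder by O(|m|). The phase factor
  and the linear term contribute |\<theta>| |m| each, the quadratic term at most 3 \<theta>^2
  |m|.\<close>

lemma sol_R_sol_F:
  assumes y: "y \<in> solenoid p" and m: "\<bar>m\<bar> \<le> 1"
  shows "cmod (sol_R p d l m y - sol_F p d l y)
    \<le> (2 * \<bar>of_int l / real p ^ d\<bar> + 3 * (of_int l / real p ^ d)\<^sup>2) * \<bar>m\<bar>"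
proof -
  define \<theta> where "\<theta> = real_of_int l / real p ^ d"
  have "sol_R p d l m y - sol_F p d l y = sol_char d l y * (iexp (- (\<theta> * m)) - 1)
      + (\<i> * of_real (\<theta> * m) + of_real (\<theta>\<^sup>2 / 2 * (m * (m - 2 * sol_H y))))"
    unfolding sol_R_def sol_F_def sol_J_def \<theta>_def[symmetric]
    by (simp add: field_simps power2_eq_square)
  then have "cmod (sol_R p d l m y - sol_F p d l y) \<le> cmod (sol_char d l y * (iexp (- (\<theta> * m)) - 1))
      + (cmod (\<i> * of_real (\<theta> * m)) + cmod (of_real (\<theta>\<^sup>2 / 2 * (m * (m - 2 * sol_H y)))))"
    by (metis norm_triangle_ineq norm_triangle_mono order_refl)
  also have "cmod (sol_char d l y * (iexp (- (\<theta> * m)) - 1)) \<le> \<bar>\<theta>\<bar> * \<bar>m\<bar>"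
    using iexp_approx1[of "- (\<theta> * m)" 0] by (simp add: norm_mult norm_sol_char[OF y] abs_mult)
  also have "cmod (\<i> * of_real (\<theta> * m)) = \<bar>\<theta>\<bar> * \<bar>m\<bar>" by (simp add: norm_mult abs_mult)
  also have "cmod (of_real (\<theta>\<^sup>2 / 2 * (m * (m - 2 * sol_H y)))) = \<theta>\<^sup>2 / 2 * (\<bar>m\<bar> * \<bar>m - 2 * sol_H y\<bar>)"
    unfolding norm_of_real by (simp add: abs_mult)
  \<comment> \<open>|m - 2H| <= 1 + 2 * 2, rounded up to 6.\<close>
  also have "\<dots> \<le> \<theta>\<^sup>2 / 2 * (\<bar>m\<bar> * 6)"
    using abs_sol_H[OF y] m by (intro mult_left_mono) auto
  finally show ?thesis by (simp add: \<theta>_def[symmetric] algebra_simps)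
qed

section \<open>Rowwise independent arrays\<close>

text \<open>The hypotheses in working form: \<open>sol_H\<close> stands for h(arg y_0), and
  infinitesimality is expressed by the distances |y_d - 1|. All rows, row 0 included, are regular;
  the theorem supplies this by shifting the row index. The condition on the means is added in
  \<open>tendsto_char_of_row_product\<close>.\<close>

locale sol_array = prob_space M for M :: "'w measure" +
  fixes p :: nat and K :: "nat \<Rightarrow> nat" and X :: "nat \<Rightarrow> nat \<Rightarrow> 'w \<Rightarrow> nat \<Rightarrow> complex"
    and b :: real and \<eta> :: "(nat \<Rightarrow> complex) measure"
  assumes p_pos: "0 < p"
    and K_pos: "\<And>n. 1 \<le> K n"
    and indep: "\<And>n. indep_vars (\<lambda>k. sol_borel p) (X n) {1..K n}"
    and levy: "levy_measure p \<eta>"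
    and inf: "\<And>d \<delta>. 0 < \<delta> \<Longrightarrow>
      (\<lambda>n. MAX k\<in>{1..K n}. prob {\<omega> \<in> space M. \<delta> \<le> cmod (X n k \<omega> d - 1)}) \<longlonglongrightarrow> 0"
    and var: "(\<lambda>n. \<Sum>k=1..K n. variance (\<lambda>\<omega>. sol_H (X n k \<omega>))) \<longlonglongrightarrow> b + (\<integral>y. (sol_H y)\<^sup>2 \<partial>\<eta>)"
    and C0: "\<And>f. f \<in> C0_sol p \<Longrightarrow>
      (\<lambda>n. \<Sum>k=1..K n. expectation (\<lambda>\<omega>. f (X n k \<omega>))) \<longlonglongrightarrow> (\<integral>y. f y \<partial>\<eta>)"
begin

section \<open>Integrability and smallness of moments along the rows\<close>

lemma X_meas: "k \<in> {1..K n} \<Longrightarrow> X n k \<in> measurable M (sol_borel p)"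
  using indep unfolding indep_vars_def by blast

lemma X_in: "k \<in> {1..K n} \<Longrightarrow> \<omega> \<in> space M \<Longrightarrow> X n k \<omega> \<in> solenoid p"
  using measurable_space[OF X_meas] by simp

lemma integrable_X:
  fixes f :: "(nat \<Rightarrow> complex) \<Rightarrow> 'b::{banach, second_countable_topology}"
  assumes "k \<in> {1..K n}" "continuous_on (solenoid p) f"
  shows "integrable M (\<lambda>\<omega>. f (X n k \<omega>))"
proof -
  obtain B where B: "\<forall>y\<in>solenoid p. norm (f y) \<le> B" using bounded_sol_continuous[OF assms(2)] ..
  show ?thesis
    using B X_in[OF assms(1)]
    by (intro integrable_const_bound[of _ B] AE_I2
        measurable_compose[OF X_meas[OF assms(1)] borel_measurable_sol_continuous[OF assms(2)]]) auto
qed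

definition row_mean :: "nat \<Rightarrow> nat \<Rightarrow> real" where
  "row_mean n k = expectation (\<lambda>\<omega>. sol_H (X n k \<omega>))"

definition row_var :: "nat \<Rightarrow> nat \<Rightarrow> real" where
  "row_var n k = variance (\<lambda>\<omega>. sol_H (X n k \<omega>))"

lemma row_var_eq: "row_var n k = expectation (\<lambda>\<omega>. (sol_H (X n k \<omega>) - row_mean n k)\<^sup>2)"
  by (simp add: row_var_def row_mean_def)

lemma row_var_nonneg: "0 \<le> row_var n k"
  unfolding row_var_def by (rule variance_positive)

text \<open>Smallness in probability becomes smallness in mean because the distance is at most 2: it
  is below e/2 off the bad event, whose probability is eventually at most e/4.\<close>

lemma mean_distance_small:
  assumes "0 < e"
  shows "eventually (\<lambda>n. \<forall>k\<in>{1..K n}. expectation (\<lambda>\<omega>. cmod (X n k \<omega> d - 1)) \<le> e) sequentially"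
proof -
  define B where "B n k = {\<omega> \<in> space M. e / 2 \<le> cmod (X n k \<omega> d - 1)}" for n k
  have "eventually (\<lambda>n. (MAX k\<in>{1..K n}. prob (B n k)) < e / 4) sequentially"
    using inf[of "e/2" d] assms unfolding B_def by (intro order_tendstoD(2)[of _ 0]) auto
  then show ?thesis
  proof eventually_elim
    case (elim n)
    show ?case
    proof
      fix k assume k: "k \<in> {1..K n}"
      have meas [measurable]: "(\<lambda>\<omega>. X n k \<omega> d) \<in> borel_measurable M"
        by (rule measurable_compose[OF X_meas[OF k] measurable_sol_coord])
      have B: "B n k \<in> sets M" unfolding B_def by measurable
      have "prob (B n k) \<le> (MAX k\<in>{1..K n}. prob (B n k))" using k by (intro Max_ge) auto
      then have pr: "prob (B n k) \<le> e / 4" using elim by linarith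
      have iB: "integrable M (indicat_real (B n k))"
        using B by (intro integrable_real_indicator) (auto simp: less_top[symmetric])
      have "expectation (\<lambda>\<omega>. cmod (X n k \<omega> d - 1)) \<le> expectation (\<lambda>\<omega>. e / 2 + 2 * indicator (B n k) \<omega>)"
      proof (rule integral_mono)
        show "integrable M (\<lambda>\<omega>. cmod (X n k \<omega> d - 1))"
          by (rule integrable_X[OF k, of "\<lambda>y. cmod (y d - 1)"]) (intro continuous_intros)
        show "integrable M (\<lambda>\<omega>. e / 2 + 2 * indicator (B n k) \<omega>)"
          using iB by simp
        fix \<omega> assume \<omega>: "\<omega> \<in> space M"
        have "cmod (X n k \<omega> d - 1) \<le> 2"
          using norm_triangle_ineq4[of "X n k \<omega> d" 1] solenoid_norm[OF X_in[OF k \<omega>], of d] by simp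
        then show "cmod (X n k \<omega> d - 1) \<le> e / 2 + 2 * indicator (B n k) \<omega>"
          using \<omega> assms by (auto simp: indicator_def B_def)
      qed
      also have "\<dots> = e / 2 + 2 * prob (B n k)" using B iB by (simp add: prob_space)
      finally show "expectation (\<lambda>\<omega>. cmod (X n k \<omega> d - 1)) \<le> e" using pr by simp
    qed
  qed
qed

lemma expectation_small:
  fixes f :: "(nat \<Rightarrow> complex) \<Rightarrow> 'b::{banach, second_countable_topology}"
  assumes "continuous_on (solenoid p) f" "0 \<le> C" "\<And>y. y \<in> solenoid p \<Longrightarrow> norm (f y) \<le> C * cmod (y d - 1)" "0 < e"
  shows "eventually (\<lambda>n. \<forall>k\<in>{1..K n}. norm (expectation (\<lambda>\<omega>. f (X n k \<omega>))) \<le> e) sequentially"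
proof -
  have "0 < e / (C + 1)" using assms by simp
  from mean_distance_small[OF this, of d] show ?thesis
  proof eventually_elim
    case (elim n)
    show ?case
    proof
      fix k assume k: "k \<in> {1..K n}"
      have "norm (expectation (\<lambda>\<omega>. f (X n k \<omega>))) \<le> expectation (\<lambda>\<omega>. norm (f (X n k \<omega>)))"
        by (rule integral_norm_bound)
      also have "\<dots> \<le> expectation (\<lambda>\<omega>. C * cmod (X n k \<omega> d - 1))"
      proof (rule integral_mono)
        show "integrable M (\<lambda>\<omega>. norm (f (X n k \<omega>)))" by (intro integrable_norm integrable_X k assms(1))
        show "integrable M (\<lambda>\<omega>. C * cmod (X n k \<omega> d - 1))"
          by (rule integrable_X[OF k, of "\<lambda>y. C * cmod (y d - 1)"]) (intro continuous_intros)
      qed (intro assms(3) X_in[OF k])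
      also have "\<dots> = C * expectation (\<lambda>\<omega>. cmod (X n k \<omega> d - 1))" by simp
      also have "\<dots> \<le> C * (e / (C + 1))" using elim k assms(2) by (intro mult_left_mono) auto
      also have "\<dots> \<le> e" using assms(2,4) by (simp add: field_simps)
      finally show "norm (expectation (\<lambda>\<omega>. f (X n k \<omega>))) \<le> e" .
    qed
  qed
qed

lemma row_mean_small:
  assumes "0 < e"
  shows "eventually (\<lambda>n. \<forall>k\<in>{1..K n}. \<bar>row_mean n k\<bar> \<le> e) sequentially"
proof -
  obtain C where "C \<ge> 0" "\<forall>y\<in>solenoid p. \<bar>sol_H y\<bar> \<le> C * cmod (y 0 - 1)"
    using sol_H_bound[OF p_pos] by blast
  then show ?thesis
    using expectation_small[OF continuous_on_sol_H, of C 0 e] assms by (simp add: row_mean_def)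
qed

text \<open>The two regimes meet here. Near the identity the remainder is a small multiple of the
  squared deviation, which gives the variance term; where the cutoff is positive
  \<open>sol_R\<close> is replaced by \<open>sol_F\<close>, at a cost proportional to \<kappa> times
  the cutoff.\<close>

lemma expectation_sol_R_approx:
  fixes d :: nat and l :: int
  assumes k: "k \<in> {1..K n}" and \<delta>: "0 < \<delta>" "2 * \<delta> \<le> 1 / (4 * real p ^ d)" and m: "\<bar>row_mean n k\<bar> \<le> \<kappa>" "\<kappa> \<le> 1"
  defines "\<theta> \<equiv> of_int l / real p ^ d"
  shows "cmod (expectation (\<lambda>\<omega>. sol_R p d l (row_mean n k) (X n k \<omega>))
      - expectation (\<lambda>\<omega>. sol_cutoff d \<delta> (X n k \<omega>) *\<^sub>R sol_F p d l (X n k \<omega>)))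
    \<le> \<bar>\<theta>\<bar> ^ 3 * (4 * real p ^ d * \<delta> + \<kappa>) * row_var n k
      + (2 * \<bar>\<theta>\<bar> + 3 * \<theta>\<^sup>2) * \<kappa> * expectation (\<lambda>\<omega>. sol_cutoff d \<delta> (X n k \<omega>))"
proof -
  let ?a = "\<bar>\<theta>\<bar> ^ 3 * (4 * real p ^ d * \<delta> + \<kappa>)" and ?c = "(2 * \<bar>\<theta>\<bar> + 3 * \<theta>\<^sup>2) * \<kappa>"
  let ?D = "\<lambda>y. sol_R p d l (row_mean n k) y - sol_cutoff d \<delta> y *\<^sub>R sol_F p d l y"
  have cont: "continuous_on (solenoid p) (sol_R p d l (row_mean n k))"
    "continuous_on (solenoid p) (\<lambda>y. sol_cutoff d \<delta> y *\<^sub>R sol_F p d l y)"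
    by (intro continuous_intros continuous_on_sol_R continuous_on_sol_F continuous_on_sol_cutoff)+
  have pw: "cmod (?D y) \<le> ?a * (sol_H y - row_mean n k)\<^sup>2 + ?c * sol_cutoff d \<delta> y" if y: "y \<in> solenoid p" for y
  proof -
    define \<xi> where "\<xi> = sol_cutoff d \<delta> y"
    have \<xi>: "0 \<le> \<xi>" "\<xi> \<le> 1" by (auto simp: \<xi>_def sol_cutoff_nonneg sol_cutoff_le_1)
    \<comment> \<open>The weight 1 - \<xi> vanishes beyond distance 2 \<delta>, so the first summand
      is seen only where \<open>sol_R_local\<close> applies.\<close>
    have "?D y = (1 - \<xi>) *\<^sub>R sol_R p d l (row_mean n k) y + \<xi> *\<^sub>R (sol_R p d l (row_mean n k) y - sol_F p d l y)"
      by (simp add: \<xi>_def algebra_simps)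
    then have "cmod (?D y) \<le> (1 - \<xi>) * cmod (sol_R p d l (row_mean n k) y) + \<xi> * cmod (sol_R p d l (row_mean n k) y - sol_F p d l y)"
      using norm_triangle_ineq[of "(1 - \<xi>) *\<^sub>R sol_R p d l (row_mean n k) y" "\<xi> *\<^sub>R (sol_R p d l (row_mean n k) y - sol_F p d l y)"] \<xi>
      by simp
    also have "(1 - \<xi>) * cmod (sol_R p d l (row_mean n k) y) \<le> ?a * (sol_H y - row_mean n k)\<^sup>2"
    proof (cases "2 * \<delta> \<le> cmod (y d - 1)")
      case True
      then have "\<xi> = 1" using sol_cutoff_eq_1[of \<delta> y d] \<delta> by (simp add: \<xi>_def)
      then show ?thesis using \<delta>(1) m by auto
    next
      case False
      have "(1 - \<xi>) * cmod (sol_R p d l (row_mean n k) y) \<le> cmod (sol_R p d l (row_mean n k) y)"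
        using mult_right_mono[of "1 - \<xi>" 1 "cmod (sol_R p d l (row_mean n k) y)"] \<xi> by simp
      also have "\<dots> \<le> \<bar>\<theta>\<bar> ^ 3 * (2 * real p ^ d * cmod (y d - 1) + \<bar>row_mean n k\<bar>) * (sol_H y - row_mean n k)\<^sup>2"
        unfolding \<theta>_def using False \<delta>(2) by (intro sol_R_local[OF p_pos y]) simp
      also have "\<dots> \<le> ?a * (sol_H y - row_mean n k)\<^sup>2"
      proof (intro mult_right_mono mult_left_mono add_mono m)
        have "2 * real p ^ d * cmod (y d - 1) \<le> 2 * real p ^ d * (2 * \<delta>)"
          using False by (intro mult_left_mono) auto
        then show "2 * real p ^ d * cmod (y d - 1) \<le> 4 * real p ^ d * \<delta>" by simp
      qed auto
      finally show ?thesis .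
    qed
    also have "\<xi> * cmod (sol_R p d l (row_mean n k) y - sol_F p d l y) \<le> \<xi> * ?c"
    proof (rule mult_left_mono[OF _ \<xi>(1)])
      have "cmod (sol_R p d l (row_mean n k) y - sol_F p d l y) \<le> (2 * \<bar>\<theta>\<bar> + 3 * \<theta>\<^sup>2) * \<bar>row_mean n k\<bar>"
        unfolding \<theta>_def using m by (intro sol_R_sol_F y) simp
      also have "\<dots> \<le> ?c" using m by (intro mult_left_mono) auto
      finally show "cmod (sol_R p d l (row_mean n k) y - sol_F p d l y) \<le> ?c" .
    qed
    finally show ?thesis by (simp add: \<xi>_def mult.commute)
  qed
  have "cmod (expectation (\<lambda>\<omega>. ?D (X n k \<omega>))) \<le> expectation (\<lambda>\<omega>. cmod (?D (X n k \<omega>)))"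
    by (rule integral_norm_bound)
  also have "\<dots> \<le> expectation (\<lambda>\<omega>. ?a * (sol_H (X n k \<omega>) - row_mean n k)\<^sup>2 + ?c * sol_cutoff d \<delta> (X n k \<omega>))"
  proof (rule integral_mono)
    show "integrable M (\<lambda>\<omega>. cmod (?D (X n k \<omega>)))"
      by (intro integrable_norm integrable_X[OF k, of ?D] continuous_on_diff cont)
    show "integrable M (\<lambda>\<omega>. ?a * (sol_H (X n k \<omega>) - row_mean n k)\<^sup>2 + ?c * sol_cutoff d \<delta> (X n k \<omega>))"
      by (rule integrable_X[OF k, of "\<lambda>y. ?a * (sol_H y - row_mean n k)\<^sup>2 + ?c * sol_cutoff d \<delta> y"])
        (intro continuous_intros continuous_on_sol_H continuous_on_sol_cutoff)
  qed (intro pw X_in[OF k])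
  also have "\<dots> = ?a * row_var n k + ?c * expectation (\<lambda>\<omega>. sol_cutoff d \<delta> (X n k \<omega>))"
    unfolding row_var_eq
    by (subst Bochner_Integration.integral_add)
      (auto intro!: integrable_mult_right integrable_X[OF k, of "\<lambda>y. (sol_H y - row_mean n k)\<^sup>2"]
        integrable_X[OF k, of "sol_cutoff d \<delta>"] continuous_intros continuous_on_sol_H continuous_on_sol_cutoff)
  also have "expectation (\<lambda>\<omega>. ?D (X n k \<omega>)) = expectation (\<lambda>\<omega>. sol_R p d l (row_mean n k) (X n k \<omega>))
      - expectation (\<lambda>\<omega>. sol_cutoff d \<delta> (X n k \<omega>) *\<^sub>R sol_F p d l (X n k \<omega>))"
    by (rule Bochner_Integration.integral_diff) (rule integrable_X[OF k cont(1)], rule integrable_X[OF k cont(2)])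
  finally show ?thesis .
qed

section \<open>Limits of cut-off row sums and of the sums of remainders\<close>

lemma tendsto_cutoff:
  assumes "0 < \<delta>"
  shows "(\<lambda>n. \<Sum>k=1..K n. expectation (\<lambda>\<omega>. sol_cutoff d \<delta> (X n k \<omega>))) \<longlonglongrightarrow> (\<integral>y. sol_cutoff d \<delta> y \<partial>\<eta>)"
  using C0[OF C0_sol_cutoff_times[OF assms, of p "\<lambda>_. 1" d]] by simp

text \<open>Condition (iv) concerns real functions, so real and imaginary parts are treated
  separately. Integrability holds because the cutoff is at most \<delta>^-2 times the squared
  distance.\<close>

lemma tendsto_cutoff_times:
  fixes f :: "(nat \<Rightarrow> complex) \<Rightarrow> complex"
  assumes "0 < \<delta>" and f: "continuous_on (solenoid p) f"
  shows "integrable \<eta> (\<lambda>y. sol_cutoff d \<delta> y *\<^sub>R f y)"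
    and "(\<lambda>n. \<Sum>k=1..K n. expectation (\<lambda>\<omega>. sol_cutoff d \<delta> (X n k \<omega>) *\<^sub>R f (X n k \<omega>)))
      \<longlonglongrightarrow> (\<integral>y. sol_cutoff d \<delta> y *\<^sub>R f y \<partial>\<eta>)"
proof -
  have c: "continuous_on (solenoid p) (\<lambda>y. sol_cutoff d \<delta> y *\<^sub>R f y)"
    by (intro continuous_intros continuous_on_sol_cutoff f)
  obtain B where B: "\<forall>y\<in>solenoid p. cmod (f y) \<le> B" using bounded_sol_continuous[OF f] ..
  show i: "integrable \<eta> (\<lambda>y. sol_cutoff d \<delta> y *\<^sub>R f y)"
  proof (rule levy_integrable[OF levy borel_measurable_sol_continuous[OF c]])
    fix y assume y: "y \<in> solenoid p"
    then have "0 \<le> B" using B norm_ge_zero order_trans by blast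
    then show "norm (sol_cutoff d \<delta> y *\<^sub>R f y) \<le> (1 / \<delta>\<^sup>2 * B) * (cmod (y d - 1))\<^sup>2"
      using mult_mono[OF sol_cutoff_le[OF assms(1), of d y], of "cmod (f y)" B] B y
      by (simp add: sol_cutoff_nonneg algebra_simps)
  qed
  have iX: "integrable M (\<lambda>\<omega>. sol_cutoff d \<delta> (X n k \<omega>) *\<^sub>R f (X n k \<omega>))" if "k \<in> {1..K n}" for n k
    by (rule integrable_X[OF that c])
  show "(\<lambda>n. \<Sum>k=1..K n. expectation (\<lambda>\<omega>. sol_cutoff d \<delta> (X n k \<omega>) *\<^sub>R f (X n k \<omega>)))
      \<longlonglongrightarrow> (\<integral>y. sol_cutoff d \<delta> y *\<^sub>R f y \<partial>\<eta>)"
    unfolding tendsto_complex_iff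
  proof
    have "(\<lambda>n. \<Sum>k=1..K n. expectation (\<lambda>\<omega>. sol_cutoff d \<delta> (X n k \<omega>) * Re (f (X n k \<omega>))))
        \<longlonglongrightarrow> (\<integral>y. sol_cutoff d \<delta> y * Re (f y) \<partial>\<eta>)"
      by (intro C0[OF C0_sol_cutoff_times[OF assms(1)]] continuous_intros f)
    then show "(\<lambda>n. Re (\<Sum>k=1..K n. expectation (\<lambda>\<omega>. sol_cutoff d \<delta> (X n k \<omega>) *\<^sub>R f (X n k \<omega>))))
        \<longlonglongrightarrow> Re (\<integral>y. sol_cutoff d \<delta> y *\<^sub>R f y \<partial>\<eta>)"
      using integral_Re[OF iX] integral_Re[OF i] by simp
    have "(\<lambda>n. \<Sum>k=1..K n. expectation (\<lambda>\<omega>. sol_cutoff d \<delta> (X n k \<omega>) * Im (f (X n k \<omega>))))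
        \<longlonglongrightarrow> (\<integral>y. sol_cutoff d \<delta> y * Im (f y) \<partial>\<eta>)"
      by (intro C0[OF C0_sol_cutoff_times[OF assms(1)]] continuous_intros f)
    then show "(\<lambda>n. Im (\<Sum>k=1..K n. expectation (\<lambda>\<omega>. sol_cutoff d \<delta> (X n k \<omega>) *\<^sub>R f (X n k \<omega>))))
        \<longlonglongrightarrow> Im (\<integral>y. sol_cutoff d \<delta> y *\<^sub>R f y \<partial>\<eta>)"
      using integral_Im[OF iX] integral_Im[OF i] by simp
  qed
qed

text \<open>The cutoff differs from 1 only at distance below 2 \<delta>. There one of the three
  distance factors bounding \<open>sol_F\<close> is at most 2 \<delta>, and the other two are
  integrable against \<eta>.\<close>

lemma tail_of_sol_F:
  assumes "0 < \<delta>" and C: "0 \<le> C" "\<And>y. y \<in> solenoid p \<Longrightarrow> cmod (sol_F p d l y) \<le> C * cmod (y d - 1) ^ 3"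
  shows "integrable \<eta> (sol_F p d l)"
    and "cmod ((\<integral>y. sol_F p d l y \<partial>\<eta>) - (\<integral>y. sol_cutoff d \<delta> y *\<^sub>R sol_F p d l y \<partial>\<eta>))
      \<le> 2 * \<delta> * C * (\<integral>y. (cmod (y d - 1))\<^sup>2 \<partial>\<eta>)"
proof -
  note i1 = tendsto_cutoff_times(1)[OF assms(1) continuous_on_sol_F, of d d l]
  show i2: "integrable \<eta> (sol_F p d l)"
  proof (rule levy_integrable[OF levy borel_measurable_sol_continuous[OF continuous_on_sol_F]])
    fix y assume y: "y \<in> solenoid p"
    have u: "cmod (y d - 1) \<le> 2" using norm_triangle_ineq4[of "y d" 1] solenoid_norm[OF y, of d] by simp
    have "C * cmod (y d - 1) ^ 3 = C * (cmod (y d - 1) * (cmod (y d - 1))\<^sup>2)"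
      by (simp add: power3_eq_cube power2_eq_square)
    also have "\<dots> \<le> C * (2 * (cmod (y d - 1))\<^sup>2)"
      using u C(1) by (intro mult_left_mono mult_right_mono) auto
    finally show "norm (sol_F p d l y) \<le> (C * 2) * (cmod (y d - 1))\<^sup>2"
      using C(2)[OF y] by simp
  qed
  have "cmod ((\<integral>y. sol_F p d l y \<partial>\<eta>) - (\<integral>y. sol_cutoff d \<delta> y *\<^sub>R sol_F p d l y \<partial>\<eta>))
      = cmod (\<integral>y. sol_F p d l y - sol_cutoff d \<delta> y *\<^sub>R sol_F p d l y \<partial>\<eta>)"
    using i1 i2 by simp
  also have "\<dots> \<le> (\<integral>y. cmod (sol_F p d l y - sol_cutoff d \<delta> y *\<^sub>R sol_F p d l y) \<partial>\<eta>)"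
    by (rule integral_norm_bound)
  also have "\<dots> \<le> (\<integral>y. 2 * \<delta> * C * (cmod (y d - 1))\<^sup>2 \<partial>\<eta>)"
  proof (rule integral_mono)
    show "integrable \<eta> (\<lambda>y. cmod (sol_F p d l y - sol_cutoff d \<delta> y *\<^sub>R sol_F p d l y))"
      using i1 i2 by simp
    show "integrable \<eta> (\<lambda>y. 2 * \<delta> * C * (cmod (y d - 1))\<^sup>2)"
      by (rule integrable_mult_right[OF levy_integrable_distance[OF levy]])
    fix y assume "y \<in> space \<eta>"
    then have y: "y \<in> solenoid p" by (simp add: space_eq_solenoid[OF levy_measure_sets[OF levy]])
    have "sol_F p d l y - sol_cutoff d \<delta> y *\<^sub>R sol_F p d l y = (1 - sol_cutoff d \<delta> y) *\<^sub>R sol_F p d l y"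
      by (simp add: algebra_simps)
    then have eq: "cmod (sol_F p d l y - sol_cutoff d \<delta> y *\<^sub>R sol_F p d l y)
        = (1 - sol_cutoff d \<delta> y) * cmod (sol_F p d l y)"
      using sol_cutoff_le_1[of d \<delta> y] by simp
    show "cmod (sol_F p d l y - sol_cutoff d \<delta> y *\<^sub>R sol_F p d l y) \<le> 2 * \<delta> * C * (cmod (y d - 1))\<^sup>2"
    proof (cases "2 * \<delta> \<le> cmod (y d - 1)")
      case True
      then show ?thesis unfolding eq using sol_cutoff_eq_1[of \<delta> y d] True assms(1) C(1) by simp
    next
      case False
      have "(1 - sol_cutoff d \<delta> y) * cmod (sol_F p d l y) \<le> cmod (sol_F p d l y)"
        using mult_right_mono[of "1 - sol_cutoff d \<delta> y" 1 "cmod (sol_F p d l y)"] sol_cutoff_nonneg[of d \<delta> y]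
        by simp
      also have "\<dots> \<le> C * (cmod (y d - 1) * (cmod (y d - 1))\<^sup>2)"
        using C(2)[OF y] by (simp add: power3_eq_cube power2_eq_square)
      also have "\<dots> \<le> C * (2 * \<delta> * (cmod (y d - 1))\<^sup>2)"
        using False C(1) by (intro mult_left_mono mult_right_mono) auto
      finally show ?thesis unfolding eq by (simp add: mult_ac)
    qed
  qed
  also have "\<dots> = 2 * \<delta> * C * (\<integral>y. (cmod (y d - 1))\<^sup>2 \<partial>\<eta>)" by simp
  finally show "cmod ((\<integral>y. sol_F p d l y \<partial>\<eta>) - (\<integral>y. sol_cutoff d \<delta> y *\<^sub>R sol_F p d l y \<partial>\<eta>))
      \<le> 2 * \<delta> * C * (\<integral>y. (cmod (y d - 1))\<^sup>2 \<partial>\<eta>)" .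
qed

lemma sum_row_var_bounded: "\<exists>v>0. eventually (\<lambda>n. (\<Sum>k=1..K n. row_var n k) \<le> v) sequentially"
proof -
  let ?v = "b + (\<integral>y. (sol_H y)\<^sup>2 \<partial>\<eta>)"
  have "eventually (\<lambda>n. (\<Sum>k=1..K n. row_var n k) < \<bar>?v\<bar> + 1) sequentially"
    using var unfolding row_var_def by (rule order_tendstoD(2)) simp
  then have "eventually (\<lambda>n. (\<Sum>k=1..K n. row_var n k) \<le> \<bar>?v\<bar> + 1) sequentially"
    by (rule eventually_mono) simp
  then show ?thesis by (intro exI[of _ "\<bar>?v\<bar> + 1"]) auto
qed

text \<open>The order of choices matters: \<delta> first, making both the local variance term and
  the tail of \<eta> small; only then \<kappa>, since the cutoff mass that it multiplies depends on
  \<delta> and may grow as \<delta> shrinks.\<close>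

lemma tendsto_sum_sol_R:
  "(\<lambda>n. \<Sum>k=1..K n. expectation (\<lambda>\<omega>. sol_R p d l (row_mean n k) (X n k \<omega>))) \<longlonglongrightarrow> (\<integral>y. sol_F p d l y \<partial>\<eta>)"
proof (rule tendstoI)
  fix e :: real assume e: "0 < e"
  define \<theta> where "\<theta> = real_of_int l / real p ^ d"
  define P where "P = real p ^ d"
  have P: "0 < P" using p_pos by (simp add: P_def)
  obtain v where v: "v > 0" "eventually (\<lambda>n. (\<Sum>k=1..K n. row_var n k) \<le> v) sequentially"
    using sum_row_var_bounded by blast
  obtain C where C: "C \<ge> 0" "\<And>y. y \<in> solenoid p \<Longrightarrow> cmod (sol_F p d l y) \<le> C * cmod (y d - 1) ^ 3"
    using sol_F_bound[OF p_pos] by blast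
  define I where "I = (\<integral>y. (cmod (y d - 1))\<^sup>2 \<partial>\<eta>)"
  have I: "I \<ge> 0" by (simp add: I_def)
  define D where "D = \<bar>\<theta>\<bar> ^ 3 * (4 * P) * v + 2 * C * I"
  have D: "D \<ge> 0" using P v C I by (simp add: D_def)
  \<comment> \<open>The first entry keeps the ball of radius 2 \<delta> inside the range of
    \<open>sol_local\<close>; the second makes \<delta> D at most e/8, with D + 1 to exclude
    division by zero.\<close>
  define \<delta> where "\<delta> = min (1 / (8 * P)) (e / (8 * (D + 1)))"
  have \<delta>: "0 < \<delta>" "2 * \<delta> \<le> 1 / (4 * P)" "\<delta> \<le> e / (8 * (D + 1))"
  proof -
    show "0 < \<delta>" using P e D by (simp add: \<delta>_def)
    have "\<delta> \<le> 1 / (8 * P)" by (simp add: \<delta>_def)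
    then show "2 * \<delta> \<le> 1 / (4 * P)" by simp
  qed (simp add: \<delta>_def)
  have \<delta>D: "\<delta> * D \<le> e / 8"
  proof -
    have "\<delta> * D \<le> e / (8 * (D + 1)) * (D + 1)" using \<delta> D e by (intro mult_mono) auto
    also have "\<dots> = e / 8" using D by (simp add: field_simps)
    finally show ?thesis .
  qed
  \<comment> \<open>An eventual bound for the expected cutoff mass of a row at this \<delta>. With
    \<kappa> G <= e/8 below, the total error is under e/8 + e/8 + e/4 < e.\<close>
  define w where "w = (\<integral>y. sol_cutoff d \<delta> y \<partial>\<eta>) + 1"
  have w0: "w \<ge> 1" by (simp add: w_def sol_cutoff_nonneg)
  have w: "eventually (\<lambda>n. (\<Sum>k=1..K n. expectation (\<lambda>\<omega>. sol_cutoff d \<delta> (X n k \<omega>))) < w) sequentially"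
    by (rule order_tendstoD(2)[OF tendsto_cutoff[OF \<delta>(1)]]) (simp add: w_def)
  define G where "G = \<bar>\<theta>\<bar> ^ 3 * v + (2 * \<bar>\<theta>\<bar> + 3 * \<theta>\<^sup>2) * w"
  have G: "G \<ge> 0" using v w0 by (simp add: G_def)
  define \<kappa> where "\<kappa> = min 1 (e / (8 * (G + 1)))"
  have \<kappa>: "0 < \<kappa>" "\<kappa> \<le> 1" "\<kappa> \<le> e / (8 * (G + 1))" using e G by (auto simp: \<kappa>_def)
  have \<kappa>G: "\<kappa> * G \<le> e / 8"
  proof -
    have "\<kappa> * G \<le> e / (8 * (G + 1)) * (G + 1)" using \<kappa> G e by (intro mult_mono) auto
    also have "\<dots> = e / 8" using G by (simp add: field_simps)
    finally show ?thesis .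
  qed
  let ?F = "\<integral>y. sol_F p d l y \<partial>\<eta>" and ?Fc = "\<integral>y. sol_cutoff d \<delta> y *\<^sub>R sol_F p d l y \<partial>\<eta>"
  let ?R = "\<lambda>n k. expectation (\<lambda>\<omega>. sol_R p d l (row_mean n k) (X n k \<omega>))"
  let ?S = "\<lambda>n k. expectation (\<lambda>\<omega>. sol_cutoff d \<delta> (X n k \<omega>) *\<^sub>R sol_F p d l (X n k \<omega>))"
  let ?T = "\<lambda>n k. expectation (\<lambda>\<omega>. sol_cutoff d \<delta> (X n k \<omega>))"
  have lim: "eventually (\<lambda>n. dist (\<Sum>k=1..K n. ?S n k) ?Fc < e / 4) sequentially"
    using tendsto_cutoff_times(2)[OF \<delta>(1) continuous_on_sol_F] e by (intro tendstoD) auto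
  have tail: "cmod (?F - ?Fc) \<le> 2 * \<delta> * C * I"
    unfolding I_def by (rule tail_of_sol_F(2)[OF \<delta>(1) C])
  from v(2) w lim row_mean_small[OF \<kappa>(1)]
  show "eventually (\<lambda>n. dist (\<Sum>k=1..K n. ?R n k) ?F < e) sequentially"
  proof eventually_elim
    case (elim n)
    have "cmod ((\<Sum>k=1..K n. ?R n k) - (\<Sum>k=1..K n. ?S n k)) \<le> (\<Sum>k=1..K n. cmod (?R n k - ?S n k))"
      unfolding sum_subtractf[symmetric] by (rule norm_sum)
    also have "\<dots> \<le> (\<Sum>k=1..K n. \<bar>\<theta>\<bar> ^ 3 * (4 * P * \<delta> + \<kappa>) * row_var n k + (2 * \<bar>\<theta>\<bar> + 3 * \<theta>\<^sup>2) * \<kappa> * ?T n k)"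
    proof (rule sum_mono)
      fix k assume k: "k \<in> {1..K n}"
      show "cmod (?R n k - ?S n k) \<le> \<bar>\<theta>\<bar> ^ 3 * (4 * P * \<delta> + \<kappa>) * row_var n k + (2 * \<bar>\<theta>\<bar> + 3 * \<theta>\<^sup>2) * \<kappa> * ?T n k"
        unfolding \<theta>_def P_def
        using elim(4) k \<delta> \<kappa> by (intro expectation_sol_R_approx) (auto simp: P_def)
    qed
    also have "\<dots> = \<bar>\<theta>\<bar> ^ 3 * (4 * P * \<delta> + \<kappa>) * (\<Sum>k=1..K n. row_var n k) + (2 * \<bar>\<theta>\<bar> + 3 * \<theta>\<^sup>2) * \<kappa> * (\<Sum>k=1..K n. ?T n k)"
      by (simp add: sum.distrib sum_distrib_left)
    also have "\<dots> \<le> \<bar>\<theta>\<bar> ^ 3 * (4 * P * \<delta> + \<kappa>) * v + (2 * \<bar>\<theta>\<bar> + 3 * \<theta>\<^sup>2) * \<kappa> * w"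
      using elim(1,2) P \<delta>(1) \<kappa>(1) by (intro add_mono mult_left_mono) auto
    also have "\<dots> = \<delta> * (\<bar>\<theta>\<bar> ^ 3 * (4 * P) * v) + \<kappa> * G" by (simp add: G_def algebra_simps)
    finally have 1: "cmod ((\<Sum>k=1..K n. ?R n k) - (\<Sum>k=1..K n. ?S n k)) \<le> \<delta> * (\<bar>\<theta>\<bar> ^ 3 * (4 * P) * v) + \<kappa> * G" .
    have 2: "\<delta> * (\<bar>\<theta>\<bar> ^ 3 * (4 * P) * v) + 2 * \<delta> * C * I = \<delta> * D" by (simp add: D_def algebra_simps)
    have "cmod ((\<Sum>k=1..K n. ?R n k) - ?F) \<le> cmod ((\<Sum>k=1..K n. ?R n k) - (\<Sum>k=1..K n. ?S n k))
        + cmod ((\<Sum>k=1..K n. ?S n k) - ?Fc) + cmod (?F - ?Fc)"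
      using norm_triangle_ineq4[of "(\<Sum>k=1..K n. ?R n k) - ?Fc" "?F - ?Fc"]
        norm_triangle_ineq[of "(\<Sum>k=1..K n. ?R n k) - (\<Sum>k=1..K n. ?S n k)" "(\<Sum>k=1..K n. ?S n k) - ?Fc"]
      by simp
    also have "\<dots> < e" using 1 2 \<delta>D \<kappa>G tail elim(3) e unfolding dist_norm by linarith
    finally show ?case unfolding dist_norm .
  qed
qed

text \<open>Passing from products to exponentials requires bounded absolute sums, which convergence
  of the signed sums does not give. A fixed \<delta> and \<kappa> = 1 suffice: the approximating
  terms are bounded by a multiple of the cutoff mass.\<close>

lemma sum_norm_expectation_sol_R_bounded:
  "\<exists>B. eventually (\<lambda>n. (\<Sum>k=1..K n. cmod (expectation (\<lambda>\<omega>. sol_R p d l (row_mean n k) (X n k \<omega>)))) \<le> B) sequentially"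
proof -
  define \<theta> where "\<theta> = real_of_int l / real p ^ d"
  define P where "P = real p ^ d"
  define \<delta> where "\<delta> = 1 / (8 * P)"
  have P: "0 < P" using p_pos by (simp add: P_def)
  have \<delta>: "0 < \<delta>" "2 * \<delta> \<le> 1 / (4 * P)" using P by (auto simp: \<delta>_def)
  obtain v where v: "v > 0" "eventually (\<lambda>n. (\<Sum>k=1..K n. row_var n k) \<le> v) sequentially"
    using sum_row_var_bounded by blast
  obtain B0 where "\<forall>y\<in>solenoid p. cmod (sol_F p d l y) \<le> B0" using bounded_sol_continuous[OF continuous_on_sol_F] ..
  then obtain B where B: "0 \<le> B" "\<And>y. y \<in> solenoid p \<Longrightarrow> cmod (sol_F p d l y) \<le> B"
    by (meson abs_ge_self abs_ge_zero order_trans)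
  define w where "w = (\<integral>y. sol_cutoff d \<delta> y \<partial>\<eta>) + 1"
  have w: "eventually (\<lambda>n. (\<Sum>k=1..K n. expectation (\<lambda>\<omega>. sol_cutoff d \<delta> (X n k \<omega>))) < w) sequentially"
    by (rule order_tendstoD(2)[OF tendsto_cutoff[OF \<delta>(1)]]) (simp add: w_def)
  let ?R = "\<lambda>n k. expectation (\<lambda>\<omega>. sol_R p d l (row_mean n k) (X n k \<omega>))"
  let ?S = "\<lambda>n k. expectation (\<lambda>\<omega>. sol_cutoff d \<delta> (X n k \<omega>) *\<^sub>R sol_F p d l (X n k \<omega>))"
  let ?T = "\<lambda>n k. expectation (\<lambda>\<omega>. sol_cutoff d \<delta> (X n k \<omega>))"
  let ?a = "\<bar>\<theta>\<bar> ^ 3 * (4 * P * \<delta> + 1)" and ?c = "2 * \<bar>\<theta>\<bar> + 3 * \<theta>\<^sup>2 + B"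
  from v(2) w row_mean_small[OF zero_less_one]
  have "eventually (\<lambda>n. (\<Sum>k=1..K n. cmod (?R n k)) \<le> ?a * v + ?c * w) sequentially"
  proof eventually_elim
    case (elim n)
    have "(\<Sum>k=1..K n. cmod (?R n k)) \<le> (\<Sum>k=1..K n. ?a * row_var n k + ?c * ?T n k)"
    proof (rule sum_mono)
      fix k assume k: "k \<in> {1..K n}"
      have "cmod (?R n k - ?S n k) \<le> ?a * row_var n k + (2 * \<bar>\<theta>\<bar> + 3 * \<theta>\<^sup>2) * 1 * ?T n k"
        unfolding \<theta>_def P_def
        using elim(3) k \<delta> by (intro expectation_sol_R_approx) (auto simp: P_def)
      moreover have "cmod (?S n k) \<le> B * ?T n k"
      proof -
        have "cmod (?S n k) \<le> expectation (\<lambda>\<omega>. cmod (sol_cutoff d \<delta> (X n k \<omega>) *\<^sub>R sol_F p d l (X n k \<omega>)))"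
          by (rule integral_norm_bound)
        also have "\<dots> \<le> expectation (\<lambda>\<omega>. B * sol_cutoff d \<delta> (X n k \<omega>))"
        proof (rule integral_mono)
          show "integrable M (\<lambda>\<omega>. cmod (sol_cutoff d \<delta> (X n k \<omega>) *\<^sub>R sol_F p d l (X n k \<omega>)))"
            by (rule integrable_X[OF k, of "\<lambda>y. cmod (sol_cutoff d \<delta> y *\<^sub>R sol_F p d l y)"])
              (intro continuous_intros continuous_on_sol_F continuous_on_sol_cutoff)
          show "integrable M (\<lambda>\<omega>. B * sol_cutoff d \<delta> (X n k \<omega>))"
            by (intro integrable_mult_right integrable_X[OF k] continuous_on_sol_cutoff)
          fix \<omega> assume "\<omega> \<in> space M"
          then show "cmod (sol_cutoff d \<delta> (X n k \<omega>) *\<^sub>R sol_F p d l (X n k \<omega>)) \<le> B * sol_cutoff d \<delta> (X n k \<omega>)"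
            using mult_left_mono[OF B(2)[OF X_in[OF k]], of \<omega> "sol_cutoff d \<delta> (X n k \<omega>)"]
            by (simp add: sol_cutoff_nonneg mult.commute)
        qed
        finally show ?thesis by simp
      qed
      moreover have "cmod (?R n k) \<le> cmod (?R n k - ?S n k) + cmod (?S n k)"
        using norm_triangle_ineq[of "?R n k - ?S n k" "?S n k"] by simp
      ultimately show "cmod (?R n k) \<le> ?a * row_var n k + ?c * ?T n k" by (simp add: algebra_simps)
    qed
    also have "\<dots> = ?a * (\<Sum>k=1..K n. row_var n k) + ?c * (\<Sum>k=1..K n. ?T n k)"
      by (simp add: sum.distrib sum_distrib_left)
    also have "\<dots> \<le> ?a * v + ?c * w"
      using elim(1,2) P \<delta>(1) B(1) by (intro add_mono mult_left_mono) auto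
    finally show ?case .
  qed
  then show ?thesis by blast
qed

text \<open>Centring at the exact mean removes the linear term, and the quadratic term has the
  variance as its expectation.\<close>

lemma expectation_centred_char:
  assumes k: "k \<in> {1..K n}"
  shows "expectation (\<lambda>\<omega>. sol_char d l (X n k \<omega>)) * iexp (- (of_int l / real p ^ d * row_mean n k)) - 1
    = expectation (\<lambda>\<omega>. sol_R p d l (row_mean n k) (X n k \<omega>)) - of_real ((of_int l / real p ^ d)\<^sup>2 / 2 * row_var n k)"
proof -
  define \<theta> where "\<theta> = real_of_int l / real p ^ d"
  let ?H = "\<lambda>\<omega>. sol_H (X n k \<omega>)" and ?c = "\<lambda>\<omega>. sol_char d l (X n k \<omega>)"
  have iH: "integrable M ?H" by (rule integrable_X[OF k continuous_on_sol_H])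
  have iS: "integrable M (\<lambda>\<omega>. (?H \<omega> - row_mean n k)\<^sup>2)"
    by (rule integrable_X[OF k, of "\<lambda>y. (sol_H y - row_mean n k)\<^sup>2"]) (intro continuous_intros continuous_on_sol_H)
  have ic: "integrable M ?c" by (rule integrable_X[OF k continuous_on_sol_char])
  have "(\<lambda>\<omega>. sol_R p d l (row_mean n k) (X n k \<omega>)) = (\<lambda>\<omega>. (?c \<omega> * iexp (- (\<theta> * row_mean n k)) - 1)
      - \<i> * of_real \<theta> * of_real (?H \<omega> - row_mean n k) + of_real (\<theta>\<^sup>2 / 2) * of_real ((?H \<omega> - row_mean n k)\<^sup>2))"
    by (simp add: sol_R_def \<theta>_def[symmetric] fun_eq_iff power_mult_distrib)
  then have "expectation (\<lambda>\<omega>. sol_R p d l (row_mean n k) (X n k \<omega>))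
      = (expectation ?c * iexp (- (\<theta> * row_mean n k)) - 1) - \<i> * of_real \<theta> * of_real (expectation (\<lambda>\<omega>. ?H \<omega> - row_mean n k))
        + of_real (\<theta>\<^sup>2 / 2) * of_real (expectation (\<lambda>\<omega>. (?H \<omega> - row_mean n k)\<^sup>2))"
    using iH iS ic by (simp add: prob_space del: of_real_diff of_real_power)
  moreover have "expectation (\<lambda>\<omega>. ?H \<omega> - row_mean n k) = 0" using iH by (simp add: row_mean_def prob_space)
  ultimately show ?thesis by (simp add: \<theta>_def[symmetric] row_var_eq[symmetric])
qed

text \<open>Applies \<open>tendsto_prod_exp\<close> to the centred coefficients: deviations from 1
  are remainder minus \<theta>^2/2 times variance, boundedly summable, uniformly small by
  infinitesimality, and their sums converge.\<close>

lemma tendsto_centred_product: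
  "(\<lambda>n. \<Prod>k=1..K n. expectation (\<lambda>\<omega>. sol_char d l (X n k \<omega>)) * iexp (- (of_int l / real p ^ d * row_mean n k)))
    \<longlonglongrightarrow> exp (- of_real (b * (of_int l / real p ^ d)\<^sup>2 / 2) + (\<integral>y. sol_J p d l y \<partial>\<eta>))"
proof -
  define \<theta> where "\<theta> = real_of_int l / real p ^ d"
  let ?R = "\<lambda>n k. expectation (\<lambda>\<omega>. sol_R p d l (row_mean n k) (X n k \<omega>))"
  let ?c = "\<lambda>n k. expectation (\<lambda>\<omega>. sol_char d l (X n k \<omega>))"
  note eq = expectation_centred_char[of _ _ d l, folded \<theta>_def]
  have c_le: "cmod (?c n k) \<le> 1" if k: "k \<in> {1..K n}" for n k
  proof -
    have "cmod (?c n k) \<le> expectation (\<lambda>\<omega>. cmod (sol_char d l (X n k \<omega>)))" by (rule integral_norm_bound)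
    also have "\<dots> = expectation (\<lambda>\<omega>. 1)"
      by (rule Bochner_Integration.integral_cong[OF refl]) (rule norm_sol_char[OF X_in[OF k]])
    finally show ?thesis by (simp add: prob_space)
  qed
  obtain B where B: "eventually (\<lambda>n. (\<Sum>k=1..K n. cmod (?R n k)) \<le> B) sequentially"
    using sum_norm_expectation_sol_R_bounded by blast
  obtain v where v: "v > 0" "eventually (\<lambda>n. (\<Sum>k=1..K n. row_var n k) \<le> v) sequentially"
    using sum_row_var_bounded by blast
  show ?thesis
  proof (rule tendsto_prod_exp[where B = "B + \<theta>\<^sup>2 / 2 * v"])
    show "cmod (?c n k * iexp (- (of_int l / real p ^ d * row_mean n k))) \<le> 1" if "k \<in> {1..K n}" for n k
      using c_le[OF that] by (simp add: norm_mult)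
    show "eventually (\<lambda>n. (\<Sum>k\<in>{1..K n}. cmod (?c n k * iexp (- (of_int l / real p ^ d * row_mean n k)) - 1))
        \<le> B + \<theta>\<^sup>2 / 2 * v) sequentially"
      using B v(2)
    proof eventually_elim
      case (elim n)
      have "(\<Sum>k=1..K n. cmod (?c n k * iexp (- (of_int l / real p ^ d * row_mean n k)) - 1))
          \<le> (\<Sum>k=1..K n. cmod (?R n k) + \<theta>\<^sup>2 / 2 * row_var n k)"
      proof (rule sum_mono)
        fix k assume k: "k \<in> {1..K n}"
        show "cmod (?c n k * iexp (- (of_int l / real p ^ d * row_mean n k)) - 1) \<le> cmod (?R n k) + \<theta>\<^sup>2 / 2 * row_var n k"
          unfolding \<theta>_def[symmetric] eq[OF k]
          using norm_triangle_ineq4[of "?R n k" "of_real (\<theta>\<^sup>2 / 2 * row_var n k)"] row_var_nonneg[of n k]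
          unfolding norm_of_real by simp
      qed
      also have "\<dots> = (\<Sum>k=1..K n. cmod (?R n k)) + \<theta>\<^sup>2 / 2 * (\<Sum>k=1..K n. row_var n k)"
        by (simp add: sum.distrib sum_distrib_left)
      also have "\<dots> \<le> B + \<theta>\<^sup>2 / 2 * v" using elim by (intro add_mono mult_left_mono) auto
      finally show ?case .
    qed
    show "eventually (\<lambda>n. \<forall>k\<in>{1..K n}. cmod (?c n k * iexp (- (of_int l / real p ^ d * row_mean n k)) - 1) \<le> e) sequentially"
      if e: "0 < e" for e
    proof -
      obtain C where C: "C \<ge> 0" "\<And>y. y \<in> solenoid p \<Longrightarrow> cmod (sol_char d l y - 1) \<le> C * cmod (y d - 1)"
        using sol_char_bound[OF p_pos] by blast
      define q where "q = \<bar>\<theta>\<bar> + 1"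
      have q: "0 < q" "\<bar>\<theta>\<bar> \<le> q" by (simp_all add: q_def)
      have e1: "0 < e / 2" and e2: "0 < e / (2 * q)" using e q(1) by auto
      have cc: "continuous_on (solenoid p) (\<lambda>y. sol_char d l y - 1)"
        by (intro continuous_intros continuous_on_sol_char)
      have "eventually (\<lambda>n. \<forall>k\<in>{1..K n}. norm (expectation (\<lambda>\<omega>. sol_char d l (X n k \<omega>) - 1)) \<le> e / 2) sequentially"
        by (rule expectation_small[OF cc C(1) _ e1]) (rule C(2))
      from this row_mean_small[OF e2] show ?thesis
      proof eventually_elim
        case (elim n)
        show ?case
        proof
          fix k assume k: "k \<in> {1..K n}"
          have "expectation (\<lambda>\<omega>. sol_char d l (X n k \<omega>) - 1) = ?c n k - 1"
            using integrable_X[OF k continuous_on_sol_char] by (simp add: prob_space)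
          then have 1: "cmod (?c n k - 1) \<le> e / 2" using elim(1)[rule_format, OF k] by (simp only:)
          have "cmod (iexp (- (\<theta> * row_mean n k)) - 1) \<le> \<bar>\<theta>\<bar> * \<bar>row_mean n k\<bar>"
            using iexp_approx1[of "- (\<theta> * row_mean n k)" 0] by (simp add: abs_mult)
          also have "\<dots> \<le> q * (e / (2 * q))"
            using elim(2) k q by (intro mult_mono) auto
          also have "\<dots> = e / 2" using q(1) by simp
          finally have 2: "cmod (iexp (- (\<theta> * row_mean n k)) - 1) \<le> e / 2" .
          have "cmod (?c n k * iexp (- (\<theta> * row_mean n k)) - 1)
              \<le> cmod ((?c n k - 1) * iexp (- (\<theta> * row_mean n k))) + cmod (iexp (- (\<theta> * row_mean n k)) - 1)"
            using norm_triangle_ineq[of "(?c n k - 1) * iexp (- (\<theta> * row_mean n k))" "iexp (- (\<theta> * row_mean n k)) - 1"]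
            by (simp add: algebra_simps)
          also have "\<dots> = cmod (?c n k - 1) + cmod (iexp (- (\<theta> * row_mean n k)) - 1)" by (simp add: norm_mult)
          finally show "cmod (?c n k * iexp (- (of_int l / real p ^ d * row_mean n k)) - 1) \<le> e"
            using 1 2 by (simp add: \<theta>_def[symmetric])
        qed
      qed
    qed
    obtain C where C: "C \<ge> 0" "\<And>y. y \<in> solenoid p \<Longrightarrow> cmod (sol_F p d l y) \<le> C * cmod (y d - 1) ^ 3"
      using sol_F_bound[OF p_pos] by blast
    have "(\<lambda>n. (\<Sum>k=1..K n. ?R n k) - of_real (\<theta>\<^sup>2 / 2 * (\<Sum>k=1..K n. row_var n k)))
        \<longlonglongrightarrow> (\<integral>y. sol_F p d l y \<partial>\<eta>) - of_real (\<theta>\<^sup>2 / 2 * (b + (\<integral>y. (sol_H y)\<^sup>2 \<partial>\<eta>)))"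
      using var unfolding row_var_def by (intro tendsto_intros tendsto_sum_sol_R)
    moreover have "(\<Sum>k=1..K n. ?R n k) - of_real (\<theta>\<^sup>2 / 2 * (\<Sum>k=1..K n. row_var n k))
        = (\<Sum>k=1..K n. ?c n k * iexp (- (\<theta> * row_mean n k)) - 1)" for n
    proof -
      have "(\<Sum>k=1..K n. ?c n k * iexp (- (\<theta> * row_mean n k)) - 1) = (\<Sum>k=1..K n. ?R n k - of_real (\<theta>\<^sup>2 / 2 * row_var n k))"
        by (intro sum.cong refl eq)
      then show ?thesis by (simp add: sum_subtractf sum_distrib_left)
    qed
    \<comment> \<open>The quadratic term by which \<open>sol_F\<close> exceeds \<open>sol_J\<close>
      cancels the integral of H^2 in the limit of the variances; what remains of the latter is the
      Gaussian part b.\<close>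
    moreover have "(\<integral>y. sol_F p d l y \<partial>\<eta>) - of_real (\<theta>\<^sup>2 / 2 * (b + (\<integral>y. (sol_H y)\<^sup>2 \<partial>\<eta>)))
        = - of_real (b * \<theta>\<^sup>2 / 2) + (\<integral>y. sol_J p d l y \<partial>\<eta>)"
    proof -
      have "(\<lambda>y. sol_F p d l y) = (\<lambda>y. sol_J p d l y + of_real (\<theta>\<^sup>2 / 2) * of_real ((sol_H y)\<^sup>2))"
        by (simp add: sol_F_def \<theta>_def[symmetric] fun_eq_iff power_mult_distrib)
      then have "(\<integral>y. sol_F p d l y \<partial>\<eta>) = (\<integral>y. sol_J p d l y \<partial>\<eta>) + of_real (\<theta>\<^sup>2 / 2) * of_real (\<integral>y. (sol_H y)\<^sup>2 \<partial>\<eta>)"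
        using levy_integrable_sol_J[OF p_pos levy] levy_integrable_sol_H_squared[OF p_pos levy]
        by (simp del: of_real_power)
      then show ?thesis by (simp add: algebra_simps)
    qed
    ultimately show "(\<lambda>n. \<Sum>k\<in>{1..K n}. (?c n k * iexp (- (of_int l / real p ^ d * row_mean n k)) - 1))
        \<longlonglongrightarrow> - of_real (b * (of_int l / real p ^ d)\<^sup>2 / 2) + (\<integral>y. sol_J p d l y \<partial>\<eta>)"
      unfolding \<theta>_def[symmetric] by simp
  qed simp
qed

text \<open>The row means are put back as exp(i \<theta> S), S being their sum. The hypothesis sees
  S only modulo 2 pi p^d, but l is an integer, so exp(i \<theta> S) is the l-th power of a
  convergent sequence and tends to a_d^l.\<close>

lemma tendsto_char_of_row_product:
  assumes a: "a \<in> solenoid p"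
    and mean: "\<And>d. (\<lambda>n. iexp (1 / real p ^ d * (\<Sum>k=1..K n. row_mean n k))) \<longlonglongrightarrow> a d"
  shows "(\<lambda>n. expectation (\<lambda>\<omega>. sol_char d l (sol_prod (\<lambda>k. X n k \<omega>) {1..K n})))
    \<longlonglongrightarrow> sol_char d l a * exp (- of_real (b * (of_int l / real p ^ d)\<^sup>2 / 2)) * exp (\<integral>y. sol_J p d l y \<partial>\<eta>)"
proof -
  define \<theta> where "\<theta> = real_of_int l / real p ^ d"
  let ?c = "\<lambda>n k. expectation (\<lambda>\<omega>. sol_char d l (X n k \<omega>))"
  have "(\<lambda>n. iexp (1 / real p ^ d * (\<Sum>k=1..K n. row_mean n k)) powi l * (\<Prod>k=1..K n. ?c n k * iexp (- (\<theta> * row_mean n k))))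
      \<longlonglongrightarrow> a d powi l * exp (- of_real (b * \<theta>\<^sup>2 / 2) + (\<integral>y. sol_J p d l y \<partial>\<eta>))"
    unfolding \<theta>_def
    by (intro tendsto_mult tendsto_power_int mean solenoid_nonzero[OF a] tendsto_centred_product)
  moreover have "iexp (1 / real p ^ d * (\<Sum>k=1..K n. row_mean n k)) powi l * (\<Prod>k=1..K n. ?c n k * iexp (- (\<theta> * row_mean n k)))
      = expectation (\<lambda>\<omega>. sol_char d l (sol_prod (\<lambda>k. X n k \<omega>) {1..K n}))" for n
  proof -
    have 1: "iexp (1 / real p ^ d * (\<Sum>k=1..K n. row_mean n k)) powi l = iexp (\<theta> * (\<Sum>k=1..K n. row_mean n k))"
    proof -
      have "iexp (1 / real p ^ d * (\<Sum>k=1..K n. row_mean n k)) powi l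
          = cis (of_int l * (1 / real p ^ d * (\<Sum>k=1..K n. row_mean n k)))"
        by (simp only: cis_conv_exp[symmetric] cis_power_int)
      then show ?thesis by (simp add: cis_conv_exp \<theta>_def)
    qed
    have 2: "(\<Prod>k=1..K n. iexp (- (\<theta> * row_mean n k))) = iexp (- (\<theta> * (\<Sum>k=1..K n. row_mean n k)))"
      by (simp add: exp_sum[symmetric] sum_distrib_left sum_negf)
    have 3: "iexp (\<theta> * (\<Sum>k=1..K n. row_mean n k)) * iexp (- (\<theta> * (\<Sum>k=1..K n. row_mean n k))) = 1"
      by (simp add: exp_add[symmetric])
    have "indep_vars (\<lambda>_. borel) (\<lambda>k \<omega>. sol_char d l (X n k \<omega>)) {1..K n}"
      by (rule indep_vars_compose2[OF indep]) simp
    then have "expectation (\<lambda>\<omega>. \<Prod>k\<in>{1..K n}. sol_char d l (X n k \<omega>)) = (\<Prod>k=1..K n. ?c n k)"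
      by (intro indep_vars_lebesgue_integral integrable_X continuous_on_sol_char) auto
    then show ?thesis unfolding sol_char_prod prod.distrib 1 2 using 3 by simp
  qed
  ultimately have "(\<lambda>n. expectation (\<lambda>\<omega>. sol_char d l (sol_prod (\<lambda>k. X n k \<omega>) {1..K n})))
      \<longlonglongrightarrow> a d powi l * exp (- of_real (b * \<theta>\<^sup>2 / 2) + (\<integral>y. sol_J p d l y \<partial>\<eta>))"
    by (simp only:)
  then show ?thesis unfolding exp_add \<theta>_def sol_char_def[of d l a] mult.assoc .
qed

end

section \<open>Infinitesimality and the limit theorem\<close>

lemma dist_one_le_circ_arg:
  assumes "z \<in> circle"
  shows "cmod (z - 1) \<le> \<bar>circ_arg z\<bar>"
proof -
  have "iexp (circ_arg z) = z" unfolding cis_conv_exp[symmetric] by (rule circ_arg(3)[OF assms])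
  then show ?thesis using iexp_approx1[of "circ_arg z" 0] by simp
qed

lemma measurable_circ_arg_event:
  assumes "0 \<le> e" "e < pi"
  shows "{y \<in> solenoid p. \<exists>j\<le>d. e < \<bar>circ_arg (y j)\<bar>} \<in> sets (sol_borel p)"
proof -
  have "{y \<in> space (sol_borel p). \<exists>j\<in>{..d}. Re (y j) < cos e} \<in> sets (sol_borel p)"
    by (intro sets.sets_Collect_finite_Ex) measurable
  also have "{y \<in> space (sol_borel p). \<exists>j\<in>{..d}. Re (y j) < cos e} = {y \<in> solenoid p. \<exists>j\<le>d. e < \<bar>circ_arg (y j)\<bar>}"
    using abs_circ_arg_gt_iff[OF solenoid_circle assms] by auto
  finally show ?thesis .
qed

text \<open>A basic open set of the product topology restricts finitely many coordinates, all with
  index at most d. If these coordinates have argument at most e, they lie in the prescribed balls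
  around 1, since the chord is no longer than the arc.\<close>

lemma borel_nbhd_contains_basic:
  assumes "borel_nbhd p U"
  obtains d e where "0 < e" "e < pi" "solenoid p - U \<subseteq> {y \<in> solenoid p. \<exists>j\<le>d. e < \<bar>circ_arg (y j)\<bar>}"
proof -
  obtain V where V: "openin (top_of_set (solenoid p)) V" "sol_one \<in> V" "V \<subseteq> U"
    using assms unfolding borel_nbhd_def by blast
  then obtain T where T: "open T" "V = solenoid p \<inter> T" by (auto simp: openin_open)
  have "openin (product_topology (\<lambda>_::nat. euclidean :: complex topology) UNIV) T"
    using T(1) by (simp add: euclidean_product_topology)
  then obtain W where W: "sol_one \<in> (\<Pi>\<^sub>E i\<in>UNIV. W i)" "\<And>i. open (W i)" "finite {i. W i \<noteq> UNIV}" "(\<Pi>\<^sub>E i\<in>UNIV. W i) \<subseteq> T"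
    using product_topology_open_contains_basis[of "\<lambda>_::nat. euclidean :: complex topology" UNIV T sol_one] V(2) T(2)
    by auto
  obtain d where d: "\<And>i. W i \<noteq> UNIV \<Longrightarrow> i \<le> d"
    using W(3) finite_nat_set_iff_bounded_le[of "{i. W i \<noteq> UNIV}"] by auto
  have "\<forall>i. \<exists>e>0. ball 1 e \<subseteq> W i"
    using W(1,2) by (auto simp: PiE_iff sol_one_def intro: openE)
  then obtain r where r: "\<And>i. 0 < r i" "\<And>i. ball 1 (r i) \<subseteq> W i" by metis
  \<comment> \<open>Halving makes e strictly smaller than each of the finitely many radii; the cap
    at 1 keeps e below pi, where the event is known to be measurable.\<close>
  define e where "e = min 1 (Min (r ` {..d})) / 2"
  have pos: "0 < Min (r ` {..d})" using r(1) by (subst Min_gr_iff) auto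
  have e: "0 < e" "e < 1" using pos by (auto simp: e_def)
  have er: "e < r i" if "i \<le> d" for i
  proof -
    have "Min (r ` {..d}) \<le> r i" using that by (intro Min_le) auto
    moreover have "e \<le> Min (r ` {..d}) / 2" by (simp add: e_def)
    ultimately show ?thesis using pos by linarith
  qed
  show ?thesis
  proof (rule that[of e d])
    show "e < pi" using e pi_gt3 by linarith
    show "solenoid p - U \<subseteq> {y \<in> solenoid p. \<exists>j\<le>d. e < \<bar>circ_arg (y j)\<bar>}"
    proof (rule subsetI, rule ccontr)
      fix y assume y: "y \<in> solenoid p - U" and "y \<notin> {y \<in> solenoid p. \<exists>j\<le>d. e < \<bar>circ_arg (y j)\<bar>}"
      then have a: "\<bar>circ_arg (y j)\<bar> \<le> e" if "j \<le> d" for j using that by force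
      have "y i \<in> W i" for i
      proof (cases "i \<le> d")
        case True
        have "cmod (y i - 1) < r i"
          using dist_one_le_circ_arg[OF solenoid_circle, of y p i] y a[OF True] er[OF True] by simp
        then have "y i \<in> ball 1 (r i)" by (simp add: dist_norm norm_minus_commute)
        then show ?thesis using r(2) by blast
      next
        case False
        then show ?thesis using d[of i] by auto
      qed
      then have "y \<in> T" using W(4) by (auto simp: PiE_UNIV_domain)
      then show False using y T(2) V(3) by blast
    qed
  qed (rule e(1))
qed

text \<open>A sandwich from row 1 on: there the index set is nonempty, so the maxima are genuine and
  bounded below by 0. For row 0 nothing is known about \<open>K 0\<close>.\<close>

lemma tendsto_Max_prob_mono:
  fixes K :: "nat \<Rightarrow> nat"
  assumes "prob_space M"
    and lim: "(\<lambda>n. MAX k\<in>{1..K n}. measure M (B n k)) \<longlonglongrightarrow> 0"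
    and K: "\<And>n. 1 \<le> n \<Longrightarrow> 1 \<le> K n"
    and B: "\<And>n k. 1 \<le> n \<Longrightarrow> k \<in> {1..K n} \<Longrightarrow> B n k \<in> sets M"
    and sub: "\<And>n k. 1 \<le> n \<Longrightarrow> k \<in> {1..K n} \<Longrightarrow> A n k \<subseteq> B n k"
  shows "(\<lambda>n. MAX k\<in>{1..K n}. measure M (A n k)) \<longlonglongrightarrow> 0"
proof (rule tendsto_sandwich[OF _ _ tendsto_const lim])
  interpret prob_space M by fact
  show "eventually (\<lambda>n. 0 \<le> (MAX k\<in>{1..K n}. measure M (A n k))) sequentially"
    unfolding eventually_sequentially
  proof (intro exI[of _ 1] allI impI)
    fix n :: nat assume n: "1 \<le> n"
    have "0 \<le> measure M (A n 1)" by simp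
    also have "\<dots> \<le> (MAX k\<in>{1..K n}. measure M (A n k))" using K[OF n] by (intro Max_ge) auto
    finally show "0 \<le> (MAX k\<in>{1..K n}. measure M (A n k))" .
  qed
  show "eventually (\<lambda>n. (MAX k\<in>{1..K n}. measure M (A n k)) \<le> (MAX k\<in>{1..K n}. measure M (B n k))) sequentially"
    unfolding eventually_sequentially
  proof (intro exI[of _ 1] allI impI)
    fix n :: nat assume n: "1 \<le> n"
    show "(MAX k\<in>{1..K n}. measure M (A n k)) \<le> (MAX k\<in>{1..K n}. measure M (B n k))"
    proof (intro Max.boundedI)
      fix x assume "x \<in> (\<lambda>k. measure M (A n k)) ` {1..K n}"
      then obtain k where k: "k \<in> {1..K n}" "x = measure M (A n k)" by blast
      have "x \<le> measure M (B n k)" unfolding k(2) by (rule finite_measure_mono[OF sub[OF n k(1)] B[OF n k(1)]])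
      also have "\<dots> \<le> (MAX k\<in>{1..K n}. measure M (B n k))" using k(1) by (intro Max_ge) auto
      finally show "x \<le> (MAX k\<in>{1..K n}. measure M (B n k))" .
    qed (use K[OF n] in auto)
  qed
qed

theorem theorem8p1:
  fixes p :: nat
    and M :: "'w measure"
    and K :: "nat \<Rightarrow> nat"
    and X :: "nat \<Rightarrow> nat \<Rightarrow> 'w \<Rightarrow> nat \<Rightarrow> complex"
    and a :: "nat \<Rightarrow> complex"
    and b :: real
    and \<eta> :: "(nat \<Rightarrow> complex) measure"
  assumes "prime p"
    and "prob_space M"
    and "\<forall>n\<ge>1. K n \<ge> 1"
    and "\<forall>n\<ge>1. prob_space.indep_vars M (\<lambda>k. sol_borel p) (X n) {1..K n}"
    and "a \<in> solenoid p"
    and "b \<ge> 0"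
    and "levy_measure p \<eta>"
    and "\<forall>d. \<forall>\<epsilon>>0.
           (\<lambda>n. MAX k\<in>{1..K n}.
                  measure M {\<omega> \<in> space M. \<exists>j\<le>d. \<bar>circ_arg (X n k \<omega> j)\<bar> > \<epsilon>}) \<longlonglongrightarrow> 0"
    and "\<forall>d. (\<lambda>n. exp (\<i> / of_nat p ^ d *
                  of_real (\<Sum>k=1..K n. prob_space.expectation M (\<lambda>\<omega>. h_fun (circ_arg (X n k \<omega> 0))))))
           \<longlonglongrightarrow> a d"
    and "(\<lambda>n. \<Sum>k=1..K n. prob_space.variance M (\<lambda>\<omega>. h_fun (circ_arg (X n k \<omega> 0))))
           \<longlonglongrightarrow> b + (\<integral>y. (h_fun (circ_arg (y 0)))\<^sup>2 \<partial>\<eta>)"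
    and "\<forall>f\<in>C0_sol p.
           (\<lambda>n. \<Sum>k=1..K n. prob_space.expectation M (\<lambda>\<omega>. f (X n k \<omega>))) \<longlonglongrightarrow> (\<integral>y. f y \<partial>\<eta>)"
  shows "infinitesimal p M K X \<and>
         sol_weak_conv p
           (\<lambda>n. distr M (sol_borel p) (\<lambda>\<omega>. sol_prod (\<lambda>k. X n k \<omega>) {1..K n}))
           (sol_conv p (sol_conv p (return (sol_borel p) a) (gauss_sol p b)) (gen_poisson_sol p \<eta>))"
proof -
  interpret prob_space M by fact
  have p: "0 < p" using \<open>prime p\<close> by (rule prime_gt_0_nat)
  note levy = \<open>levy_measure p \<eta>\<close>
  have X_meas: "X n k \<in> measurable M (sol_borel p)" if "1 \<le> n" "k \<in> {1..K n}" for n k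
    using assms(4) that unfolding indep_vars_def by blast
  have X_in: "X n k \<omega> \<in> solenoid p" if "1 \<le> n" "k \<in> {1..K n}" "\<omega> \<in> space M" for n k \<omega>
    using measurable_space[OF X_meas[OF that(1,2)] that(3)] by simp
  \<comment> \<open>Condition (i) in the form used twice: for the complement of a neighbourhood of
    the identity and for the distance events required by \<open>sol_array\<close>.\<close>
  have small: "(\<lambda>n. MAX k\<in>{1..K n}. prob (A n k)) \<longlonglongrightarrow> 0"
    if e: "0 < e" "e < pi" and
      A: "\<And>n k. 1 \<le> n \<Longrightarrow> k \<in> {1..K n} \<Longrightarrow> A n k \<subseteq> {\<omega> \<in> space M. \<exists>j\<le>d. e < \<bar>circ_arg (X n k \<omega> j)\<bar>}"
    for A e d
  proof (rule tendsto_Max_prob_mono[OF assms(2)])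
    show "(\<lambda>n. MAX k\<in>{1..K n}. prob {\<omega> \<in> space M. \<exists>j\<le>d. e < \<bar>circ_arg (X n k \<omega> j)\<bar>}) \<longlonglongrightarrow> 0"
      using assms(8) e(1) by blast
    show "{\<omega> \<in> space M. \<exists>j\<le>d. e < \<bar>circ_arg (X n k \<omega> j)\<bar>} \<in> events" if n: "1 \<le> n" "k \<in> {1..K n}" for n k
    proof -
      have "X n k -` {y \<in> solenoid p. \<exists>j\<le>d. e < \<bar>circ_arg (y j)\<bar>} \<inter> space M \<in> events"
        using e by (intro measurable_sets[OF X_meas[OF n]] measurable_circ_arg_event) auto
      also have "X n k -` {y \<in> solenoid p. \<exists>j\<le>d. e < \<bar>circ_arg (y j)\<bar>} \<inter> space M
          = {\<omega> \<in> space M. \<exists>j\<le>d. e < \<bar>circ_arg (X n k \<omega> j)\<bar>}"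
        using X_in[OF n] by auto
      finally show ?thesis .
    qed
  qed (use assms(3) A in auto)
  have "infinitesimal p M K X"
    unfolding infinitesimal_def
  proof (intro allI impI)
    fix U assume "borel_nbhd p U"
    then obtain d e where de: "0 < e" "e < pi"
      "solenoid p - U \<subseteq> {y \<in> solenoid p. \<exists>j\<le>d. e < \<bar>circ_arg (y j)\<bar>}"
      by (rule borel_nbhd_contains_basic)
    show "(\<lambda>n. MAX k\<in>{1..K n}. prob {\<omega> \<in> space M. X n k \<omega> \<in> solenoid p - U}) \<longlonglongrightarrow> 0"
      by (rule small[of e _ d, OF de(1,2)]) (use de(3) in blast)
  qed
  moreover have "sol_weak_conv p
           (\<lambda>n. distr M (sol_borel p) (\<lambda>\<omega>. sol_prod (\<lambda>k. X n k \<omega>) {1..K n}))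
           (sol_conv p (sol_conv p (return (sol_borel p) a) (gauss_sol p b)) (gen_poisson_sol p \<eta>))"
  proof -
    have H_X: "h_fun (circ_arg (X n k \<omega> 0)) = sol_H (X n k \<omega>)" if "1 \<le> n" "k \<in> {1..K n}" "\<omega> \<in> space M" for n k \<omega>
      by (rule h_fun_solenoid[OF X_in[OF that]])
    have eH: "expectation (\<lambda>\<omega>. h_fun (circ_arg (X n k \<omega> 0))) = expectation (\<lambda>\<omega>. sol_H (X n k \<omega>))"
      if "1 \<le> n" "k \<in> {1..K n}" for n k
      by (rule Bochner_Integration.integral_cong[OF refl]) (rule H_X[OF that])
    have vH: "variance (\<lambda>\<omega>. h_fun (circ_arg (X n k \<omega> 0))) = variance (\<lambda>\<omega>. sol_H (X n k \<omega>))"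
      if "1 \<le> n" "k \<in> {1..K n}" for n k
      unfolding eH[OF that] by (rule Bochner_Integration.integral_cong[OF refl]) (simp only: H_X[OF that])
    have iH: "(\<integral>y. (h_fun (circ_arg (y 0)))\<^sup>2 \<partial>\<eta>) = (\<integral>y. (sol_H y)\<^sup>2 \<partial>\<eta>)"
      by (rule Bochner_Integration.integral_cong[OF refl])
        (simp add: h_fun_solenoid space_eq_solenoid[OF levy_measure_sets[OF levy]])
    \<comment> \<open>The hypotheses hold for rows n >= 1, so the array is read with its row index
      shifted by one.\<close>
    interpret A: sol_array M p "\<lambda>n. K (Suc n)" "\<lambda>n. X (Suc n)" b \<eta>
    proof
      show "indep_vars (\<lambda>k. sol_borel p) (X (Suc n)) {1..K (Suc n)}" for n using assms(4) by simp
      show "(\<lambda>n. MAX k\<in>{1..K (Suc n)}. prob {\<omega> \<in> space M. \<delta> \<le> cmod (X (Suc n) k \<omega> d - 1)}) \<longlonglongrightarrow> 0"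
        if \<delta>: "0 < \<delta>" for d \<delta>
      proof (rule LIMSEQ_Suc, rule small[of "min 1 (\<delta> / 2)" _ d])
        \<comment> \<open>The threshold must be below pi and strictly below \<delta>, because the
          distance is only known to be at least \<delta> and the event asks for a strict inequality
          on the argument.\<close>
        show "min 1 (\<delta> / 2) < pi" using pi_gt3 by linarith
        fix n k assume n: "1 \<le> n" "k \<in> {1..K n}"
        show "{\<omega> \<in> space M. \<delta> \<le> cmod (X n k \<omega> d - 1)}
            \<subseteq> {\<omega> \<in> space M. \<exists>j\<le>d. min 1 (\<delta> / 2) < \<bar>circ_arg (X n k \<omega> j)\<bar>}"
        proof safe
          fix \<omega> assume \<omega>: "\<omega> \<in> space M" "\<delta> \<le> cmod (X n k \<omega> d - 1)"
          have "cmod (X n k \<omega> d - 1) \<le> \<bar>circ_arg (X n k \<omega> d)\<bar>"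
            by (rule dist_one_le_circ_arg[OF solenoid_circle[OF X_in[OF n \<omega>(1)]]])
          then have "min 1 (\<delta> / 2) < \<bar>circ_arg (X n k \<omega> d)\<bar>" using \<omega>(2) \<delta> by linarith
          then show "\<exists>j\<le>d. min 1 (\<delta> / 2) < \<bar>circ_arg (X n k \<omega> j)\<bar>" by blast
        qed
      qed (use \<delta> in simp)
      show "(\<lambda>n. \<Sum>k=1..K (Suc n). variance (\<lambda>\<omega>. sol_H (X (Suc n) k \<omega>))) \<longlonglongrightarrow> b + (\<integral>y. (sol_H y)\<^sup>2 \<partial>\<eta>)"
        using LIMSEQ_Suc[OF assms(10)] vH[of "Suc _"] by (simp add: iH)
      show "(\<lambda>n. \<Sum>k=1..K (Suc n). expectation (\<lambda>\<omega>. f (X (Suc n) k \<omega>))) \<longlonglongrightarrow> (\<integral>y. f y \<partial>\<eta>)"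
        if "f \<in> C0_sol p" for f
        using LIMSEQ_Suc[OF assms(11)[rule_format, OF that]] .
    qed (use p levy assms(3) in auto)
    have mean: "(\<lambda>n. iexp (1 / real p ^ d * (\<Sum>k=1..K (Suc n). A.row_mean n k))) \<longlonglongrightarrow> a d" for d
    proof -
      have "(\<Sum>k=1..K (Suc n). expectation (\<lambda>\<omega>. h_fun (circ_arg (X (Suc n) k \<omega> 0)))) = (\<Sum>k=1..K (Suc n). A.row_mean n k)" for n
        by (intro sum.cong refl) (simp add: eH A.row_mean_def)
      then have "(\<lambda>n. exp (\<i> / of_nat p ^ d * of_real (\<Sum>k=1..K (Suc n). A.row_mean n k))) \<longlonglongrightarrow> a d"
        using LIMSEQ_Suc[OF assms(9)[rule_format, of d]] by simp
      then show ?thesis by simp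
    qed
    let ?\<mu> = "\<lambda>n. distr M (sol_borel p) (\<lambda>\<omega>. sol_prod (\<lambda>k. X n k \<omega>) {1..K n})"
    let ?\<nu>1 = "sol_conv p (return (sol_borel p) a) (gauss_sol p b)"
    let ?\<nu> = "sol_conv p ?\<nu>1 (gen_poisson_sol p \<eta>)"
    have meas: "(\<lambda>\<omega>. sol_prod (\<lambda>k. X n k \<omega>) {1..K n}) \<in> measurable M (sol_borel p)" if n: "1 \<le> n" for n
    proof (rule measurable_sol_borelI)
      show "(\<lambda>\<omega>. sol_prod (\<lambda>k. X n k \<omega>) {1..K n} j) \<in> borel_measurable M" for j
        unfolding sol_prod_def
        by (rule borel_measurable_prod) (rule measurable_compose[OF X_meas[OF n] measurable_sol_coord])
    qed (intro sol_prod_in X_in[OF n])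
    note r = prob_space_return_sol[OF \<open>a \<in> solenoid p\<close>] sets_return
    note g = prob_space_gauss_sol[OF p \<open>0 \<le> b\<close>] sets_gauss_sol[OF p \<open>0 \<le> b\<close>]
    note g' = prob_space_gen_poisson_sol[OF p levy] sets_gen_poisson_sol[OF p levy]
    note \<nu>1 = prob_space_sol_conv[OF r g] sets_sol_conv[OF r g]
    have "sol_weak_conv p (\<lambda>n. ?\<mu> (Suc n)) ?\<nu>"
    proof (rule sol_weak_convI)
      show "prob_space (?\<mu> (Suc n))" for n by (intro prob_space_distr meas) simp
      show "prob_space ?\<nu>" "sets ?\<nu> = sets (sol_borel p)"
        by (rule prob_space_sol_conv[OF \<nu>1 g'], rule sets_sol_conv[OF \<nu>1 g'])
      fix d l
      have "(\<integral>y. sol_char d l y \<partial>?\<nu>) = sol_char d l a * of_real (exp (- b * (of_int l)\<^sup>2 / (2 * of_nat p ^ (2 * d))))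
          * exp (\<integral>y. sol_J p d l y \<partial>\<eta>)"
        unfolding integral_sol_char_sol_conv[OF \<nu>1 g'] integral_sol_char_sol_conv[OF r g]
          integral_sol_char_return[OF \<open>a \<in> solenoid p\<close>] integral_sol_char_gauss_sol[OF p \<open>0 \<le> b\<close>]
          integral_sol_char_gen_poisson_sol[OF p levy] ..
      also have "of_real (exp (- b * (of_int l)\<^sup>2 / (2 * of_nat p ^ (2 * d))))
          = exp (- of_real (b * (of_int l / real p ^ d)\<^sup>2 / 2) :: complex)"
        unfolding exp_of_real[symmetric] of_real_minus[symmetric]
        by (simp add: power_divide power_mult mult.commute)
      finally have eq: "(\<integral>y. sol_char d l y \<partial>?\<nu>) = sol_char d l a
          * exp (- of_real (b * (of_int l / real p ^ d)\<^sup>2 / 2)) * exp (\<integral>y. sol_J p d l y \<partial>\<eta>)" .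
      have "(\<integral>y. sol_char d l y \<partial>?\<mu> (Suc n))
          = expectation (\<lambda>\<omega>. sol_char d l (sol_prod (\<lambda>k. X (Suc n) k \<omega>) {1..K (Suc n)}))" for n
        by (rule integral_distr[OF meas measurable_sol_char]) simp
      then show "(\<lambda>n. \<integral>y. sol_char d l y \<partial>?\<mu> (Suc n)) \<longlonglongrightarrow> (\<integral>y. sol_char d l y \<partial>?\<nu>)"
        unfolding eq using A.tendsto_char_of_row_product[OF \<open>a \<in> solenoid p\<close> mean, of d l] by (simp only:)
    qed simp
    \<comment> \<open>Weak convergence was proved for the shifted sequence, as the law at n = 0 need
      not be a probability measure; the limit of each integral is unaffected by undoing the
      shift.\<close>
    note weak = this[unfolded sol_weak_conv_def, rule_format]
    show ?thesis
      unfolding sol_weak_conv_def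
    proof (intro allI impI)
      fix f :: "(nat \<Rightarrow> complex) \<Rightarrow> real"
      assume "continuous_on (solenoid p) f \<and> bounded (f ` solenoid p)"
      from weak[OF this] show "(\<lambda>n. \<integral>y. f y \<partial>?\<mu> n) \<longlonglongrightarrow> (\<integral>y. f y \<partial>?\<nu>)"
        by (rule LIMSEQ_imp_Suc)
    qed
  qed
  ultimately show ?thesis ..
qed

end
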